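(* Let $F$ be a field of characteristic $p$, let $K/F$ be a purely inseparable field extension of exponent one, and let $\delta$ be an algebraic derivation on $K$ with ${\rm Const}(\delta)=F$ and minimum polynomial $g(t)=t^{p^e}+c_1t^{p^{e-1}}+\dots+c_et\in F[t]$. Let $R=K[t;\delta]$ and $x=g(t)$, and let $N$ be the reduced norm of the central simple $F(x)$-algebra $K(t;\delta)$. (i) For all $f\in R$ we have $N(f)\in F[x]$, and $f$ divides $N(f)$ in $R$. (ii) If $f(t)=a_0+a_1t+\dots+a_mt^m\in R$ has degree $m$, then $$N(f(t))=(-1)^{m(p^e-1)}a_m^{p^e}x^m+\dots,$$ where the omitted terms have degree less than $m$ in $x$.
   Context: ${\rm Const}(\delta)=\{a\in K:\delta(a)=0\}$; $[K:F]=p^e$. $K[t;\delta]$ is the ring of polynomials $\sum a_it^i$, $a_i\in K$, with $ta=at+\delta(a)$ for $a\in K$. Its center is $F[x]$, $x=g(t)$. The ring of central quotients $K(t;\delta)=\{f/q: f\in R,\ 0\neq q\in F[x]\}$ is a central simple algebra of degree $p^e$ over $F(x)$, free as a left $K(x)$-module on $1,t,\dots,t^{p^e-1}$; $N$ is its reduced norm. "$f$ divides $N(f)$ in $R$" means $N(f)=qf=fq$ for some $q\in R$. *)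

theory Defs
  imports
    "HOL-Algebra.Embedded_Algebras"
    "HOL-Computational_Algebra.Fraction_Field"
    "HOL-Computational_Algebra.Polynomial"
    "Jordan_Normal_Form.Determinant"
    "Jordan_Normal_Form.VS_Connect"
begin

definition is_derivation :: "('k::field \<Rightarrow> 'k) \<Rightarrow> bool" where
  "is_derivation \<delta> \<longleftrightarrow>
     (\<forall>a b. \<delta> (a + b) = \<delta> a + \<delta> b) \<and> (\<forall>a b. \<delta> (a * b) = \<delta> a * b + a * \<delta> b)"

definition Const :: "('k::field \<Rightarrow> 'k) \<Rightarrow> 'k set" where
  "Const \<delta> = {a. \<delta> a = 0}"

definition polys_over :: "'k::field set \<Rightarrow> 'k poly set" where
  "polys_over F = {h. set (coeffs h) \<subseteq> F}"

text \<open>The additive map \<open>h(\<delta>)\<close>, where \<open>t\<^sup>i\<close> is replaced by the \<open>i\<close>-th iterate of \<open>\<delta>\<close>.\<close>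

definition poly_at_map :: "'k::field poly \<Rightarrow> ('k \<Rightarrow> 'k) \<Rightarrow> 'k \<Rightarrow> 'k" where
  "poly_at_map h \<delta> a = (\<Sum>i\<le>degree h. coeff h i * (\<delta> ^^ i) a)"

definition algebraic_derivation :: "'k::field set \<Rightarrow> ('k \<Rightarrow> 'k) \<Rightarrow> bool" where
  "algebraic_derivation F \<delta> \<longleftrightarrow>
     is_derivation \<delta> \<and> (\<exists>h \<in> polys_over F. h \<noteq> 0 \<and> (\<forall>a. poly_at_map h \<delta> a = 0))"

definition is_minimum_polynomial :: "'k::field set \<Rightarrow> ('k \<Rightarrow> 'k) \<Rightarrow> 'k poly \<Rightarrow> bool" where
  "is_minimum_polynomial F \<delta> g \<longleftrightarrow>
     g \<in> polys_over F \<and> lead_coeff g = 1 \<and> (\<forall>a. poly_at_map g \<delta> a = 0) \<and>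
     (\<forall>h \<in> polys_over F. h \<noteq> 0 \<longrightarrow> (\<forall>a. poly_at_map h \<delta> a = 0) \<longrightarrow> degree g \<le> degree h)"

text \<open>The whole type \<open>'k\<close> is a purely inseparable extension of the subfield \<open>F\<close> whose exponent
  (the least \<open>n\<close> such that all \<open>p\<^sup>n\<close>-th powers lie in \<open>F\<close>) is exactly one.\<close>

definition purely_inseparable_exponent_one :: "'k::field set \<Rightarrow> bool" where
  "purely_inseparable_exponent_one F \<longleftrightarrow>
     (\<forall>a. a ^ CHAR('k) \<in> F) \<and> \<not> (\<forall>a. a \<in> F)"

text \<open>The differential polynomial ring \<open>K[t;\<delta>]\<close> has the additive group of \<^typ>\<open>'k poly\<close>, with
  coefficients written on the left of the powers of \<open>t = [:0, 1:]\<close>; only the multiplication is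
  twisted. Since \<open>t b = b t + \<delta> b\<close>, left multiplication by \<open>t\<close> is the map \<open>t_times \<delta>\<close>.
  Beware that \<open>*\<close> and \<open>^\<close> on \<^typ>\<open>'k poly\<close> are not the operations of this ring.\<close>

definition t_times :: "('k::field \<Rightarrow> 'k) \<Rightarrow> 'k poly \<Rightarrow> 'k poly" where
  "t_times \<delta> q = pCons 0 q + map_poly \<delta> q"

definition diff_poly_mult :: "('k::field \<Rightarrow> 'k) \<Rightarrow> 'k poly \<Rightarrow> 'k poly \<Rightarrow> 'k poly" where
  "diff_poly_mult \<delta> f q = (\<Sum>i\<le>degree f. Polynomial.smult (coeff f i) ((t_times \<delta> ^^ i) q))"

definition diff_poly_ring :: "('k::field \<Rightarrow> 'k) \<Rightarrow> 'k poly ring" where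
  "diff_poly_ring \<delta> =
     \<lparr> carrier = UNIV, mult = diff_poly_mult \<delta>, one = 1, zero = 0, add = (+) \<rparr>"

text \<open>The element \<open>h(x)\<close> of \<open>K[t;\<delta>]\<close>, and the subring \<open>F[x]\<close>.\<close>

definition poly_at :: "('k::field \<Rightarrow> 'k) \<Rightarrow> 'k poly \<Rightarrow> 'k poly \<Rightarrow> 'k poly" where
  "poly_at \<delta> x h =
     (\<Sum>i\<le>degree h. [:coeff h i:] \<otimes>\<^bsub>diff_poly_ring \<delta>\<^esub> (x [^]\<^bsub>diff_poly_ring \<delta>\<^esub> i))"

definition polys_in :: "('k::field \<Rightarrow> 'k) \<Rightarrow> 'k set \<Rightarrow> 'k poly \<Rightarrow> 'k poly set" where
  "polys_in \<delta> F x = poly_at \<delta> x ` polys_over F"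

text \<open>Rings of fractions \<open>f/q\<close> of a ring \<open>R\<close> with \<open>q\<close> in a multiplicative set \<open>S\<close> of central
  elements that are not zero divisors (so that \<open>f/q = f'/q'\<close> iff \<open>f q' = f' q\<close>).\<close>

definition frac_rel ::
    "('a, 'b) ring_scheme \<Rightarrow> 'a set \<Rightarrow> (('a \<times> 'a) \<times> ('a \<times> 'a)) set" where
  "frac_rel R S = {((f, q), (f', q')). f \<in> carrier R \<and> f' \<in> carrier R \<and> q \<in> S \<and> q' \<in> S \<and>
     f \<otimes>\<^bsub>R\<^esub> q' = f' \<otimes>\<^bsub>R\<^esub> q}"

definition frac :: "('a, 'b) ring_scheme \<Rightarrow> 'a set \<Rightarrow> 'a \<Rightarrow> 'a \<Rightarrow> ('a \<times> 'a) set" where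
  "frac R S f q = frac_rel R S `` {(f, q)}"

definition fraction_ring :: "('a, 'b) ring_scheme \<Rightarrow> 'a set \<Rightarrow> ('a \<times> 'a) set ring" where
  "fraction_ring R S =
     \<lparr> carrier = (carrier R \<times> S) // frac_rel R S,
       mult = (\<lambda>X Y. \<Union>(f, q) \<in> X. \<Union>(f', q') \<in> Y. frac R S (f \<otimes>\<^bsub>R\<^esub> f') (q \<otimes>\<^bsub>R\<^esub> q')),
       one = frac R S \<one>\<^bsub>R\<^esub> \<one>\<^bsub>R\<^esub>,
       zero = frac R S \<zero>\<^bsub>R\<^esub> \<one>\<^bsub>R\<^esub>,
       add = (\<lambda>X Y. \<Union>(f, q) \<in> X. \<Union>(f', q') \<in> Y.
                frac R S ((f \<otimes>\<^bsub>R\<^esub> q') \<oplus>\<^bsub>R\<^esub> (f' \<otimes>\<^bsub>R\<^esub> q)) (q \<otimes>\<^bsub>R\<^esub> q')) \<rparr>"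

text \<open>\<open>K(t;\<delta>)\<close>, its subfield \<open>F(x)\<close>, and the canonical embedding of \<open>K[t;\<delta>]\<close>.\<close>

definition central_quotients ::
    "('k::field \<Rightarrow> 'k) \<Rightarrow> 'k set \<Rightarrow> 'k poly \<Rightarrow> ('k poly \<times> 'k poly) set ring" where
  "central_quotients \<delta> F x = fraction_ring (diff_poly_ring \<delta>) (polys_in \<delta> F x - {0})"

definition central_fractions ::
    "('k::field \<Rightarrow> 'k) \<Rightarrow> 'k set \<Rightarrow> 'k poly \<Rightarrow> ('k poly \<times> 'k poly) set set" where
  "central_fractions \<delta> F x =
     {frac (diff_poly_ring \<delta>) (polys_in \<delta> F x - {0}) f q | f q.
        f \<in> polys_in \<delta> F x \<and> q \<in> polys_in \<delta> F x - {0}}"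

definition embed ::
    "('k::field \<Rightarrow> 'k) \<Rightarrow> 'k set \<Rightarrow> 'k poly \<Rightarrow> 'k poly \<Rightarrow> ('k poly \<times> 'k poly) set" where
  "embed \<delta> F x f = frac (diff_poly_ring \<delta>) (polys_in \<delta> F x - {0}) f 1"

definition is_basis :: "('a, 'b) ring_scheme \<Rightarrow> 'a set \<Rightarrow> 'a list \<Rightarrow> bool" where
  "is_basis A k Us \<longleftrightarrow>
     set Us \<subseteq> carrier A \<and> ring.independent A k Us \<and> ring.Span A k Us = carrier A"

text \<open>Let \<open>A\<close> be a central simple algebra of degree \<open>n\<close> over its subfield \<open>k\<close>. A splitting over the
  field \<open>'e\<close> consists of a field embedding \<open>\<iota> : k \<rightarrow> 'e\<close> and an isomorphism of \<open>'e\<close>-algebras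
  from the scalar extension of \<open>A\<close> along \<open>\<iota>\<close> to the \<open>n \<times> n\<close> matrices over \<open>'e\<close>. The latter is
  given by its restriction \<open>\<phi>\<close> to \<open>A\<close>: a \<open>k\<close>-algebra homomorphism whose \<open>'e\<close>-linear extension is
  bijective, that is, which sends a \<open>k\<close>-basis of \<open>A\<close> to an \<open>'e\<close>-basis of the matrices.\<close>

definition is_splitting ::
    "('a, 'b) ring_scheme \<Rightarrow> 'a set \<Rightarrow> nat \<Rightarrow> ('a \<Rightarrow> 'e::field) \<Rightarrow> ('a \<Rightarrow> 'e mat) \<Rightarrow> bool" where
  "is_splitting A k n \<iota> \<phi> \<longleftrightarrow>
     \<iota> \<in> Ring.ring_hom (A\<lparr>carrier := k\<rparr>) (class_ring :: 'e ring) \<and>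
     \<phi> \<in> Ring.ring_hom A (ring_mat TYPE('e) n ()) \<and>
     (\<forall>c \<in> k. \<phi> c = \<iota> c \<cdot>\<^sub>m 1\<^sub>m n) \<and>
     (\<exists>Us. is_basis A k Us \<and>
        is_basis (ring_mat TYPE('e) n ()) (range (\<lambda>c. c \<cdot>\<^sub>m 1\<^sub>m n)) (map \<phi> Us))"

text \<open>The reduced norm of \<open>a\<close> is the element of \<open>k\<close> that becomes \<open>det (\<phi> a)\<close> in a splitting field.
  It does not depend on the splitting; the type argument only says in which type the splitting
  field is sought.\<close>

definition reduced_norm ::
    "'e::field itself \<Rightarrow> ('a, 'b) ring_scheme \<Rightarrow> 'a set \<Rightarrow> nat \<Rightarrow> 'a \<Rightarrow> 'a" where
  "reduced_norm E A k n a =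
     (THE c. c \<in> k \<and>
        (\<exists>(\<iota> :: 'a \<Rightarrow> 'e) \<phi>. is_splitting A k n \<iota> \<phi> \<and> \<iota> c = det (\<phi> a)))"

end

(*
  Write n = p^e. Since x is central and monic of degree n, the ring R is a free left K[x]-module on
  1, t, ..., t^(n-1), and right multiplication by f has a matrix M(f) over K[x] with M(fg) = M(f) M(g).
  The determinant of M(f) is the reduced norm:

  - Left multiplication by t shows that the derivative of M(f) is a commutator, so Jacobi's formula
    gives delta(det M(f)) = 0, that is, det M(f) lies in F[x].
  - The first row of the adjugate matrix yields q with q f = det M(f).
  - Comparing degrees in t, only a cyclic shift contributes to the leading coefficient.
  - M splits K(t;delta) over K(x): the matrix units are combinations of the M(t^a b t^c) because
    1, delta, ..., delta^(n-1) are linearly independent over K.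
  - Given any other splitting phi over some iota, compose with the Frobenius map. The commuting
    matrices phi(b) with b in K then have eigenvalues in the field, because b^p lies in F; a common
    eigenvector conjugates phi to M, so that det(phi f)^p = iota(det M(f))^p.
*)

theory Submission
  imports Defs
begin

section \<open>Differential polynomials\<close>

text \<open>The reduced norm is defined through every splitting over the field of fractions of K[x],
  with an arbitrary embedding of F(x). Two splittings with different embeddings are not conjugate in
  general, which is why the comparison goes through p-th powers. Nothing is lost there, since p-th
  roots are unique in characteristic p.

  The shape of g enters through centrality. Its exponents are powers of p, and delta^(p^i) is again
  a derivation, so g(t) b = b g(t) + g(delta)(b) for b in K, where the last term is 0. Minimality of
  g is only assumed among polynomials over F. It extends to polynomials over K, because
  differentiating the coefficients of a monic annihilator gives an annihilator of smaller degree.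

  The sign in the leading coefficient is always 1 in K: either n is odd, or p = 2.\<close>

locale derivation =
  fixes \<delta> :: "'k::field \<Rightarrow> 'k"
  assumes is_derivation: "is_derivation \<delta>"
begin

lemma deriv_add: "\<delta> (a + b) = \<delta> a + \<delta> b"
  and deriv_mult: "\<delta> (a * b) = \<delta> a * b + a * \<delta> b"
  using is_derivation by (auto simp: is_derivation_def)

lemma deriv_0 [simp]: "\<delta> 0 = 0"
  using deriv_add[of 0 0] by (metis add_cancel_left_right add_0)

lemma deriv_1 [simp]: "\<delta> 1 = 0"
  using deriv_mult[of 1 1] by (metis add_cancel_left_right mult_1 mult_1_right)

lemma deriv_sum: "\<delta> (\<Sum>i\<in>A. f i) = (\<Sum>i\<in>A. \<delta> (f i))"
  by (induction A rule: infinite_finite_induct) (simp_all add: deriv_add)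

lemma deriv_iter_0 [simp]: "(\<delta> ^^ i) 0 = 0"
  by (induction i) simp_all

lemma deriv_iter_add: "(\<delta> ^^ i) (a + b) = (\<delta> ^^ i) a + (\<delta> ^^ i) b"
  by (induction i) (simp_all add: deriv_add)

lemma deriv_iter_sum: "(\<delta> ^^ k) (\<Sum>i\<in>A. f i) = (\<Sum>i\<in>A. (\<delta> ^^ k) (f i))"
  by (induction A rule: infinite_finite_induct) (simp_all add: deriv_iter_add)

lemma deriv_iter_const_mult: "\<delta> c = 0 \<Longrightarrow> (\<delta> ^^ i) (c * a) = c * (\<delta> ^^ i) a"
  by (induction i) (simp_all add: deriv_mult)

abbreviation T where "T \<equiv> t_times \<delta>"

abbreviation dmult (infixl "\<star>" 70) where "f \<star> q \<equiv> diff_poly_mult \<delta> f q"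

abbreviation R where "R \<equiv> diff_poly_ring \<delta>"

lemma map_poly_deriv_add: "map_poly \<delta> (f + q) = map_poly \<delta> f + map_poly \<delta> q"
  by (rule poly_eqI) (simp add: coeff_map_poly deriv_add)

lemma map_poly_deriv_smult:
  "map_poly \<delta> (Polynomial.smult a q) = Polynomial.smult a (map_poly \<delta> q) + Polynomial.smult (\<delta> a) q"
  by (rule poly_eqI) (simp add: coeff_map_poly deriv_mult)

lemma map_poly_deriv_1 [simp]: "map_poly \<delta> 1 = 0"
  by (rule poly_eqI) (simp add: coeff_map_poly)

lemma map_poly_deriv_sum: "map_poly \<delta> (\<Sum>i\<in>A. f i) = (\<Sum>i\<in>A. map_poly \<delta> (f i))"
  by (induction A rule: infinite_finite_induct) (simp_all add: map_poly_deriv_add)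

lemma map_poly_deriv_mult: "map_poly \<delta> (f * q) = map_poly \<delta> f * q + f * map_poly \<delta> q"
  by (rule poly_eqI)
    (simp add: coeff_map_poly coeff_mult deriv_sum deriv_mult sum.distrib)

lemma T_add: "T (f + q) = T f + T q"
  by (simp add: t_times_def map_poly_deriv_add)

lemma T_0 [simp]: "T 0 = 0"
  by (simp add: t_times_def)

lemma T_smult: "T (Polynomial.smult a q) = Polynomial.smult a (T q) + Polynomial.smult (\<delta> a) q"
  by (simp add: t_times_def map_poly_deriv_smult smult_add_right algebra_simps)

lemma T_iter_add: "(T ^^ i) (f + q) = (T ^^ i) f + (T ^^ i) q"
  by (induction i) (simp_all add: T_add)

lemma T_iter_0 [simp]: "(T ^^ i) 0 = 0"
  by (induction i) simp_all

lemma dmult_eq_sum: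
  assumes "degree f \<le> m"
  shows "f \<star> q = (\<Sum>i\<le>m. Polynomial.smult (coeff f i) ((T ^^ i) q))"
  unfolding diff_poly_mult_def
  using assms by (intro sum.mono_neutral_left) (auto simp: coeff_eq_0)

lemma dmult_add_left: "(f + f') \<star> q = f \<star> q + f' \<star> q"
  using degree_add_le_max[of f f']
  by (simp add: dmult_eq_sum[of _ "max (degree f) (degree f')"] smult_add_left sum.distrib)

lemma dmult_add_right: "f \<star> (q + q') = f \<star> q + f \<star> q'"
  by (simp add: diff_poly_mult_def T_iter_add smult_add_right sum.distrib)

lemma dmult_smult_left: "Polynomial.smult a f \<star> q = Polynomial.smult a (f \<star> q)"
  by (rule poly_eqI) (simp add: dmult_eq_sum[of _ "degree f"] coeff_sum sum_distrib_left mult.assoc)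

lemma dmult_0_left [simp]: "0 \<star> q = 0"
  and dmult_0_right [simp]: "f \<star> 0 = 0"
  by (simp_all add: diff_poly_mult_def)

text \<open>Right multiplication by t is a plain shift of coefficients, so \<open>pCons a f\<close>
  is a + f t. The resulting recursion drives all inductions over the left factor.\<close>

lemma dmult_pCons: "pCons a f \<star> q = Polynomial.smult a q + f \<star> T q"
proof -
  have "pCons a f \<star> q = (\<Sum>i\<le>Suc (degree f). Polynomial.smult (coeff (pCons a f) i) ((T ^^ i) q))"
    by (rule dmult_eq_sum) (simp add: degree_pCons_le)
  also have "\<dots> = Polynomial.smult a q + f \<star> T q"
    unfolding sum.atMost_Suc_shift diff_poly_mult_def by (simp add: funpow_swap1)
  finally show ?thesis .
qed

lemma dmult_const_left [simp]: "[:a:] \<star> q = Polynomial.smult a q"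
  by (simp add: dmult_pCons)

lemma T_pCons: "T (pCons a f) = pCons (\<delta> a) ([:a:] + T f)"
  by (simp add: t_times_def map_poly_pCons)

text \<open>Associativity when the first factor is t; the general case follows by building the first
  factor from constants and t.\<close>

lemma T_dmult: "T f \<star> q = T (f \<star> q)"
proof (induction f arbitrary: q)
  case (pCons a f)
  then show ?case
    by (simp add: T_pCons dmult_pCons T_add T_smult dmult_add_left algebra_simps)
qed simp

lemma dmult_assoc: "f \<star> q \<star> r = f \<star> (q \<star> r)"
  by (induction f arbitrary: q)
    (simp_all add: dmult_pCons dmult_add_left dmult_smult_left T_dmult)

lemma T_monom: "T (monom 1 k) = monom 1 (Suc k)"
  by (rule poly_eqI) (auto simp: t_times_def coeff_map_poly coeff_pCons split: nat.splits)

text \<open>Nothing has to be moved past a power of t that stands on the right. This is what permits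
  the ordinary \<open>*\<close> in expansions with coefficients on the left.\<close>

lemma dmult_monom_right: "f \<star> monom 1 k = f * monom 1 k"
proof (induction f arbitrary: k)
  case (pCons a f)
  show ?case
    using pCons.IH[of "Suc k"] by (simp only: dmult_pCons T_monom) (simp add: monom_Suc)
qed simp

lemma dmult_t_left: "monom 1 1 \<star> f = T f"
  by (simp add: monom_Suc dmult_pCons monom_0)

lemma dmult_1_right [simp]: "f \<star> 1 = f"
  using dmult_monom_right[of f 0] by simp

lemma dmult_1_left [simp]: "1 \<star> f = f"
  by (simp add: one_pCons)

lemma dmult_sum_left: "(\<Sum>i\<in>A. f i) \<star> q = (\<Sum>i\<in>A. f i \<star> q)"
  by (induction A rule: infinite_finite_induct) (simp_all add: dmult_add_left)

lemma dmult_sum_right: "f \<star> (\<Sum>i\<in>A. q i) = (\<Sum>i\<in>A. f \<star> q i)"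
  by (induction A rule: infinite_finite_induct) (simp_all add: dmult_add_right)

lemma T_sum: "T (\<Sum>i\<in>A. f i) = (\<Sum>i\<in>A. T (f i))"
  by (simp flip: dmult_t_left add: dmult_sum_right)

lemma dmult_minus_left: "- f \<star> q = - (f \<star> q)"
  using dmult_smult_left[of "- 1" f q] by simp

lemma dmult_minus_right: "f \<star> - q = - (f \<star> q)"
  using dmult_add_right[of f q "- q"] by (simp add: eq_neg_iff_add_eq_0 add.commute)

lemma dmult_diff_right: "f \<star> (q - q') = f \<star> q - f \<star> q'"
  using dmult_add_right[of f q "- q'"] by (simp add: dmult_minus_right)

lemma dmult_diff_left: "(f - f') \<star> q = f \<star> q - f' \<star> q"
  using dmult_add_left[of f "- f'" q] by (simp add: dmult_minus_left)

lemma R_simps [simp]: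
  "carrier R = UNIV" "mult R = (\<star>)" "one R = 1" "zero R = 0" "add R = (+)"
  by (simp_all add: diff_poly_ring_def)

abbreviation dpow (infixr "\<up>" 75) where "f \<up> (i :: nat) \<equiv> f [^]\<^bsub>R\<^esub> i"

lemma dpow_0 [simp]: "f \<up> 0 = 1"
  and dpow_Suc: "f \<up> Suc i = (f \<up> i) \<star> f"
  by (simp_all add: nat_pow_def)

text \<open>The derivation part of \<open>T\<close> never raises the degree, so the top coefficient
  is merely shifted.\<close>

lemma T_iter_top:
  assumes "degree q \<le> m"
  shows "degree ((T ^^ i) q) \<le> i + m \<and> coeff ((T ^^ i) q) (i + m) = coeff q m"
proof (induction i)
  case (Suc i)
  let ?q = "(T ^^ i) q"
  have "coeff (T ?q) k = coeff ?q (k - 1)" if "k \<ge> Suc i + m" for k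
  proof -
    have "coeff ?q k = 0"
      using that Suc by (intro coeff_eq_0) linarith
    then show ?thesis
      using that by (cases k) (auto simp: t_times_def coeff_map_poly)
  qed
  then show ?case
    using Suc by (auto intro!: degree_le simp: coeff_eq_0)
qed (use assms in auto)

lemma dmult_top:
  assumes f: "degree f \<le> l" and q: "degree q \<le> m"
  shows "degree (f \<star> q) \<le> l + m" and "coeff (f \<star> q) (l + m) = coeff f l * coeff q m"
proof -
  note eq = dmult_eq_sum[OF f, of q]
  have "degree (Polynomial.smult (coeff f i) ((T ^^ i) q)) \<le> l + m" if "i \<le> l" for i
    using T_iter_top[OF q, of i] that by (intro order_trans[OF degree_smult_le]) auto
  then show "degree (f \<star> q) \<le> l + m"
    unfolding eq by (intro degree_sum_le) auto
  have "coeff ((T ^^ i) q) (l + m) = (if i = l then coeff q m else 0)" if "i \<le> l" for i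
    using T_iter_top[OF q, of i] that by (auto intro!: coeff_eq_0)
  then have "coeff (f \<star> q) (l + m) = (\<Sum>i\<le>l. coeff f i * (if i = l then coeff q m else 0))"
    unfolding eq coeff_sum by (intro sum.cong) auto
  also have "\<dots> = coeff f l * coeff q m"
    by (subst sum.remove[of _ l]) auto
  finally show "coeff (f \<star> q) (l + m) = coeff f l * coeff q m" .
qed

lemma lead_coeff_dmult: 
  assumes "f \<noteq> 0" "q \<noteq> 0"
  shows "degree (f \<star> q) = degree f + degree q" "lead_coeff (f \<star> q) = lead_coeff f * lead_coeff q"
proof -
  note top = dmult_top[OF order.refl order.refl, of f q]
  show deg: "degree (f \<star> q) = degree f + degree q"
    by (rule antisym[OF top(1)]) (use top(2) assms in \<open>intro le_degree, simp\<close>)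
  show "lead_coeff (f \<star> q) = lead_coeff f * lead_coeff q"
    using top(2) by (simp add: deg)
qed

lemma dmult_eq_0_iff [simp]: "f \<star> q = 0 \<longleftrightarrow> f = 0 \<or> q = 0"
  using lead_coeff_dmult(2)[of f q] by (metis dmult_0_left dmult_0_right leading_coeff_0_iff mult_eq_0_iff)

end

lemma mult_mat_index:
  assumes "A \<in> carrier_mat n n" "B \<in> carrier_mat n n" "i < n" "j < n"
  shows "(A * B) $$ (i, j) = (\<Sum>k<n. A $$ (i, k) * B $$ (k, j))"
  using assms by (auto simp: scalar_prod_def atLeast0LessThan intro!: sum.cong)

lemma ex_maximal_degree:
  fixes d :: "nat \<Rightarrow> nat"
  assumes "j < n" "Q j"
  obtains i where "i < n" "Q i" "\<And>k. k < n \<Longrightarrow> Q k \<Longrightarrow> d k \<le> d i"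
proof -
  let ?S = "d ` {k. k < n \<and> Q k}"
  have "finite ?S" "?S \<noteq> {}"
    using assms by auto
  then have "Max ?S \<in> ?S" "\<And>k. k < n \<Longrightarrow> Q k \<Longrightarrow> d k \<le> Max ?S"
    by (auto intro: Max_in)
  then show thesis
    using that by fastforce
qed

section \<open>Coordinates over the polynomials in x\<close>

text \<open>The consequences of the hypotheses in the form in which they are used.
  \<open>x_central\<close> and \<open>iter_indep\<close> come from the minimum polynomial in the
  last section; \<open>iter_indep\<close> allows coefficients in all of K.\<close>

locale differential_extension = derivation \<delta> for \<delta> :: "'k::field \<Rightarrow> 'k" +
  fixes F :: "'k set" and x :: "'k poly" and n p e :: nat and bs :: "'k list"
  assumes Const: "Const \<delta> = F"
    and prime_p: "prime p" and char_p: "CHAR('k) = p" and n_eq: "n = p ^ e"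
    and pth_power: "a ^ p \<in> F"
    and degree_x: "degree x = n" and monic_x: "lead_coeff x = 1"
    and x_central: "diff_poly_mult \<delta> x q = diff_poly_mult \<delta> q x"
    and length_bs: "length bs = n"
    and span_bs: "\<exists>c. (\<forall>s<n. c s \<in> F) \<and> a = (\<Sum>s<n. c s * bs ! s)"
    and iter_indep: "h \<noteq> 0 \<Longrightarrow> degree h < n \<Longrightarrow> \<exists>a. poly_at_map h \<delta> a \<noteq> 0"
begin

lemma n_pos: "n > 0"
  using prime_p n_eq by (simp add: prime_gt_0_nat)

lemma in_F_iff: "a \<in> F \<longleftrightarrow> \<delta> a = 0"
  using Const by (auto simp: Const_def)

lemma polys_over_iff: "h \<in> polys_over F \<longleftrightarrow> (\<forall>i. coeff h i \<in> F)"
proof -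
  have "0 \<in> F" by (simp add: in_F_iff)
  then have "set (coeffs h) \<subseteq> F \<longleftrightarrow> range (coeff h) \<subseteq> F"
    by (simp add: range_coeff)
  then show ?thesis
    by (auto simp: polys_over_def)
qed

lemma polys_over_iff_deriv: "h \<in> polys_over F \<longleftrightarrow> map_poly \<delta> h = 0"
  by (simp add: polys_over_iff poly_eq_iff coeff_map_poly in_F_iff)

text \<open>Differentiating coefficients is a derivation of K[x], and the derivative of h^p has the
  factor p = 0. So K[x] is purely inseparable over F[x], which is the basis of the later Frobenius
  argument.\<close>

lemma polys_over_power: "h ^ p \<in> polys_over F"
proof -
  have "map_poly \<delta> (h ^ Suc m) = of_nat (Suc m) * h ^ m * map_poly \<delta> h" for m
    by (induction m) (simp_all add: map_poly_deriv_mult algebra_simps)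
  from this[of "p - 1"] have "map_poly \<delta> (h ^ p) = of_nat p * h ^ (p - 1) * map_poly \<delta> h"
    using prime_p by (simp add: prime_gt_0_nat)
  moreover have "of_nat p = (0 :: 'k poly)"
    using of_nat_CHAR[where 'a = "'k poly"] by (simp add: char_p)
  ultimately show ?thesis
    by (simp add: polys_over_iff_deriv)
qed

lemma dmult_smult_right: "\<delta> a = 0 \<Longrightarrow> q \<star> Polynomial.smult a r = Polynomial.smult a (q \<star> r)"
proof -
  assume a: "\<delta> a = 0"
  have "(T ^^ i) (Polynomial.smult a r) = Polynomial.smult a ((T ^^ i) r)" for i
    by (induction i) (simp_all add: T_smult a)
  then show ?thesis
    by (intro poly_eqI) (simp add: diff_poly_mult_def coeff_sum sum_distrib_left ac_simps)
qed

lemma x_pow_central: "(x \<up> i) \<star> q = q \<star> (x \<up> i)"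
  by (induction i arbitrary: q) (simp_all add: dpow_Suc, metis dmult_assoc x_central)

lemma x_pow_top: "degree (x \<up> i) = n * i" "lead_coeff (x \<up> i) = 1"
proof (induction i)
  case (Suc i)
  have nz: "x \<up> i \<noteq> 0" "x \<noteq> 0"
    using Suc(2) monic_x by auto
  {
    case 1 show ?case
      using nz by (simp add: dpow_Suc lead_coeff_dmult Suc degree_x)
  next
    case 2 show ?case
      using nz lead_coeff_dmult(2)[of "x \<up> i" x] Suc(2) monic_x by (simp only: dpow_Suc) simp
  }
qed auto

section \<open>The commutative subring K[x] of K[t;delta]\<close>

abbreviation P where "P \<equiv> poly_at \<delta> x"

lemma P_eq_sum:
  assumes "degree h \<le> m"
  shows "P h = (\<Sum>i\<le>m. Polynomial.smult (coeff h i) (x \<up> i))"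
  unfolding poly_at_def
  using assms by (simp, intro sum.mono_neutral_left) (auto simp: coeff_eq_0)

lemma P_add: "P (h + h') = P h + P h'"
  using degree_add_le_max[of h h']
  by (simp add: P_eq_sum[of _ "max (degree h) (degree h')"] smult_add_left sum.distrib)

lemma P_0 [simp]: "P 0 = 0"
  by (simp add: poly_at_def)

lemma P_smult: "P (Polynomial.smult a h) = Polynomial.smult a (P h)"
  by (rule poly_eqI) (simp add: P_eq_sum[of _ "degree h"] coeff_sum sum_distrib_left mult.assoc)

lemma P_sum: "P (\<Sum>i\<in>A. f i) = (\<Sum>i\<in>A. P (f i))"
  by (induction A rule: infinite_finite_induct) (simp_all add: P_add)

lemma P_minus: "P (- h) = - P h"
  using P_smult[of "- 1" h] by simp

lemma P_diff: "P (h - h') = P h - P h'"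
  using P_add[of h "- h'"] by (simp add: P_minus)

lemma P_pCons: "P (pCons a h) = [:a:] + (P h) \<star> x"
proof -
  have "P (pCons a h) = (\<Sum>i\<le>Suc (degree h). Polynomial.smult (coeff (pCons a h) i) (x \<up> i))"
    by (rule P_eq_sum) (simp add: degree_pCons_le)
  also have "\<dots> = [:a:] + (P h) \<star> x"
    unfolding sum.atMost_Suc_shift
    by (simp add: P_eq_sum[of h "degree h"] dmult_sum_left dmult_smult_left dpow_Suc one_pCons)
  finally show ?thesis .
qed

lemma P_const [simp]: "P [:a:] = [:a:]"
  by (simp add: P_pCons)

lemma P_1 [simp]: "P 1 = 1"
  by (simp add: one_pCons)

lemma P_x: "P (monom 1 1) = x"
  by (simp add: monom_Suc monom_0 P_pCons)

text \<open>Elements of K commute with each other and with the central element x, so on this subring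
  the twisted product is the ordinary one.\<close>

lemma P_mult: "P (h * h') = P h \<star> P h'"
proof (induction h)
  case (pCons a h)
  have "P h \<star> P h' \<star> x = P h \<star> x \<star> P h'"
    by (metis dmult_assoc x_central)
  then show ?case
    by (simp add: P_add P_smult P_pCons dmult_add_left pCons.IH)
qed simp

lemma P_power: "P (h ^ i) = P h \<up> i"
  by (induction i) (simp_all add: dpow_Suc power_Suc2 P_mult del: power_Suc)

lemma P_monom: "P (monom a i) = Polynomial.smult a (x \<up> i)"
  by (subst P_eq_sum[OF degree_monom_le])
    (simp add: coeff_monom if_distrib[of "\<lambda>c. Polynomial.smult c _"] cong: if_cong)

lemma P_central:
  assumes "h \<in> polys_over F"
  shows "P h \<star> q = q \<star> P h"
  using assms
  by (simp add: P_eq_sum[of h "degree h"] dmult_sum_left dmult_sum_right dmult_smult_left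
      dmult_smult_right x_pow_central polys_over_iff in_F_iff)

text \<open>Since x commutes with t, moving t past h(x) only differentiates the coefficients of h.
  The derivative in the commutator formula \<open>M_T\<close> originates here.\<close>

lemma T_P: "T (P h) = P (map_poly \<delta> h) + P h \<star> monom 1 1"
proof -
  have "T (x \<up> i) = (x \<up> i) \<star> monom 1 1" for i
    by (metis dmult_t_left x_pow_central)
  then show ?thesis
    using map_poly_degree_leq[of \<delta> h]
    by (simp add: P_eq_sum[of _ "degree h"] T_sum T_smult coeff_map_poly dmult_sum_left
        dmult_smult_left sum.distrib)
qed

lemma P_top:
  assumes "h \<noteq> 0"
  shows "degree (P h) = n * degree h" "lead_coeff (P h) = lead_coeff h"
proof -
  note eq = P_eq_sum[OF order.refl, of h]
  have le: "degree (P h) \<le> n * degree h"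
    unfolding eq
    by (intro degree_sum_le order_trans[OF degree_smult_le]) (auto simp: x_pow_top)
  have "coeff (x \<up> i) (n * degree h) = (if i = degree h then 1 else 0)" if "i \<le> degree h" for i
    using x_pow_top[of i] that n_pos by (auto intro!: coeff_eq_0)
  then have "coeff (P h) (n * degree h) = (\<Sum>i\<le>degree h. coeff h i * (if i = degree h then 1 else 0))"
    unfolding eq coeff_sum by (intro sum.cong) auto
  also have "\<dots> = lead_coeff h"
    by (subst sum.remove[of _ "degree h"]) auto
  finally have c: "coeff (P h) (n * degree h) = lead_coeff h" .
  then show "degree (P h) = n * degree h"
    using le assms by (intro antisym le_degree) auto
  then show "lead_coeff (P h) = lead_coeff h"
    using c by simp
qed

text \<open>The degrees \<open>n * degree (h j) + j\<close> of the summands are distinct modulo \<open>n\<close>,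
  so there is no cancellation of leading terms.\<close>

definition expand :: "(nat \<Rightarrow> 'k poly) \<Rightarrow> 'k poly" where
  "expand h = (\<Sum>j<n. P (h j) * monom 1 j)"

lemma expand_add: "expand (\<lambda>j. h j + h' j) = expand h + expand h'"
  by (simp add: expand_def P_add distrib_right sum.distrib)

lemma expand_diff: "expand (\<lambda>j. h j - h' j) = expand h - expand h'"
  by (simp add: expand_def P_diff left_diff_distrib sum_subtractf)

lemma expand_single:
  assumes "j < n"
  shows "expand (\<lambda>i. if i = j then q else 0) = P q * monom 1 j"
  unfolding expand_def using assms by (subst sum.remove[of _ j]) auto

lemma mult_monom_top:
  fixes q :: "'k poly"
  assumes "q \<noteq> 0"
  shows "degree (q * monom 1 j) = degree q + j" "lead_coeff (q * monom 1 j) = lead_coeff q"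
  using assms lead_coeff_mult[of q "monom 1 j"] by (simp_all add: degree_mult_eq degree_monom_eq)

lemma expand_top:
  assumes j: "j < n" "h j \<noteq> 0"
    and max: "\<And>i. i < n \<Longrightarrow> h i \<noteq> 0 \<Longrightarrow> n * degree (h i) + i \<le> n * degree (h j) + j"
  shows "degree (expand h) = n * degree (h j) + j" "lead_coeff (expand h) = lead_coeff (h j)"
proof -
  let ?D = "n * degree (h j) + j"
  have P_nz: "P q \<noteq> 0" if "q \<noteq> 0" for q
    using P_top(2)[OF that] that by auto
  have deg: "degree (P (h i) * monom 1 i) = n * degree (h i) + i" if "h i \<noteq> 0" for i
    using mult_monom_top(1)[OF P_nz[OF that], of i] P_top(1)[OF that] by simp
  have le: "degree (expand h) \<le> ?D"
    unfolding expand_def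
  proof (rule degree_sum_le)
    fix i assume "i \<in> {..<n}"
    then show "degree (P (h i) * monom 1 i) \<le> ?D"
      using max[of i] deg[of i] by (cases "h i = 0") auto
  qed simp
  have "coeff (P (h i) * monom 1 i) ?D = (if i = j then lead_coeff (h j) else 0)" if i: "i < n" for i
  proof (cases "h i = 0")
    case False
    show ?thesis
    proof (cases "i = j")
      case True
      then show ?thesis
        using mult_monom_top(2)[OF P_nz[OF False], of i] P_top(2)[OF False] deg[OF False] by simp
    next
      case neq: False
      have "n * degree (h i) + i \<noteq> ?D"
      proof
        assume "n * degree (h i) + i = ?D"
        then have "(n * degree (h i) + i) mod n = ?D mod n" by simp
        then show False using i j(1) neq by simp
      qed
      then show ?thesis
        using max[OF i False] neq deg[OF False] by (auto intro!: coeff_eq_0)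
    qed
  qed (use j in auto)
  then have "coeff (expand h) ?D = (\<Sum>i<n. if i = j then lead_coeff (h j) else 0)"
    unfolding expand_def coeff_sum by (intro sum.cong) auto
  then have c: "coeff (expand h) ?D = lead_coeff (h j)"
    using j(1) by simp
  show "degree (expand h) = ?D"
    using le c j(2) by (intro antisym le_degree) auto
  then show "lead_coeff (expand h) = lead_coeff (h j)"
    using c by simp
qed

text \<open>The degree d of the sum reveals which summand leads: its index is d mod n and its degree
  in x is d div n.\<close>

lemma
  assumes "j < n" "h j \<noteq> 0"
  shows expand_nonzero: "expand h \<noteq> 0"
    and expand_bound: "n * degree (h j) + j \<le> degree (expand h)"
    and expand_lead_degree: "degree (h (degree (expand h) mod n)) = degree (expand h) div n"
    and expand_lead_coeff: "lead_coeff (h (degree (expand h) mod n)) = lead_coeff (expand h)"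
proof -
  obtain i where i: "i < n" "h i \<noteq> 0"
    "\<And>k. k < n \<Longrightarrow> h k \<noteq> 0 \<Longrightarrow> n * degree (h k) + k \<le> n * degree (h i) + i"
    by (rule ex_maximal_degree[of j n "\<lambda>k. h k \<noteq> 0" "\<lambda>k. n * degree (h k) + k"]) (use assms in auto)
  note top = expand_top[of i h, OF i]
  show "expand h \<noteq> 0"
    using top(2) i(2) by auto
  show "n * degree (h j) + j \<le> degree (expand h)"
    using top(1) i(3)[of j] assms by simp
  have "degree (expand h) mod n = i" "degree (expand h) div n = degree (h i)"
    using i(1) by (simp_all add: top(1))
  then show "degree (h (degree (expand h) mod n)) = degree (expand h) div n"
    and "lead_coeff (h (degree (expand h) mod n)) = lead_coeff (expand h)"
    using top(2) by simp_all
qed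

lemma expand_inj: "expand h = expand h' \<Longrightarrow> j < n \<Longrightarrow> h j = h' j"
  using expand_nonzero[of j "\<lambda>j. h j - h' j"] by (auto simp: expand_diff)

text \<open>Division with remainder: the leading term of f is matched by a single summand, and
  subtracting it lowers the degree.\<close>

lemma expand_surj: "\<exists>h. f = expand h"
\<comment> \<open>The measure places 0 strictly below the nonzero constants, which also have
  \<open>degree\<close> 0.\<close>
proof (induction "if f = 0 then 0 else Suc (degree f)" arbitrary: f rule: less_induct)
  case less
  show ?case
  proof (cases "f = 0")
    case True
    then show ?thesis
      by (intro exI[of _ "\<lambda>_. 0"]) (simp add: expand_def)
  next
    case False
    define j where "j = degree f mod n"
    define q where "q = monom (lead_coeff f) (degree f div n)"
    have j: "j < n" using n_pos by (simp add: j_def)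
    have q: "q \<noteq> 0" "degree q = degree f div n" "lead_coeff q = lead_coeff f"
      using False by (auto simp: q_def degree_monom_eq)
    let ?q = "expand (\<lambda>i. if i = j then q else 0)"
    have "n * degree q + j = degree f"
      using q by (simp add: j_def)
    moreover have "n * degree (if i = j then q else 0) + i \<le> n * degree q + j"
      if "(if i = j then q else 0) \<noteq> 0" for i
      using that by (auto split: if_splits)
    ultimately have top: "degree ?q = degree f" "lead_coeff ?q = lead_coeff f"
      using expand_top[of j "\<lambda>i. if i = j then q else 0", OF j] q by simp_all
    have "f - ?q = 0 \<or> degree (f - ?q) < degree f"
    proof (rule disjCI)
      assume "\<not> degree (f - ?q) < degree f"
      moreover have "degree (f - ?q) \<le> degree f"
        using top by (intro degree_diff_le) auto
      ultimately have "degree (f - ?q) = degree f" by simp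
      moreover have "coeff (f - ?q) (degree f) = 0"
        using top by simp
      ultimately show "f - ?q = 0" by (metis leading_coeff_0_iff)
    qed
    then obtain h where "f - ?q = expand h"
      using less[of "f - ?q"] False by (cases "f - ?q = 0") auto
    then have "f = expand (\<lambda>i. h i + (if i = j then q else 0))"
      by (simp add: expand_add algebra_simps)
    then show ?thesis by blast
  qed
qed

text \<open>Only the values at indices below n are determined by f.\<close>

definition coord :: "'k poly \<Rightarrow> nat \<Rightarrow> 'k poly" where
  "coord f = (SOME h. f = expand h)"

lemma expand_coord: "expand (coord f) = f"
  unfolding coord_def using someI_ex[OF expand_surj[of f]] by simp

lemma coord_expand: "j < n \<Longrightarrow> coord (expand h) j = h j"
  by (rule expand_inj) (simp_all add: expand_coord)

text \<open>The matrix of right multiplication by \<open>f\<close>, which is linear over \<open>K[x]\<close> acting from the left;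
  row vectors make \<open>M\<close> multiplicative rather than antimultiplicative.\<close>

definition M :: "'k poly \<Rightarrow> 'k poly mat" where
  "M f = mat n n (\<lambda>(i, j). coord (monom 1 i \<star> f) j)"

lemma M_carrier [simp]: "M f \<in> carrier_mat n n"
  and M_dim [simp]: "dim_row (M f) = n" "dim_col (M f) = n"
  by (simp_all add: M_def)

lemma M_row: "i < n \<Longrightarrow> monom 1 i \<star> f = (\<Sum>j<n. P (M f $$ (i, j)) * monom 1 j)"
  using expand_coord[of "monom 1 i \<star> f"] by (simp add: expand_def M_def)

text \<open>Uniqueness of coordinates: an identity between matrices may be checked in K[t;delta] row
  by row.\<close>

lemma M_eqI:
  assumes "A \<in> carrier_mat n n"
    and "\<And>i. i < n \<Longrightarrow> monom 1 i \<star> f = (\<Sum>j<n. P (A $$ (i, j)) * monom 1 j)"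
  shows "M f = A"
proof (rule eq_matI)
  fix i j assume "i < dim_row A" "j < dim_col A"
  then have ij: "i < n" "j < n" using assms by auto
  have "monom 1 i \<star> f = expand (\<lambda>j. A $$ (i, j))"
    using assms(2)[OF ij(1)] by (simp add: expand_def)
  then show "M f $$ (i, j) = A $$ (i, j)"
    using ij coord_expand[of j "\<lambda>j. A $$ (i, j)"] by (simp add: M_def)
qed (use assms in auto)

lemma M_add: "M (f + q) = M f + M q"
proof (rule M_eqI)
  fix i assume "i < n"
  then show "monom 1 i \<star> (f + q) = (\<Sum>j<n. P ((M f + M q) $$ (i, j)) * monom 1 j)"
    by (simp add: dmult_add_right M_row P_add distrib_right sum.distrib)
qed simp

lemma M_mult: "M (f \<star> q) = M f * M q"
proof (rule M_eqI)
  fix i assume i: "i < n"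
  have "monom 1 i \<star> (f \<star> q) = (\<Sum>j<n. P (M f $$ (i, j)) \<star> (monom 1 j \<star> q))"
    unfolding dmult_assoc[symmetric] M_row[OF i]
    by (simp add: dmult_sum_left dmult_monom_right)
  also have "\<dots> = (\<Sum>j<n. \<Sum>k<n. P (M f $$ (i, j) * M q $$ (j, k)) * monom 1 k)"
    by (intro sum.cong refl)
      (simp add: M_row dmult_sum_right P_mult flip: dmult_monom_right dmult_assoc)
  also have "\<dots> = (\<Sum>k<n. P ((M f * M q) $$ (i, k)) * monom 1 k)"
    by (subst sum.swap, intro sum.cong refl)
      (subst mult_mat_index[OF M_carrier M_carrier i], auto simp: P_sum sum_distrib_right)
  finally show "monom 1 i \<star> (f \<star> q) = (\<Sum>k<n. P ((M f * M q) $$ (i, k)) * monom 1 k)" .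
qed (rule mult_carrier_mat[of _ n n]; simp)

text \<open>Coefficients in F make P h central, so that it can be moved to the left of t^i, where it
  acts as a scalar.\<close>

lemma M_P:
  assumes "h \<in> polys_over F"
  shows "M (P h) = h \<cdot>\<^sub>m 1\<^sub>m n"
proof (rule M_eqI)
  fix i assume i: "i < n"
  have "(\<Sum>j<n. P ((h \<cdot>\<^sub>m 1\<^sub>m n) $$ (i, j)) * monom 1 j) = (\<Sum>j<n. if j = i then P h * monom 1 j else 0)"
    using i by (intro sum.cong) auto
  then show "monom 1 i \<star> P h = (\<Sum>j<n. P ((h \<cdot>\<^sub>m 1\<^sub>m n) $$ (i, j)) * monom 1 j)"
    using i by (simp add: P_central[OF assms, symmetric] dmult_monom_right)
qed simp

text \<open>Left multiplication by \<open>t\<close> commutes with right multiplications but is only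
  \<open>\<delta>\<close>-semilinear, hence the derivative of \<open>M f\<close> is a commutator.\<close>

lemma M_T: "M (monom 1 1) * M f = map_mat (map_poly \<delta>) (M f) + M f * M (monom 1 1)"
  (is "?\<tau> * _ = _")
  unfolding M_mult[symmetric]
proof (rule M_eqI)
  fix i assume i: "i < n"
  have "monom 1 i \<star> (monom 1 1 \<star> f) = T (monom 1 i \<star> f)"
    by (metis T_dmult dmult_assoc dmult_t_left dmult_monom_right mult.commute)
  also have "\<dots> = (\<Sum>j<n. T (P (M f $$ (i, j))) \<star> monom 1 j)"
    unfolding M_row[OF i] by (simp flip: dmult_t_left dmult_monom_right add: dmult_sum_right dmult_assoc)
  also have "\<dots> = (\<Sum>j<n. P (map_poly \<delta> (M f $$ (i, j))) * monom 1 j)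
      + (\<Sum>j<n. P (M f $$ (i, j)) \<star> monom 1 j \<star> monom 1 1)"
    by (simp add: T_P dmult_add_left sum.distrib dmult_monom_right distrib_right mult.assoc mult.commute[of "monom 1 (Suc 0)"])
  also have "(\<Sum>j<n. P (M f $$ (i, j)) \<star> monom 1 j \<star> monom 1 1) = monom 1 i \<star> (f \<star> monom 1 1)"
    unfolding dmult_assoc[symmetric] M_row[OF i]
    by (simp add: sum_distrib_right dmult_monom_right)
  also have "\<dots> = (\<Sum>j<n. P (M (f \<star> monom 1 1) $$ (i, j)) * monom 1 j)"
    by (rule M_row[OF i])
  finally show "monom 1 i \<star> (monom 1 1 \<star> f) =
      (\<Sum>j<n. P ((map_mat (map_poly \<delta>) (M f) + M (f \<star> monom 1 1)) $$ (i, j)) * monom 1 j)"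
    using i by (simp add: P_add distrib_right sum.distrib)
qed simp

end

section \<open>The determinant of right multiplication\<close>

lemma derivation_prod:
  fixes D :: "'a::comm_ring_1 \<Rightarrow> 'a"
  assumes mult: "\<And>a b. D (a * b) = D a * b + a * D b" and "finite S"
  shows "D (\<Prod>i\<in>S. f i) = (\<Sum>k\<in>S. D (f k) * (\<Prod>i\<in>S - {k}. f i))"
  using \<open>finite S\<close>
proof (induction S rule: finite_induct)
  case empty
  then show ?case using mult[of 1 1] by simp
next
  case (insert a S)
  have "(\<Prod>i\<in>insert a S - {k}. f i) = f a * (\<Prod>i\<in>S - {k}. f i)" if "k \<in> S" for k
  proof -
    have "insert a S - {k} = insert a (S - {k})" using insert that by auto
    then show ?thesis using insert by simp
  qed
  then have "(\<Sum>k\<in>S. D (f k) * (\<Prod>i\<in>insert a S - {k}. f i)) = f a * D (\<Prod>i\<in>S. f i)"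
    by (simp add: insert sum_distrib_left ac_simps)
  moreover have "insert a S - {a} = S" using insert by auto
  ultimately show ?case
    using insert by (simp add: mult)
qed

text \<open>Jacobi's formula. The product rule turns the sum over permutations into n determinants,
  each with one differentiated row; expansion along that row involves only cofactors of A.\<close>

lemma derivation_det:
  fixes D :: "'a::comm_ring_1 \<Rightarrow> 'a"
  assumes add: "\<And>a b. D (a + b) = D a + D b" and mult: "\<And>a b. D (a * b) = D a * b + a * D b"
    and A: "A \<in> carrier_mat n n"
  shows "D (det A) = (\<Sum>k<n. \<Sum>j<n. D (A $$ (k, j)) * cofactor A k j)"
proof -
  have D0: "D 0 = 0" using add[of 0 0] by simp
  have D1: "D 1 = 0" using mult[of 1 1] by simp
  have Dm1: "D (- 1) = 0" using add[of 1 "- 1"] by (simp add: D0 D1)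
  have D_sum: "D (\<Sum>i\<in>S. f i) = (\<Sum>i\<in>S. D (f i))" for S and f :: "(nat \<Rightarrow> nat) \<Rightarrow> 'a"
    by (induction S rule: infinite_finite_induct) (simp_all add: add D0)
  \<comment> \<open>A with its k-th row differentiated.\<close>
  define A' where "A' k = mat n n (\<lambda>(i, j). if i = k then D (A $$ (i, j)) else A $$ (i, j))" for k
  have A': "A' k \<in> carrier_mat n n" for k by (simp add: A'_def)
  let ?perms = "{\<pi>. \<pi> permutes {0..<n}}"
  have prod_A': "(\<Prod>i = 0..<n. A' k $$ (i, \<pi> i)) = D (A $$ (k, \<pi> k)) * (\<Prod>i\<in>{0..<n} - {k}. A $$ (i, \<pi> i))"
    if "k < n" "\<pi> permutes {0..<n}" for k \<pi>
  proof -
    have \<pi>: "\<pi> i < n" if "i < n" for i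
      using permutes_in_image[OF \<open>\<pi> permutes {0..<n}\<close>] that by simp
    have "(\<Prod>i\<in>{0..<n} - {k}. A' k $$ (i, \<pi> i)) = (\<Prod>i\<in>{0..<n} - {k}. A $$ (i, \<pi> i))"
      by (intro prod.cong) (auto simp: A'_def \<pi>)
    moreover have "A' k $$ (k, \<pi> k) = D (A $$ (k, \<pi> k))"
      using that by (simp add: A'_def \<pi>)
    ultimately show ?thesis
      using \<open>k < n\<close> by (subst prod.remove[of _ k]) auto
  qed
  have "D (det A) = (\<Sum>\<pi>\<in>?perms. signof \<pi> * D (\<Prod>i = 0..<n. A $$ (i, \<pi> i)))"
    unfolding det_def'[OF A] D_sum by (intro sum.cong refl) (auto simp: mult sign_def D1 Dm1)
  also have "\<dots> = (\<Sum>\<pi>\<in>?perms. \<Sum>k<n. signof \<pi> * (\<Prod>i = 0..<n. A' k $$ (i, \<pi> i)))"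
    by (intro sum.cong refl)
      (simp add: derivation_prod[of D, OF mult] prod_A'[unfolded atLeast0LessThan]
        sum_distrib_left atLeast0LessThan)
  also have "\<dots> = (\<Sum>k<n. det (A' k))"
    by (subst sum.swap) (simp add: det_def'[OF A'])
  also have "\<dots> = (\<Sum>k<n. \<Sum>j<n. D (A $$ (k, j)) * cofactor A k j)"
  proof (rule sum.cong[OF refl])
    fix k assume "k \<in> {..<n}"
    then have k: "k < n" by simp
    have "mat_delete (A' k) k j = mat_delete A k j" if "j < n" for j
      using A by (intro eq_matI) (auto simp: mat_delete_def A'_def)
    then have "(\<Sum>j<n. A' k $$ (k, j) * cofactor (A' k) k j) = (\<Sum>j<n. D (A $$ (k, j)) * cofactor A k j)"
      using k by (intro sum.cong) (auto simp: cofactor_def A'_def)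
    then show "det (A' k) = (\<Sum>j<n. D (A $$ (k, j)) * cofactor A k j)"
      using laplace_expansion_row[OF A' k] by simp
  qed
  finally show ?thesis .
qed

text \<open>By Jacobi's formula D(det A) is the trace of (BA - AB) adj A. Cyclicity of the trace
  turns AB adj A into B adj A A, and A commutes with its adjugate, so the two traces agree.\<close>

lemma derivation_det_commutator:
  fixes D :: "'a::comm_ring_1 \<Rightarrow> 'a"
  assumes add: "\<And>a b. D (a + b) = D a + D b" and mult: "\<And>a b. D (a * b) = D a * b + a * D b"
    and A: "A \<in> carrier_mat n n" and B: "B \<in> carrier_mat n n"
    and comm: "B * A = map_mat D A + A * B"
  shows "D (det A) = 0"
proof -
  let ?adj = "adj_mat A"
  have adj: "?adj \<in> carrier_mat n n" "A * ?adj = det A \<cdot>\<^sub>m 1\<^sub>m n" "?adj * A = det A \<cdot>\<^sub>m 1\<^sub>m n"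
    using adj_mat[OF A] by auto
  have cof: "cofactor A k j = ?adj $$ (j, k)" if "k < n" "j < n" for k j
    using that A by (simp add: adj_mat_def)
  have tr: "(\<Sum>k<n. \<Sum>j<n. X $$ (k, j) * Y $$ (j, k)) = (\<Sum>k<n. (X * Y) $$ (k, k))"
    if "X \<in> carrier_mat n n" "Y \<in> carrier_mat n n" for X Y :: "'a mat"
    using mult_mat_index[OF that] by simp
  have DA: "D (A $$ (k, j)) = (B * A) $$ (k, j) - (A * B) $$ (k, j)" if "k < n" "j < n" for k j
    using that A B by (simp add: comm)
  have "D (det A) = (\<Sum>k<n. \<Sum>j<n. ((B * A) $$ (k, j) - (A * B) $$ (k, j)) * ?adj $$ (j, k))"
    unfolding derivation_det[of D, OF add mult A] by (intro sum.cong refl) (simp add: DA cof)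
  also have "\<dots> = (\<Sum>k<n. (B * A * ?adj) $$ (k, k)) - (\<Sum>k<n. (A * B * ?adj) $$ (k, k))"
    using tr[of "B * A" ?adj] tr[of "A * B" ?adj] A B adj(1)
    by (simp add: left_diff_distrib sum_subtractf del: index_mult_mat)
  also have "(\<Sum>k<n. (A * B * ?adj) $$ (k, k)) = (\<Sum>k<n. \<Sum>j<n. A $$ (k, j) * (B * ?adj) $$ (j, k))"
    using tr[of A "B * ?adj"] A B adj by (simp add: assoc_mult_mat[OF A B adj(1)])
  also have "\<dots> = (\<Sum>j<n. \<Sum>k<n. (B * ?adj) $$ (j, k) * A $$ (k, j))"
    by (subst sum.swap) (simp add: mult.commute)
  also have "\<dots> = (\<Sum>j<n. (B * ?adj * A) $$ (j, j))"
    using tr[of "B * ?adj" A] A B adj by simp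
  also have "B * ?adj * A = B * A * ?adj"
    by (simp add: assoc_mult_mat[OF B adj(1) A] assoc_mult_mat[OF B A adj(1)] adj)
  finally show ?thesis by simp
qed

lemma smult_sum_right: "(\<Sum>i\<in>A. Polynomial.smult c (f i)) = Polynomial.smult c (\<Sum>i\<in>A. f i)"
  by (rule poly_eqI) (simp add: coeff_sum sum_distrib_left)

lemma coeff_mult_top:
  fixes q r :: "'a::comm_semiring_0 poly"
  assumes "degree q \<le> a" "degree r \<le> b"
  shows "coeff (q * r) (a + b) = coeff q a * coeff r b"
proof (cases "degree q = a \<and> degree r = b")
  case True
  then show ?thesis using coeff_mult_degree_sum[of q r] by simp
next
  case False
  then have "degree (q * r) < a + b"
    using assms degree_mult_le[of q r] by linarith
  moreover have "coeff q a * coeff r b = 0"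
    using False assms by (auto simp: coeff_eq_0)
  ultimately show ?thesis by (simp add: coeff_eq_0)
qed

context differential_extension
begin

lemma det_M_over: "det (M f) \<in> polys_over F"
  unfolding polys_over_iff_deriv
  by (rule derivation_det_commutator[of _ "M f" n "M (monom 1 1)"])
    (simp_all add: map_poly_deriv_add map_poly_deriv_mult M_T del: One_nat_def)

lemma det_M_mult: "det (M (f \<star> q)) = det (M f) * det (M q)"
  unfolding M_mult by (rule det_mult[of _ n]) simp_all

text \<open>Let q have row 0 of the adjugate as its coordinates. The coordinates of q f are then row
  0 of det(M f) times the identity, which represents det(M f) at the basis element t^0 = 1.\<close>

lemma left_multiple: "\<exists>q. P (det (M f)) = q \<star> f"
proof
  let ?adj = "adj_mat (M f)"
  have adj: "?adj \<in> carrier_mat n n" "?adj * M f = det (M f) \<cdot>\<^sub>m 1\<^sub>m n"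
    using adj_mat[of "M f" n] by auto
  have "(\<Sum>j<n. P (?adj $$ (0, j)) * monom 1 j) \<star> f = (\<Sum>j<n. P (?adj $$ (0, j)) \<star> (monom 1 j \<star> f))"
    by (simp add: dmult_sum_left flip: dmult_assoc dmult_monom_right)
  also have "\<dots> = (\<Sum>j<n. \<Sum>k<n. P (?adj $$ (0, j) * M f $$ (j, k)) * monom 1 k)"
    by (intro sum.cong refl)
      (simp add: M_row dmult_sum_right P_mult flip: dmult_monom_right dmult_assoc)
  also have "\<dots> = (\<Sum>k<n. P ((?adj * M f) $$ (0, k)) * monom 1 k)"
    by (subst sum.swap, intro sum.cong refl)
      (use n_pos in \<open>simp add: mult_mat_index[OF adj(1) M_carrier] P_sum sum_distrib_right del: index_mult_mat\<close>)
  also have "\<dots> = (\<Sum>k<n. if k = 0 then P (det (M f)) else 0)"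
    unfolding adj(2) using n_pos by (intro sum.cong) auto
  also have "\<dots> = P (det (M f))"
    using n_pos by simp
  finally show "P (det (M f)) = (\<Sum>j<n. P (?adj $$ (0, j)) * monom 1 j) \<star> f" ..
qed

text \<open>A left cofactor q is also a right one: the norm is central, so (f q - N) f = f N - N f =
  0, and there are no zero divisors.\<close>

lemma divides_norm: "\<exists>q. P (det (M f)) = q \<star> f \<and> P (det (M f)) = f \<star> q"
proof -
  obtain q where q: "P (det (M f)) = q \<star> f"
    using left_multiple by blast
  show ?thesis
  proof (cases "f = 0")
    case True
    then show ?thesis using q by (intro exI[of _ 0]) simp
  next
    case False
    have "(f \<star> q - P (det (M f))) \<star> f = 0"
      using P_central[OF det_M_over, of f f] by (simp add: dmult_diff_left dmult_assoc flip: q)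
    then show ?thesis
      using False q by auto
  qed
qed

text \<open>Row i holds the coordinates of t^i f, a polynomial of degree i + m. Its leading term
  sits in column (i + m) mod n, and the other entries of the row are bounded accordingly.\<close>

lemma M_entry_top:
  assumes f: "degree f = m" "f \<noteq> 0" and ij: "i < n" "j < n"
  shows "M f $$ (i, j) \<noteq> 0 \<Longrightarrow> n * degree (M f $$ (i, j)) + j \<le> i + m"
    and "j = (i + m) mod n \<Longrightarrow> M f $$ (i, j) \<noteq> 0 \<and> degree (M f $$ (i, j)) = (i + m) div n
      \<and> lead_coeff (M f $$ (i, j)) = lead_coeff f"
proof -
  define h where "h k = M f $$ (i, k)" for k
  have h: "expand h = monom 1 i \<star> f"
    by (simp add: expand_def h_def M_row[OF ij(1)])
  have nz: "monom 1 i \<noteq> (0 :: 'k poly)" by simp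
  have deg: "degree (expand h) = i + m" and lc: "lead_coeff (expand h) = lead_coeff f"
    using lead_coeff_dmult[OF nz f(2)] by (simp_all add: h degree_monom_eq f)
  show "M f $$ (i, j) \<noteq> 0 \<Longrightarrow> n * degree (M f $$ (i, j)) + j \<le> i + m"
    using expand_bound[OF ij(2), of h] by (simp add: h_def deg)
  obtain k where k: "k < n" "h k \<noteq> 0"
  proof -
    have "\<exists>k<n. h k \<noteq> 0"
    proof (rule ccontr)
      assume "\<not> ?thesis"
      then have "expand h = 0" by (simp add: expand_def)
      then show False using lc f by (metis leading_coeff_0_iff)
    qed
    then show thesis using that by blast
  qed
  assume j: "j = (i + m) mod n"
  show "M f $$ (i, j) \<noteq> 0 \<and> degree (M f $$ (i, j)) = (i + m) div n
      \<and> lead_coeff (M f $$ (i, j)) = lead_coeff f"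
  proof -
    have c: "coeff (expand h) (i + m) = lead_coeff f" "lead_coeff f \<noteq> 0"
      using lc deg f by auto
    have "degree (h j) = (i + m) div n" "lead_coeff (h j) = lead_coeff f"
      using expand_lead_degree[of k h, OF k] expand_lead_coeff[of k h, OF k]
      unfolding deg j c(1) by auto
    then show ?thesis
      using c(2) by (auto simp: h_def)
  qed
qed

text \<open>A permutation contributes to the coefficient of \<open>x\<^sup>m\<close> only if it is the cyclic shift by \<open>m\<close>.
  Its sign is found without computing with permutations: by multiplicativity it is the \<open>m\<close>-th power
  of the sign for \<open>m = 1\<close>, whose \<open>n\<close>-th power is \<open>1\<close>, and \<open>n\<close>-th powers are injective.\<close>

definition shift_sign :: "nat \<Rightarrow> 'k" where
  "shift_sign m = (\<Sum>\<pi> | \<pi> permutes {0..<n} \<and> (\<forall>i<n. \<pi> i = (i + m) mod n). signof \<pi>)"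

text \<open>If no factor vanishes, the entry in row i satisfies n * degree + \<pi> i \<le> i + m.
  Summed over i, the terms \<pi> i and i cancel, which leaves total degree at most m. Equality
  requires equality in every row, and modulo n this says that \<pi> is the shift by m.\<close>

lemma det_M_top_sign:
  assumes f: "degree f = m" "f \<noteq> 0"
  shows "degree (det (M f)) \<le> m \<and> coeff (det (M f)) m = shift_sign m * lead_coeff f ^ n"
proof -
  let ?perms = "{\<pi>. \<pi> permutes {0..<n}}"
  let ?q = "\<lambda>\<pi> i. M f $$ (i, \<pi> i)"
  let ?shift = "\<lambda>\<pi>. \<forall>i<n. \<pi> i = (i + m) mod n"
  have fin: "finite ?perms" by (simp add: finite_permutations)
  have main: "degree (prod (?q \<pi>) {0..<n}) \<le> m \<and>
      coeff (prod (?q \<pi>) {0..<n}) m = (if ?shift \<pi> then lead_coeff f ^ n else 0)"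
    if \<pi>: "\<pi> permutes {0..<n}" for \<pi>
  proof -
    have \<pi>_less: "\<pi> i < n" if "i < n" for i
      using permutes_in_image[OF \<pi>] that by simp
    have sum_\<pi>: "(\<Sum>i = 0..<n. \<pi> i) = (\<Sum>i = 0..<n. i)"
      using sum.permute[OF \<pi>, of "\<lambda>i. i"] by (simp add: o_def)
    show ?thesis
    proof (cases "\<forall>i<n. ?q \<pi> i \<noteq> 0")
      case False
      then obtain i where i: "i < n" "?q \<pi> i = 0" by auto
      then have "prod (?q \<pi>) {0..<n} = 0" by (intro prod_zero) auto
      moreover have "\<not> ?shift \<pi>"
        using M_entry_top(2)[OF f i(1) \<pi>_less[OF i(1)]] i by auto
      ultimately show ?thesis by (simp only: if_False coeff_0 degree_0) simp
    next
      case True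
      have le: "n * degree (?q \<pi> i) + \<pi> i \<le> i + m" if "i < n" for i
        using M_entry_top(1)[OF f that \<pi>_less[OF that]] True that by simp
      have deg: "degree (prod (?q \<pi>) {0..<n}) = (\<Sum>i = 0..<n. degree (?q \<pi> i))"
        using True by (intro degree_prod_sum_eq) auto
      have total: "n * (\<Sum>i = 0..<n. degree (?q \<pi> i)) + (\<Sum>i = 0..<n. i)
          = (\<Sum>i = 0..<n. n * degree (?q \<pi> i) + \<pi> i)"
        by (simp add: sum.distrib sum_distrib_left sum_\<pi>)
      have bound: "(\<Sum>i = 0..<n. i + m) = n * m + (\<Sum>i = 0..<n. i)"
        by (simp add: sum.distrib)
      have "(\<Sum>i = 0..<n. n * degree (?q \<pi> i) + \<pi> i) \<le> (\<Sum>i = 0..<n. i + m)"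
        using le by (intro sum_mono) auto
      then have "n * (\<Sum>i = 0..<n. degree (?q \<pi> i)) \<le> n * m"
        using total bound by linarith
      then have le_m: "(\<Sum>i = 0..<n. degree (?q \<pi> i)) \<le> m"
        using n_pos by simp
      show ?thesis
      proof (cases "?shift \<pi>")
        case shift: True
        have top: "degree (?q \<pi> i) = (i + m) div n" "lead_coeff (?q \<pi> i) = lead_coeff f" if "i < n" for i
          using M_entry_top(2)[OF f that \<pi>_less[OF that]] shift that by auto
        have "n * degree (?q \<pi> i) + \<pi> i = i + m" if "i < n" for i
          using top(1)[OF that] shift that by simp
        then have "(\<Sum>i = 0..<n. n * degree (?q \<pi> i) + \<pi> i) = (\<Sum>i = 0..<n. i + m)"
          by (intro sum.cong) auto
        then have "n * (\<Sum>i = 0..<n. degree (?q \<pi> i)) = n * m"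
          using total bound by linarith
        then have "degree (prod (?q \<pi>) {0..<n}) = m"
          using n_pos deg by simp
        moreover have "lead_coeff (prod (?q \<pi>) {0..<n}) = lead_coeff f ^ n"
          unfolding lead_coeff_prod using top(2) by simp
        ultimately show ?thesis using shift by auto
      next
        case False
        then obtain i where i: "i < n" "\<pi> i \<noteq> (i + m) mod n" by auto
        have "n * degree (?q \<pi> i) + \<pi> i \<noteq> i + m"
        proof
          assume "n * degree (?q \<pi> i) + \<pi> i = i + m"
          then have "(n * degree (?q \<pi> i) + \<pi> i) mod n = (i + m) mod n" by simp
          then show False using i \<pi>_less[OF i(1)] by simp
        qed
        then have "n * degree (?q \<pi> i) + \<pi> i < i + m" using le[OF i(1)] by simp
        then have "(\<Sum>i = 0..<n. n * degree (?q \<pi> i) + \<pi> i) < (\<Sum>i = 0..<n. i + m)"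
          using le i(1) by (intro sum_strict_mono_ex1) auto
        then have "n * (\<Sum>i = 0..<n. degree (?q \<pi> i)) < n * m"
          using total bound by linarith
        then have "(\<Sum>i = 0..<n. degree (?q \<pi> i)) < m"
          by simp
        then show ?thesis
          using False by (auto simp: deg intro!: coeff_eq_0)
      qed
    qed
  qed
  have det: "det (M f) = (\<Sum>\<pi>\<in>?perms. signof \<pi> * prod (?q \<pi>) {0..<n})"
    by (rule det_def'[OF M_carrier])
  have sgn: "degree (signof \<pi> * q) = degree q \<and> coeff (signof \<pi> * q) k = signof \<pi> * coeff q k"
    for \<pi> k and q :: "'k poly"
    by (simp add: sign_def)
  have "degree (det (M f)) \<le> m"
    unfolding det by (rule degree_sum_le) (use main sgn fin in auto)
  moreover have "coeff (det (M f)) m = (\<Sum>\<pi>\<in>?perms. signof \<pi> * (if ?shift \<pi> then lead_coeff f ^ n else 0))"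
    unfolding det coeff_sum by (intro sum.cong) (use main sgn in auto)
  moreover have "\<dots> = (\<Sum>\<pi> | \<pi> permutes {0..<n} \<and> ?shift \<pi>. signof \<pi> * lead_coeff f ^ n)"
    by (rule sum.mono_neutral_cong_right) (use fin in auto)
  ultimately show ?thesis
    by (simp add: shift_sign_def sum_distrib_right)
qed

text \<open>n is a power of the characteristic, so the n-th power map is additive and (a - b)^n =
  0.\<close>

lemma frobenius_inj:
  fixes a b :: 'k
  assumes "a ^ n = b ^ n"
  shows "a = b"
proof -
  have "(a - b) ^ n + b ^ n = a ^ n"
    using freshmans_dream'[of n e "a - b" b] prime_p by (simp add: char_p n_eq)
  then show ?thesis using assms n_pos by simp
qed

lemma det_M_one: "det (M 1) = 1"
  using M_P[of 1] by (simp add: polys_over_iff_deriv)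

lemma det_M_t_pow: "det (M (monom 1 m)) = det (M (monom 1 1)) ^ m"
proof (induction m)
  case (Suc m)
  have "monom 1 (Suc m) = monom 1 m \<star> monom 1 1"
    by (simp add: dmult_monom_right mult_monom)
  then show ?case
    using Suc by (simp only: det_M_mult) simp
qed (simp add: det_M_one)

lemma shift_sign: "shift_sign m = 1"
proof -
  let ?d = "det (M (monom 1 1))"
  have top: "degree (det (M (monom 1 k))) \<le> k" "coeff (det (M (monom 1 k))) k = shift_sign k" for k
    using det_M_top_sign[of "monom 1 k" k] by (auto simp: degree_monom_eq)
  have power: "coeff (?d ^ k) k = coeff ?d 1 ^ k \<and> degree (?d ^ k) \<le> k" for k
  proof (induction k)
    case (Suc k)
    have "coeff (?d * ?d ^ k) (1 + k) = coeff ?d 1 * coeff (?d ^ k) k"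
      by (rule coeff_mult_top) (use Suc top(1)[of 1] in auto)
    moreover have "degree (?d * ?d ^ k) \<le> 1 + k"
      using degree_mult_le[of ?d "?d ^ k"] Suc top(1)[of 1] by linarith
    ultimately show ?case using Suc by simp
  qed auto
  have sgn: "shift_sign k = shift_sign 1 ^ k" for k
    using power[of k] top(2)[of k] top(2)[of 1] by (simp add: det_M_t_pow[of k])
  \<comment> \<open>x is central of degree n and its matrix is scalar, so its determinant is known
    outright. Comparison with the general formula at m = n gives the sign of the shift by n.\<close>
  have "det (M x) = monom 1 n"
  proof -
    have "monom 1 1 \<in> polys_over F"
      by (simp add: polys_over_iff in_F_iff)
    then show ?thesis
      using M_P[of "monom 1 1"] by (simp only: P_x) (simp add: det_smult monom_power)
  qed
  then have "shift_sign n = 1"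
    using det_M_top_sign[of x n] degree_x monic_x n_pos by fastforce
  then have "shift_sign 1 ^ n = 1 ^ n"
    using sgn[of n] by simp
  then have "shift_sign 1 = 1"
    by (rule frobenius_inj)
  then show ?thesis
    using sgn[of m] by simp
qed

lemma det_M_top:
  assumes "degree f = m" "f \<noteq> 0"
  shows "degree (det (M f)) \<le> m" "coeff (det (M f)) m = coeff f m ^ n"
  using det_M_top_sign[OF assms] assms by (auto simp: shift_sign)

text \<open>For odd n the exponent is even; for even n the characteristic is 2.\<close>

lemma sign_eq_1: "(- 1) ^ (m * (n - 1)) = (1 :: 'k)"
proof (cases "even n")
  case True
  then have "p = 2"
    using prime_p n_eq by (metis prime_dvd_power primes_dvd_imp_eq two_is_prime_nat)
  then have "(- 1 :: 'k) = 1"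
    using char_p by (metis uminus_CHAR_2)
  then show ?thesis by (simp only: power_one)
qed simp

text \<open>The iterates \<open>\<delta>\<^sup>0, \<dots>, \<delta>\<^sup>n\<^sup>-\<^sup>1\<close> are linearly independent over \<open>K\<close>, hence the matrix of
  their values on a basis is invertible.\<close>

lemma dual_coeffs:
  "\<exists>es. \<forall>r<n. (\<Sum>s<n. es s * (\<delta> ^^ r) (bs ! s)) = (if r = n - 1 then 1 else 0)"
proof -
  let ?A = "mat n n (\<lambda>(s, r). (\<delta> ^^ r) (bs ! s))"
  have A: "?A \<in> carrier_mat n n" by simp
  have "det ?A \<noteq> 0"
  proof
    assume "det ?A = 0"
    then obtain v where v: "v \<in> carrier_vec n" "v \<noteq> 0\<^sub>v n" "?A *\<^sub>v v = 0\<^sub>v n"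
      using det_0_iff_vec_prod_zero_field[OF A] by auto
    \<comment> \<open>A kernel vector read as a polynomial: h(delta) kills all of \<open>bs\<close>,
      hence all of K because the iterates of delta are F-linear.\<close>
    define h where "h = (\<Sum>r<n. monom (v $ r) r)"
    have coeff_h: "coeff h r = (if r < n then v $ r else 0)" for r
      by (simp add: h_def coeff_sum)
    have "h \<noteq> 0"
    proof
      assume "h = 0"
      then have "v $ r = 0" if "r < n" for r
        using coeff_h[of r] that by simp
      then show False using v(1,2) by auto
    qed
    moreover have deg: "degree h < n"
      using n_pos by (intro le_less_trans[OF degree_le[of "n - 1"]]) (auto simp: coeff_h)
    moreover have "poly_at_map h \<delta> a = 0" for a
    proof -
      obtain c where c: "\<And>s. s < n \<Longrightarrow> c s \<in> F" "a = (\<Sum>s<n. c s * bs ! s)"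
        using span_bs[of a] by auto
      have row: "(\<Sum>r<n. (\<delta> ^^ r) (bs ! s) * v $ r) = 0" if "s < n" for s
      proof -
        have "(?A *\<^sub>v v) $ s = (\<Sum>r<n. (\<delta> ^^ r) (bs ! s) * v $ r)"
          using that v(1) by (auto simp: scalar_prod_def atLeast0LessThan intro!: sum.cong)
        then show ?thesis using that by (simp add: v(3))
      qed
      have "poly_at_map h \<delta> a = (\<Sum>r<n. v $ r * (\<delta> ^^ r) a)"
        unfolding poly_at_map_def
      proof (rule sum.mono_neutral_cong_left)
        show "\<forall>i\<in>{..<n} - {..degree h}. v $ i * (\<delta> ^^ i) a = 0"
        proof
          fix i assume "i \<in> {..<n} - {..degree h}"
          then show "v $ i * (\<delta> ^^ i) a = 0"
            using coeff_h[of i] coeff_eq_0[of h i] by simp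
        qed
      qed (use deg in \<open>auto simp: coeff_h\<close>)
      also have "\<dots> = (\<Sum>r<n. \<Sum>s<n. c s * ((\<delta> ^^ r) (bs ! s) * v $ r))"
        using c by (intro sum.cong refl)
          (simp add: deriv_iter_sum deriv_iter_const_mult in_F_iff sum_distrib_left ac_simps)
      also have "\<dots> = (\<Sum>s<n. c s * (\<Sum>r<n. (\<delta> ^^ r) (bs ! s) * v $ r))"
        by (subst sum.swap) (simp add: sum_distrib_left)
      also have "\<dots> = 0" by (simp add: row)
      finally show ?thesis .
    qed
    ultimately show False using iter_indep by blast
  qed
  \<comment> \<open>The last row of the inverse matrix, which selects the iterate of order n -
    1.\<close>
  define es where "es s = adj_mat ?A $$ (n - 1, s) / det ?A" for s
  have "(\<Sum>s<n. es s * (\<delta> ^^ r) (bs ! s)) = (if r = n - 1 then 1 else 0)" if r: "r < n" for r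
  proof -
    have adj: "adj_mat ?A \<in> carrier_mat n n" "adj_mat ?A * ?A = det ?A \<cdot>\<^sub>m 1\<^sub>m n"
      using adj_mat[OF A] by auto
    have "(\<Sum>s<n. es s * (\<delta> ^^ r) (bs ! s)) = (adj_mat ?A * ?A) $$ (n - 1, r) / det ?A"
      using r n_pos by (subst mult_mat_index[OF adj(1) A]) (auto simp: es_def sum_divide_distrib)
    then show ?thesis
      using r n_pos \<open>det ?A \<noteq> 0\<close> unfolding adj(2) by auto
  qed
  then show ?thesis by blast
qed

text \<open>The point is that w does not depend on b, so that a combination over several b affects
  only the values delta^r b. Binomial multiples of t^(i-r) are such a w.\<close>

lemma T_iter_const: "\<exists>w. w i = 1 \<and> (\<forall>b. (T ^^ i) [:b:] = (\<Sum>r\<le>i. Polynomial.smult ((\<delta> ^^ r) b) (w r)))"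
proof (induction i)
  case 0
  show ?case by (intro exI[of _ "\<lambda>_. 1"]) (simp add: one_pCons)
next
  case (Suc i)
  then obtain w where w: "w i = 1"
    "\<And>b. (T ^^ i) [:b:] = (\<Sum>r\<le>i. Polynomial.smult ((\<delta> ^^ r) b) (w r))" by blast
  \<comment> \<open>Pascal's recursion: applying t either multiplies w or differentiates b once
    more.\<close>
  define w' where "w' r = (if r \<le> i then T (w r) else 0) + (if r = 0 then 0 else w (r - 1))" for r
  have "(T ^^ Suc i) [:b:] = (\<Sum>r\<le>Suc i. Polynomial.smult ((\<delta> ^^ r) b) (w' r))" for b
  proof -
    have "(T ^^ Suc i) [:b:] = (\<Sum>r\<le>i. Polynomial.smult ((\<delta> ^^ r) b) (T (w r)))
        + (\<Sum>r\<le>i. Polynomial.smult ((\<delta> ^^ Suc r) b) (w r))"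
      by (simp add: w T_sum T_smult sum.distrib)
    also have "(\<Sum>r\<le>i. Polynomial.smult ((\<delta> ^^ r) b) (T (w r)))
        = (\<Sum>r\<le>Suc i. Polynomial.smult ((\<delta> ^^ r) b) (if r \<le> i then T (w r) else 0))"
      by simp
    also have "(\<Sum>r\<le>i. Polynomial.smult ((\<delta> ^^ Suc r) b) (w r))
        = (\<Sum>r\<le>Suc i. Polynomial.smult ((\<delta> ^^ r) b) (if r = 0 then 0 else w (r - 1)))"
      unfolding sum.atMost_Suc_shift by simp
    finally show ?thesis
      by (simp only: w'_def smult_add_right sum.distrib)
  qed
  moreover have "w' (Suc i) = 1" by (simp add: w'_def w)
  ultimately show ?case by blast
qed

text \<open>Row k of the combination represents the sum of es_s t^k b_s. By the choice of
  \<open>es\<close> only the iterate delta^(n-1) survives, and it occurs only for k = n - 1, with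
  coefficient w k = 1. So the combination is the matrix unit at (n - 1, 0).\<close>

lemma matrix_unit:
  obtains es :: "nat \<Rightarrow> 'k"
  where "\<And>k l. k < n \<Longrightarrow> l < n \<Longrightarrow>
    (\<Sum>s<n. [:es s:] * M [:bs ! s:] $$ (k, l)) = (if k = n - 1 \<and> l = 0 then 1 else 0)"
proof -
  obtain es where es: "\<And>r. r < n \<Longrightarrow> (\<Sum>s<n. es s * (\<delta> ^^ r) (bs ! s)) = (if r = n - 1 then 1 else 0)"
    using dual_coeffs by blast
  have "(\<Sum>s<n. [:es s:] * M [:bs ! s:] $$ (k, l)) = (if k = n - 1 \<and> l = 0 then 1 else 0)"
    if k: "k < n" and l: "l < n" for k l
  proof -
    obtain w where w: "w k = 1"
      "\<And>b. (T ^^ k) [:b:] = (\<Sum>r\<le>k. Polynomial.smult ((\<delta> ^^ r) b) (w r))"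
      using T_iter_const by blast
    have "monom 1 k \<star> f = (T ^^ k) f" for f
      by (simp add: dmult_eq_sum[of _ k] degree_monom_eq if_distrib[of "\<lambda>c. Polynomial.smult c _"] cong: if_cong)
    then have "expand (\<lambda>l. \<Sum>s<n. [:es s:] * M [:bs ! s:] $$ (k, l))
        = (\<Sum>s<n. Polynomial.smult (es s) ((T ^^ k) [:bs ! s:]))"
      unfolding expand_def P_sum sum_distrib_right
      by (subst sum.swap) (simp add: P_smult M_row[OF k, symmetric] smult_sum_right)
    also have "\<dots> = (\<Sum>r\<le>k. Polynomial.smult (\<Sum>s<n. es s * (\<delta> ^^ r) (bs ! s)) (w r))"
      unfolding w(2) by (simp add: smult_sum flip: smult_sum_right) (rule sum.swap)
    also have "\<dots> = (\<Sum>r\<le>k. if r = n - 1 then w r else 0)"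
      using k by (intro sum.cong) (auto simp: es)
    also have "\<dots> = (if k = n - 1 then 1 else 0)"
      using k w(1) by auto
    also have "\<dots> = expand (\<lambda>l. if k = n - 1 \<and> l = 0 then 1 else 0)"
      using n_pos expand_single[of 0 1] by (auto simp: expand_def)
    finally show ?thesis by (rule expand_inj[OF _ l])
  qed
  then show thesis by (rule that)
qed

end

section \<open>Spans and independence\<close>

context ring
begin

text \<open>Spans are built one generator at a time, so W need only absorb a multiple of a generator
  added to one of its elements.\<close>

lemma Span_subset:
  assumes "\<zero> \<in> W" and "\<And>k u v. k \<in> K \<Longrightarrow> u \<in> set Us \<Longrightarrow> v \<in> W \<Longrightarrow> k \<otimes> u \<oplus> v \<in> W"
  shows "Span K Us \<subseteq> W"
  using assms(2)
proof (induction Us)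
  case (Cons u Us)
  then have "Span K Us \<subseteq> W" by simp
  then show ?case
    using Cons.prems by (auto simp: line_extension_mem_iff subset_eq)
qed (use assms(1) in auto)

text \<open>A vector that lies in the span of the later ones lengthens the list without raising the
  dimension.\<close>

lemma length_eq_dimension_imp_independent:
  assumes K: "subfield K R" and Us: "set Us \<subseteq> carrier R" and dim: "dimension (length Us) K (Span K Us)"
  shows "independent K Us"
proof -
  \<comment> \<open>The inequality must be carried along: it excludes equality of length and
    dimension as soon as one vector is redundant.\<close>
  have "m \<le> length Us \<and> (m = length Us \<longrightarrow> independent K Us)"
    if "dimension m K (Span K Us)" for m
    using Us that
  proof (induction Us arbitrary: m)
    case Nil
    then show ?case
      using dimension_is_inj[OF K Nil(2), of 0] by auto
  next
    case (Cons u Us)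
    obtain k where k: "dimension k K (Span K Us)"
      using Span_finite_dimension[OF K, of Us] Cons.prems(1) by (auto simp: finite_dimension_def)
    note IH = Cons.IH[OF _ k]
    show ?case
    proof (cases "u \<in> Span K Us")
      case True
      have "Span K (u # Us) \<subseteq> Span K Us"
      proof (rule mono_Span_subset[OF K])
        show "set (u # Us) \<subseteq> Span K Us"
          using True Span_base_incl[OF K, of Us] Cons.prems(1) by (simp del: Span.simps)
      qed (use Cons.prems(1) in simp)
      moreover have "Span K Us \<subseteq> Span K (u # Us)"
        using Cons.prems(1) by (intro mono_Span[OF K]) simp_all
      ultimately have "Span K (u # Us) = Span K Us"
        by (rule subset_antisym)
      then have "m = k"
        using dimension_is_inj[OF K _ k] Cons.prems(2) by (simp only:)
      moreover have "k \<le> length Us"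
        using IH Cons.prems(1) by simp
      ultimately show ?thesis by simp
    next
      case False
      have "dimension (Suc k) K (Span K (u # Us))"
        using Suc_dim[OF _ False k] Cons.prems(1) by simp
      then have "m = Suc k"
        by (rule dimension_is_inj[OF K Cons.prems(2)])
      moreover have "k \<le> length Us" "k = length Us \<Longrightarrow> independent K (u # Us)"
        using IH Cons.prems(1) False by (simp_all add: li_Cons del: Span.simps)
      ultimately show ?thesis by simp
    qed
  qed
  from this[OF dim] show ?thesis by simp
qed

end

text \<open>A homomorphism that respects the scalars carries any dependence to the images. This is
  how independence of a basis of the algebra is obtained from its image in the matrices.\<close>

lemma independent_map_imp_independent:
  assumes "ring A" "ring B" and U: "set Us \<subseteq> carrier A" and k: "k \<subseteq> carrier A"
    and hom: "h \<in> Ring.ring_hom A B" and k_k': "h ` k \<subseteq> k'"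
    and ind: "ring.independent B k' (map h Us)"
  shows "ring.independent A k Us"
proof -
  interpret A: ring A by fact
  interpret B: ring B by fact
  have Span: "h a \<in> B.Span k' (map h Vs)" if "a \<in> A.Span k Vs" "set Vs \<subseteq> carrier A" for a Vs
    using that
  proof (induction Vs arbitrary: a)
    case Nil
    then show ?case
      using ring_hom_zero[OF hom \<open>ring A\<close> \<open>ring B\<close>] by simp
  next
    case (Cons v Vs)
    then obtain c w where c: "c \<in> k" "w \<in> A.Span k Vs" "a = c \<otimes>\<^bsub>A\<^esub> v \<oplus>\<^bsub>A\<^esub> w"
      by (auto simp: A.line_extension_mem_iff)
    have w: "w \<in> carrier A"
      using A.Span_in_carrier[OF k, of Vs] Cons.prems c(2) by (simp add: subset_iff del: A.Span.simps)
    have "h a = h c \<otimes>\<^bsub>B\<^esub> h v \<oplus>\<^bsub>B\<^esub> h w"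
      using c(1,3) k w Cons.prems(2) by (simp add: ring_hom_add[OF hom] ring_hom_mult[OF hom] subset_iff)
    moreover have "h c \<in> k'"
      using c(1) k_k' by blast
    moreover have "h w \<in> B.Span k' (map h Vs)"
      using Cons.IH[OF c(2)] Cons.prems(2) by simp
    ultimately show ?case
      by (auto simp: B.line_extension_mem_iff)
  qed
  show ?thesis
    using U ind
  proof (induction Us)
    case (Cons u Us)
    then have "B.independent k' (h u # map h Us)" "u \<in> carrier A" "set Us \<subseteq> carrier A"
      by simp_all
    note B.independent_backwards[OF this(1)] this(2,3)
    then show ?case
      using Span[of u Us] Cons.IH by (blast intro: A.li_Cons)
  qed (rule A.li_Nil)
qed

section \<open>The matrix algebra as a vector space over the scalar matrices\<close>

abbreviation scalar_mats :: "nat \<Rightarrow> 'e::field mat set" where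
  "scalar_mats n \<equiv> range (\<lambda>c. c \<cdot>\<^sub>m 1\<^sub>m n)"

lemma smult_one_mult: "A \<in> carrier_mat n n \<Longrightarrow> (c \<cdot>\<^sub>m 1\<^sub>m n) * A = c \<cdot>\<^sub>m (A :: 'e::comm_ring_1 mat)"
  by (simp add: mult_smult_assoc_mat[of _ n n])

lemma subfield_scalar_mats:
  assumes "n > 0"
  shows "subfield (scalar_mats n :: 'e::field mat set) (ring_mat TYPE('e) n ())"
proof -
  let ?B = "ring_mat TYPE('e) n ()"
  have eqs: "carrier (class_ring :: 'e ring) = UNIV" "mult (class_ring :: 'e ring) = (*)"
    "add (class_ring :: 'e ring) = (+)" "one (class_ring :: 'e ring) = 1"
    by (simp_all add: class_ring_simps)
  have "(\<lambda>c. c \<cdot>\<^sub>m 1\<^sub>m n) \<in> Ring.ring_hom (class_ring :: 'e ring) ?B"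
  proof (rule ring_hom_memI)
    fix a b :: 'e
    show "(a \<otimes>\<^bsub>class_ring\<^esub> b) \<cdot>\<^sub>m 1\<^sub>m n = (a \<cdot>\<^sub>m 1\<^sub>m n) \<otimes>\<^bsub>?B\<^esub> (b \<cdot>\<^sub>m 1\<^sub>m n)"
      by (simp add: eqs ring_mat_simps smult_one_mult) (auto intro!: eq_matI)
    show "(a \<oplus>\<^bsub>class_ring\<^esub> b) \<cdot>\<^sub>m 1\<^sub>m n = (a \<cdot>\<^sub>m 1\<^sub>m n) \<oplus>\<^bsub>?B\<^esub> (b \<cdot>\<^sub>m 1\<^sub>m n)"
      by (simp add: eqs ring_mat_simps add_smult_distrib_right_mat[of _ n n])
  qed (auto simp: eqs ring_mat_simps)
  then interpret h: ring_hom_ring "class_ring :: 'e ring" ?B "\<lambda>c. c \<cdot>\<^sub>m 1\<^sub>m n"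
    by (rule ring_hom_ringI2[OF field.is_ring[OF class_field] ring_mat])
  have "\<one>\<^bsub>?B\<^esub> \<noteq> \<zero>\<^bsub>?B\<^esub>"
  proof
    assume "\<one>\<^bsub>?B\<^esub> = \<zero>\<^bsub>?B\<^esub>"
    then have "(1\<^sub>m n :: 'e mat) $$ (0, 0) = 0\<^sub>m n n $$ (0, 0)"
      by (simp add: ring_mat_simps)
    then show False using assms by simp
  qed
  then show ?thesis
    by (rule h.img_is_subfield(2)[OF field.carrier_is_subfield[OF class_field], unfolded eqs(1)])
qed

definition mat_unit :: "nat \<Rightarrow> nat \<times> nat \<Rightarrow> 'e::zero_neq_one mat" where
  "mat_unit n ij = mat n n (\<lambda>kl. if kl = ij then 1 else 0)"

lemma mat_unit_carrier [simp]: "mat_unit n ij \<in> carrier_mat n n"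
  by (simp add: mat_unit_def)

lemma mat_units_Span:
  fixes Y :: "'e::field mat"
  assumes "Y \<in> carrier_mat n n" and "\<And>i j. i < n \<Longrightarrow> j < n \<Longrightarrow> (i, j) \<notin> set L \<Longrightarrow> Y $$ (i, j) = 0"
  shows "Y \<in> ring.Span (ring_mat TYPE('e) n ()) (scalar_mats n) (map (mat_unit n) L)"
proof -
  interpret B: ring "ring_mat TYPE('e) n ()" by (rule ring_mat)
  show ?thesis
    using assms
  proof (induction L arbitrary: Y)
    case Nil
    then have "Y = 0\<^sub>m n n" by (intro eq_matI) auto
    then show ?case by (simp add: ring_mat_simps)
  next
    case (Cons ij L)
    let ?Y = "mat n n (\<lambda>kl. if kl = ij then 0 else Y $$ kl)"
    have "?Y \<in> B.Span (scalar_mats n) (map (mat_unit n) L)"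
      using Cons.prems by (intro Cons.IH) auto
    moreover have "Y = (Y $$ ij \<cdot>\<^sub>m 1\<^sub>m n) * mat_unit n ij + ?Y"
      using Cons.prems(1) by (intro eq_matI) (auto simp: smult_one_mult mat_unit_def simp del: mult_smult_assoc_mat)
    ultimately show ?case
      by (auto simp: B.line_extension_mem_iff ring_mat_simps)
  qed
qed

lemma dimension_mat:
  assumes "n > 0"
  shows "ring.dimension (ring_mat TYPE('e::field) n ()) (n * n) (scalar_mats n) (carrier_mat n n)"
proof -
  interpret B: ring "ring_mat TYPE('e) n ()" by (rule ring_mat)
  have ind: "B.independent (scalar_mats n) (map (mat_unit n) L)"
    if "distinct L" "set L \<subseteq> {..<n} \<times> {..<n}" for L
    using that
  proof (induction L)
    case (Cons ij L)
    have "mat_unit n ij \<notin> B.Span (scalar_mats n) (map (mat_unit n) L)"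
    proof
      \<comment> \<open>All the remaining matrix units vanish at position \<open>ij\<close>, and
        this property passes to their span.\<close>
      let ?W = "{Y \<in> carrier_mat n n. Y $$ ij = (0 :: 'e)}"
      assume "mat_unit n ij \<in> B.Span (scalar_mats n) (map (mat_unit n) L)"
      moreover have "B.Span (scalar_mats n) (map (mat_unit n) L) \<subseteq> ?W"
      proof (rule B.Span_subset)
        fix k u v :: "'e mat"
        assume "k \<in> scalar_mats n" "u \<in> set (map (mat_unit n) L)" "v \<in> ?W"
        moreover have "ij \<notin> set L" using Cons.prems by simp
        ultimately show "k \<otimes>\<^bsub>ring_mat TYPE('e) n ()\<^esub> u \<oplus>\<^bsub>ring_mat TYPE('e) n ()\<^esub> v \<in> ?W"
          using Cons.prems(2) by (auto simp: ring_mat_simps smult_one_mult mat_unit_def simp del: mult_smult_assoc_mat)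
      qed (use Cons.prems(2) in \<open>auto simp: ring_mat_simps\<close>)
      ultimately show False
        using Cons.prems(2) by (auto simp: mat_unit_def)
    qed
    then show ?case
      using Cons by (auto intro!: B.li_Cons simp: ring_mat_simps)
  qed auto
  let ?L = "List.product [0..<n] [0..<n]"
  have "B.Span (scalar_mats n) (map (mat_unit n) ?L) \<subseteq> carrier_mat n n"
    by (rule order_trans[OF B.Span_in_carrier]) (auto simp: ring_mat_simps)
  moreover have "carrier_mat n n \<subseteq> B.Span (scalar_mats n) (map (mat_unit n) ?L)"
    by (intro subsetI mat_units_Span) auto
  ultimately have "B.Span (scalar_mats n) (map (mat_unit n) ?L) = carrier_mat n n"
    by (rule subset_antisym)
  moreover have "B.independent (scalar_mats n) (map (mat_unit n) ?L)"
    by (rule ind) (auto simp: distinct_product)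
  ultimately have "B.dimension (length (map (mat_unit n :: _ \<Rightarrow> 'e mat) ?L)) (scalar_mats n) (carrier_mat n n)"
    by (intro B.dimensionI[OF subfield_scalar_mats[OF assms]])
  then show ?thesis
    by (simp only: length_map length_product length_upt diff_zero)
qed

lemma Span_mat_closed:
  fixes Us :: "'e::field mat list"
  assumes "n > 0" "set Us \<subseteq> carrier_mat n n"
  defines "W \<equiv> ring.Span (ring_mat TYPE('e) n ()) (scalar_mats n) Us"
  shows "W \<subseteq> carrier_mat n n" "0\<^sub>m n n \<in> W" "A \<in> W \<Longrightarrow> B \<in> W \<Longrightarrow> A + B \<in> W"
    "A \<in> W \<Longrightarrow> c \<cdot>\<^sub>m A \<in> W" "set Us \<subseteq> W"
proof -
  interpret B: ring "ring_mat TYPE('e) n ()" by (rule ring_mat)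
  note K = subfield_scalar_mats[OF assms(1), where 'e = 'e]
  have Us: "set Us \<subseteq> carrier (ring_mat TYPE('e) n ())"
    using assms(2) by (simp add: ring_mat_simps)
  show sub: "W \<subseteq> carrier_mat n n" and "0\<^sub>m n n \<in> W" "A \<in> W \<Longrightarrow> B \<in> W \<Longrightarrow> A + B \<in> W"
    using B.Span_subgroup_props[OF K Us, folded W_def, unfolded ring_mat_simps] by blast+
  show "set Us \<subseteq> W"
    using B.Span_base_incl[OF K Us] by (simp only: W_def)
  show "c \<cdot>\<^sub>m A \<in> W" if "A \<in> W"
  proof -
    have "(c \<cdot>\<^sub>m 1\<^sub>m n) * A \<in> W"
      using B.Span_smult_closed[OF K Us, folded W_def, unfolded ring_mat_simps, OF _ that] by blast
    then show ?thesis
      using smult_one_mult[of A n c] sub that by (metis subsetD)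
  qed
qed

section \<open>The ring of central quotients\<close>

text \<open>The operations of \<open>fraction_ring\<close> are unions over all representatives. Once
  the result is known to be the same for each of them, the union collapses to it.\<close>

lemma UN_pair_const:
  assumes "(a, b) \<in> X" "\<And>f q. (f, q) \<in> X \<Longrightarrow> g f q = c"
  shows "(\<Union>(f, q) \<in> X. g f q) = c"
  using assms by fastforce

context differential_extension
begin

abbreviation Q where "Q \<equiv> polys_in \<delta> F x - {0}"
abbreviation A where "A \<equiv> central_quotients \<delta> F x"
abbreviation k where "k \<equiv> central_fractions \<delta> F x"

definition denoms where "denoms = polys_over F - {0}"

text \<open>Denominators are named by polynomials of the commutative ring F[x] instead of their
  images in K[t;delta], so that they can be rearranged by ordinary commutativity.\<close>

definition cfrac where "cfrac f a = frac R Q f (P a)"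

lemma polys_over_mult: "a \<in> polys_over F \<Longrightarrow> b \<in> polys_over F \<Longrightarrow> a * b \<in> polys_over F"
  by (simp add: polys_over_iff_deriv map_poly_deriv_mult)

lemma polys_over_0 [simp]: "0 \<in> polys_over F"
  and polys_over_1 [simp]: "1 \<in> polys_over F"
  by (simp_all add: polys_over_iff_deriv)

lemma denoms_mult [simp]: "a \<in> denoms \<Longrightarrow> b \<in> denoms \<Longrightarrow> a * b \<in> denoms"
  by (auto simp: denoms_def polys_over_mult)

lemma denoms_1 [simp]: "1 \<in> denoms"
  by (simp add: denoms_def)

lemma denoms_over: "a \<in> denoms \<Longrightarrow> a \<in> polys_over F"
  by (simp add: denoms_def)

lemma P_eq_0_iff [simp]: "P a = 0 \<longleftrightarrow> a = 0"
  by (metis P_0 P_top(2) leading_coeff_0_iff)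

lemma P_inj: "P a = P b \<longleftrightarrow> a = b"
  using P_eq_0_iff[of "a - b"] by (simp add: P_diff del: P_eq_0_iff)

lemma Q_eq: "Q = P ` denoms"
  by (auto simp: polys_in_def denoms_def)

lemma P_left: "a \<in> polys_over F \<Longrightarrow> f \<star> (P a \<star> q) = P a \<star> (f \<star> q)"
  by (metis P_central dmult_assoc)

lemma P_P: "P a \<star> (P b \<star> f) = P (a * b) \<star> f"
  by (simp add: P_mult dmult_assoc)

lemma P_mult_mult: "b \<in> polys_over F \<Longrightarrow> (P a \<star> f) \<star> (P b \<star> q) = P (a * b) \<star> (f \<star> q)"
  by (simp add: dmult_assoc P_left[of b f q] P_P)

lemma denoms_cancel: "a \<in> denoms \<Longrightarrow> P a \<star> f = P a \<star> q \<longleftrightarrow> f = q"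
  using dmult_eq_0_iff[of "P a" "f - q"] by (auto simp: dmult_diff_right denoms_def)

text \<open>Centrality moves both denominators to the left, the side on which they can be merged and
  cancelled.\<close>

lemma frac_rel_iff:
  "((f, q), (f', q')) \<in> frac_rel R Q \<longleftrightarrow>
    (\<exists>a\<in>denoms. \<exists>b\<in>denoms. q = P a \<and> q' = P b \<and> P b \<star> f = P a \<star> f')"
proof -
  have "q \<in> Q \<longleftrightarrow> (\<exists>a\<in>denoms. q = P a)" for q
    unfolding Q_eq by auto
  then show ?thesis
    by (auto simp: frac_rel_def) (metis denoms_over P_central)+
qed

lemma equiv_frac_rel: "equiv (UNIV \<times> Q) (frac_rel R Q)"
proof (rule equivI)
  show "trans (frac_rel R Q)"
  proof (rule transI)
    fix X Y Z assume "(X, Y) \<in> frac_rel R Q" "(Y, Z) \<in> frac_rel R Q"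
    then obtain f g h a b c where "X = (f, P a)" "Z = (h, P c)"
      and abc: "a \<in> denoms" "b \<in> denoms" "c \<in> denoms" and eqs: "P b \<star> f = P a \<star> g" "P c \<star> g = P b \<star> h"
      by (cases X, cases Y, cases Z) (auto simp: frac_rel_iff P_inj)
    \<comment> \<open>Transitivity holds after multiplication by the middle denominator, which can
      then be cancelled because there are no zero divisors.\<close>
    moreover have "P b \<star> (P c \<star> f) = P b \<star> (P a \<star> h)"
    proof -
      have "P b \<star> (P c \<star> f) = P c \<star> (P b \<star> f)" by (simp add: P_P mult.commute)
      also have "\<dots> = P a \<star> (P c \<star> g)" by (simp add: eqs(1) P_P mult.commute)
      also have "\<dots> = P a \<star> (P b \<star> h)" by (simp only: eqs)
      finally show ?thesis by (simp add: P_P mult.commute)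
    qed
    ultimately show "(X, Z) \<in> frac_rel R Q"
      by (auto simp: frac_rel_iff denoms_cancel)
  qed
qed (auto simp: refl_on_def sym_def frac_rel_def)

lemma cfrac_eq_iff:
  assumes "a \<in> denoms" "b \<in> denoms"
  shows "cfrac f a = cfrac f' b \<longleftrightarrow> P b \<star> f = P a \<star> f'"
proof -
  have "cfrac f a = cfrac f' b \<longleftrightarrow> ((f, P a), (f', P b)) \<in> frac_rel R Q"
    unfolding cfrac_def frac_def
    by (rule eq_equiv_class_iff[OF equiv_frac_rel]) (use assms in \<open>auto simp: Q_eq\<close>)
  then show ?thesis
    using assms by (auto simp: frac_rel_iff P_inj)
qed

lemma mem_cfrac_iff:
  assumes "a \<in> denoms"
  shows "(f', q) \<in> cfrac f a \<longleftrightarrow> (\<exists>b\<in>denoms. q = P b \<and> P b \<star> f = P a \<star> f')"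
  using assms by (auto simp: cfrac_def frac_def frac_rel_iff P_inj)

lemma carrier_A: "carrier A = {cfrac f a | f a. a \<in> denoms}"
  unfolding central_quotients_def fraction_ring_def quotient_def cfrac_def frac_def
  by (auto simp: Q_eq image_iff)

lemma cfrac_carrier [simp]: "a \<in> denoms \<Longrightarrow> cfrac f a \<in> carrier A"
  by (auto simp: carrier_A)

lemma A_mult:
  assumes "a \<in> denoms" "b \<in> denoms"
  shows "cfrac f a \<otimes>\<^bsub>A\<^esub> cfrac g b = cfrac (f \<star> g) (a * b)"
proof -
  have mem: "(f, P a) \<in> cfrac f a" "(g, P b) \<in> cfrac g b"
    using assms by (auto simp: mem_cfrac_iff)
  have "frac R Q (f' \<star> g') (q \<star> r) = cfrac (f \<star> g) (a * b)"
    if fq: "(f', q) \<in> cfrac f a" and gr: "(g', r) \<in> cfrac g b" for f' q g' r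
  proof -
    obtain a' b' where ab': "a' \<in> denoms" "b' \<in> denoms" "q = P a'" "r = P b'"
      and eqs: "P a' \<star> f = P a \<star> f'" "P b' \<star> g = P b \<star> g'"
      using fq gr assms by (auto simp: mem_cfrac_iff)
    have "P (a * b) \<star> (f' \<star> g') = (P a \<star> f') \<star> (P b \<star> g')"
      using assms by (simp add: P_mult_mult denoms_over)
    also have "\<dots> = P (a' * b') \<star> (f \<star> g)"
      using ab' by (simp add: P_mult_mult denoms_over flip: eqs)
    finally have "cfrac (f' \<star> g') (a' * b') = cfrac (f \<star> g) (a * b)"
      using assms ab' by (simp add: cfrac_eq_iff)
    then show ?thesis
      by (simp add: cfrac_def ab' P_mult)
  qed
  then have "(\<Union>(f', q)\<in>cfrac f a. \<Union>(g', r)\<in>cfrac g b. frac R Q (f' \<star> g') (q \<star> r)) = cfrac (f \<star> g) (a * b)"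
    by (intro UN_pair_const[OF mem(1)]) (rule UN_pair_const[OF mem(2)])
  then show ?thesis
    by (simp add: central_quotients_def fraction_ring_def)
qed

lemma A_add:
  assumes "a \<in> denoms" "b \<in> denoms"
  shows "cfrac f a \<oplus>\<^bsub>A\<^esub> cfrac g b = cfrac (P b \<star> f + P a \<star> g) (a * b)"
proof -
  have mem: "(f, P a) \<in> cfrac f a" "(g, P b) \<in> cfrac g b"
    using assms by (auto simp: mem_cfrac_iff)
  have "frac R Q (f' \<star> r + g' \<star> q) (q \<star> r) = cfrac (P b \<star> f + P a \<star> g) (a * b)"
    if fq: "(f', q) \<in> cfrac f a" and gr: "(g', r) \<in> cfrac g b" for f' q g' r
  proof -
    obtain a' b' where ab': "a' \<in> denoms" "b' \<in> denoms" "q = P a'" "r = P b'"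
      and eqs: "P a' \<star> f = P a \<star> f'" "P b' \<star> g = P b \<star> g'"
      using fq gr assms by (auto simp: mem_cfrac_iff)
    have "P (a * b) \<star> (P b' \<star> f' + P a' \<star> g') = P (b * b') \<star> (P a \<star> f') + P (a * a') \<star> (P b \<star> g')"
      by (simp add: dmult_add_right P_P mult.commute mult.left_commute)
    also have "\<dots> = P (b * b') \<star> (P a' \<star> f) + P (a * a') \<star> (P b' \<star> g)"
      by (simp only: eqs)
    also have "\<dots> = P (a' * b') \<star> (P b \<star> f + P a \<star> g)"
      by (simp add: dmult_add_right P_P mult.commute mult.left_commute)
    finally have "cfrac (P b' \<star> f' + P a' \<star> g') (a' * b') = cfrac (P b \<star> f + P a \<star> g) (a * b)"
      using assms ab' by (simp add: cfrac_eq_iff)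
    then show ?thesis
      using ab' P_central[of b' f'] P_central[of a' g'] by (simp add: cfrac_def P_mult denoms_over)
  qed
  then have "(\<Union>(f', q)\<in>cfrac f a. \<Union>(g', r)\<in>cfrac g b. frac R Q (f' \<star> r + g' \<star> q) (q \<star> r)) = cfrac (P b \<star> f + P a \<star> g) (a * b)"
    by (intro UN_pair_const[OF mem(1)]) (rule UN_pair_const[OF mem(2)])
  then show ?thesis
    by (simp add: central_quotients_def fraction_ring_def)
qed

lemma A_one: "\<one>\<^bsub>A\<^esub> = cfrac 1 1"
  and A_zero: "\<zero>\<^bsub>A\<^esub> = cfrac 0 1"
  by (simp_all add: central_quotients_def fraction_ring_def cfrac_def)

lemma carrier_A_cases:
  assumes "X \<in> carrier A"
  obtains f a where "a \<in> denoms" "X = cfrac f a"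
  using assms by (auto simp: carrier_A)

lemma ring_A: "ring A"
proof (rule ringI)
  show "abelian_group A"
  proof (rule abelian_groupI)
    fix X assume "X \<in> carrier A"
    then obtain f a where X: "a \<in> denoms" "X = cfrac f a" by (rule carrier_A_cases)
    show "\<zero>\<^bsub>A\<^esub> \<oplus>\<^bsub>A\<^esub> X = X"
      using X by (simp add: A_add A_zero)
    have "cfrac (- f) a \<oplus>\<^bsub>A\<^esub> X = \<zero>\<^bsub>A\<^esub>"
      using X by (simp add: A_add A_zero cfrac_eq_iff dmult_minus_right)
    then show "\<exists>Y\<in>carrier A. Y \<oplus>\<^bsub>A\<^esub> X = \<zero>\<^bsub>A\<^esub>"
      using X by (intro bexI[of _ "cfrac (- f) a"]) simp_all
    fix Y assume "Y \<in> carrier A"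
    then obtain g b where Y: "b \<in> denoms" "Y = cfrac g b" by (rule carrier_A_cases)
    show "X \<oplus>\<^bsub>A\<^esub> Y \<in> carrier A"
      using X Y by (simp add: A_add)
    show "X \<oplus>\<^bsub>A\<^esub> Y = Y \<oplus>\<^bsub>A\<^esub> X"
      using X Y by (simp add: A_add mult.commute add.commute)
    fix Z assume "Z \<in> carrier A"
    then obtain h c where Z: "c \<in> denoms" "Z = cfrac h c" by (rule carrier_A_cases)
    show "X \<oplus>\<^bsub>A\<^esub> Y \<oplus>\<^bsub>A\<^esub> Z = X \<oplus>\<^bsub>A\<^esub> (Y \<oplus>\<^bsub>A\<^esub> Z)"
      using X Y Z by (simp add: A_add dmult_add_right P_P mult.commute mult.left_commute mult.assoc add.assoc)
  qed (simp add: A_zero)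
  show "monoid A"
  proof (rule monoidI)
    fix X assume "X \<in> carrier A"
    then obtain f a where X: "a \<in> denoms" "X = cfrac f a" by (rule carrier_A_cases)
    show "\<one>\<^bsub>A\<^esub> \<otimes>\<^bsub>A\<^esub> X = X" "X \<otimes>\<^bsub>A\<^esub> \<one>\<^bsub>A\<^esub> = X"
      using X by (simp_all add: A_mult A_one)
    fix Y assume "Y \<in> carrier A"
    then obtain g b where Y: "b \<in> denoms" "Y = cfrac g b" by (rule carrier_A_cases)
    show "X \<otimes>\<^bsub>A\<^esub> Y \<in> carrier A"
      using X Y by (simp add: A_mult)
    fix Z assume "Z \<in> carrier A"
    then obtain h c where Z: "c \<in> denoms" "Z = cfrac h c" by (rule carrier_A_cases)
    show "X \<otimes>\<^bsub>A\<^esub> Y \<otimes>\<^bsub>A\<^esub> Z = X \<otimes>\<^bsub>A\<^esub> (Y \<otimes>\<^bsub>A\<^esub> Z)"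
      using X Y Z by (simp add: A_mult dmult_assoc mult.assoc)
  qed (simp add: A_one)
next
  fix X Y Z assume "X \<in> carrier A" "Y \<in> carrier A" "Z \<in> carrier A"
  then obtain f g h a b c where XYZ: "X = cfrac f a" "Y = cfrac g b" "Z = cfrac h c" "a \<in> denoms" "b \<in> denoms" "c \<in> denoms"
    unfolding carrier_A by blast
  have "P (a * c * (b * c)) \<star> ((P b \<star> f + P a \<star> g) \<star> h)
      = P (a * b * c) \<star> (P (b * c) \<star> (f \<star> h) + P (a * c) \<star> (g \<star> h))"
    by (simp add: dmult_add_right dmult_add_left dmult_assoc P_P
        mult.commute mult.left_commute mult.assoc)
  then show "(X \<oplus>\<^bsub>A\<^esub> Y) \<otimes>\<^bsub>A\<^esub> Z = X \<otimes>\<^bsub>A\<^esub> Z \<oplus>\<^bsub>A\<^esub> Y \<otimes>\<^bsub>A\<^esub> Z"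
    using XYZ by (simp add: A_add A_mult cfrac_eq_iff)
  have "P (c * a * (c * b)) \<star> (h \<star> (P b \<star> f + P a \<star> g))
      = P (c * (a * b)) \<star> (P (c * b) \<star> (h \<star> f) + P (c * a) \<star> (h \<star> g))"
    using XYZ by (simp add: dmult_add_right P_P P_left[of a h] P_left[of b h] denoms_over
        mult.commute mult.left_commute mult.assoc)
  then show "Z \<otimes>\<^bsub>A\<^esub> (X \<oplus>\<^bsub>A\<^esub> Y) = Z \<otimes>\<^bsub>A\<^esub> X \<oplus>\<^bsub>A\<^esub> Z \<otimes>\<^bsub>A\<^esub> Y"
    using XYZ by (simp add: A_add A_mult cfrac_eq_iff)
qed

section \<open>The subfield F(x) and a generating list over it\<close>

abbreviation emb where "emb \<equiv> embed \<delta> F x"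

lemma emb_eq_cfrac: "emb f = cfrac f 1"
  by (simp add: embed_def cfrac_def)

lemma emb_carrier [simp]: "emb f \<in> carrier A"
  by (simp add: emb_eq_cfrac)

lemma emb_mult: "emb (f \<star> q) = emb f \<otimes>\<^bsub>A\<^esub> emb q"
  and emb_add: "emb (f + q) = emb f \<oplus>\<^bsub>A\<^esub> emb q"
  and emb_1: "emb 1 = \<one>\<^bsub>A\<^esub>"
  by (simp_all add: emb_eq_cfrac A_mult A_add A_one)

lemma k_eq: "k = {cfrac (P a) b | a b. a \<in> polys_over F \<and> b \<in> denoms}"
  unfolding central_fractions_def cfrac_def Q_eq unfolding polys_in_def by blast

lemma k_carrier: "k \<subseteq> carrier A"
  unfolding k_eq carrier_A by blast

lemma emb_P_in_k: "a \<in> polys_over F \<Longrightarrow> emb (P a) \<in> k"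
  unfolding k_eq emb_eq_cfrac mem_Collect_eq by (rule exI[of _ a], rule exI[of _ 1], simp)

text \<open>Expanding each coefficient of h in \<open>bs\<close> shows that the spanning list of K
  over F also spans K[x] over F[x].\<close>

lemma ex_span_polys: "\<exists>a. (\<forall>s<n. a s \<in> polys_over F) \<and> h = (\<Sum>s<n. Polynomial.smult (bs ! s) (a s))"
proof (induction h)
  case 0
  show ?case by (intro exI[of _ "\<lambda>_. 0"]) simp
next
  case (pCons b h)
  then obtain a where a: "\<forall>s<n. a s \<in> polys_over F" "h = (\<Sum>s<n. Polynomial.smult (bs ! s) (a s))" by auto
  obtain c where c: "\<forall>s<n. c s \<in> F" "b = (\<Sum>s<n. c s * bs ! s)"
    using span_bs[of b] by auto
  have "pCons b h = (\<Sum>s<n. Polynomial.smult (bs ! s) (pCons (c s) (a s)))"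
  proof (rule poly_eqI)
    fix i
    show "coeff (pCons b h) i = coeff (\<Sum>s<n. Polynomial.smult (bs ! s) (pCons (c s) (a s))) i"
      by (cases i) (simp_all only: c(2) a(2) coeff_sum coeff_pCons_0 coeff_pCons_Suc coeff_smult mult.commute[of "c _"])
  qed
  moreover have "\<forall>s<n. pCons (c s) (a s) \<in> polys_over F"
  proof (intro allI impI)
    fix s assume "s < n"
    then have "c s \<in> F" "a s \<in> polys_over F"
      using a(1) c(1) by blast+
    then show "pCons (c s) (a s) \<in> polys_over F"
      unfolding polys_over_iff coeff_pCons by (auto split: nat.splits)
  qed
  ultimately show ?case by (intro exI[of _ "\<lambda>s. pCons (c s) (a s)"] conjI)
qed

text \<open>The n^2 pairs (s, j) index the products b_s t^j. These are shown here to span over F(x);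
  their independence comes later, from the images in the matrix algebra.\<close>

definition A_index :: "(nat \<times> nat) list" where
  "A_index = List.product [0..<n] [0..<n]"

definition A_gen :: "nat \<times> nat \<Rightarrow> 'k poly" where
  "A_gen = (\<lambda>(s, j). monom (bs ! s) j)"

definition A_basis where "A_basis = map (\<lambda>l. emb (A_gen l)) A_index"

lemma ex_A_gen: "\<exists>a. (\<forall>l\<in>set A_index. a l \<in> polys_over F) \<and> f = (\<Sum>l\<leftarrow>A_index. P (a l) \<star> A_gen l)"
proof -
  obtain h where h: "f = expand h" using expand_surj by blast
  have "\<forall>j. \<exists>a. (\<forall>s<n. a s \<in> polys_over F) \<and> h j = (\<Sum>s<n. Polynomial.smult (bs ! s) (a s))"
    using ex_span_polys by blast
  from choice[OF this] obtain a where
    "\<forall>j. (\<forall>s<n. a j s \<in> polys_over F) \<and> h j = (\<Sum>s<n. Polynomial.smult (bs ! s) (a j s))" ..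
  then have a: "\<And>j s. s < n \<Longrightarrow> a j s \<in> polys_over F"
    "\<And>j. h j = (\<Sum>s<n. Polynomial.smult (bs ! s) (a j s))"
    by blast+
  have "P (a j s) \<star> monom (bs ! s) j = Polynomial.smult (bs ! s) (P (a j s)) * monom 1 j" if "s < n" for j s
  proof -
    have "monom (bs ! s) j = [:bs ! s:] \<star> monom 1 j" by (simp add: smult_monom)
    also have "P (a j s) \<star> \<dots> = [:bs ! s:] \<star> (P (a j s) \<star> monom 1 j)"
      by (rule P_left[OF a(1)[OF that], symmetric])
    finally show ?thesis by (simp add: dmult_monom_right)
  qed
  then have "f = (\<Sum>j<n. \<Sum>s<n. P (a j s) \<star> monom (bs ! s) j)"
    unfolding h expand_def a(2) by (simp add: P_sum P_smult sum_distrib_right)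
  also have "\<dots> = (\<Sum>l\<in>{..<n} \<times> {..<n}. P (a (snd l) (fst l)) \<star> A_gen l)"
    by (subst sum.swap) (simp add: sum.cartesian_product A_gen_def case_prod_beta)
  also have "\<dots> = (\<Sum>l\<leftarrow>A_index. P (a (snd l) (fst l)) \<star> A_gen l)"
    by (subst sum_list_distinct_conv_sum_set)
      (auto simp: A_index_def distinct_product intro!: sum.cong)
  finally show ?thesis
    using a(1) by (intro exI[of _ "\<lambda>l. a (snd l) (fst l)"]) (auto simp: A_index_def)
qed

lemma Span_A_basis: "ring.Span A k A_basis = carrier A"
proof -
  interpret A: ring A by (rule ring_A)
  have Span: "cfrac (\<Sum>l\<leftarrow>L. P (a l) \<star> A_gen l) b \<in> A.Span k (map (\<lambda>l. emb (A_gen l)) L)"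
    if "\<forall>l\<in>set L. a l \<in> polys_over F" "b \<in> denoms" for L a b
    using that
  proof (induction L)
    case Nil
    then show ?case by (simp add: A_zero cfrac_eq_iff)
  next
    case (Cons l L)
    have "cfrac (\<Sum>l\<leftarrow>l # L. P (a l) \<star> A_gen l) b =
        cfrac (P (a l)) b \<otimes>\<^bsub>A\<^esub> emb (A_gen l) \<oplus>\<^bsub>A\<^esub> cfrac (\<Sum>l\<leftarrow>L. P (a l) \<star> A_gen l) b"
      using Cons.prems by (simp add: emb_eq_cfrac A_mult A_add cfrac_eq_iff dmult_add_right P_P ac_simps)
    moreover have "cfrac (P (a l)) b \<in> k"
      using Cons.prems by (auto simp: k_eq)
    moreover have "cfrac (\<Sum>l\<leftarrow>L. P (a l) \<star> A_gen l) b \<in> A.Span k (map (\<lambda>l. emb (A_gen l)) L)"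
      using Cons by simp
    ultimately show ?case
      unfolding list.map A.Span.simps foldr_Cons comp_def A.line_extension_mem_iff by blast
  qed
  have "cfrac f b \<in> A.Span k A_basis" if "b \<in> denoms" for f b
  proof -
    obtain a where "\<forall>l\<in>set A_index. a l \<in> polys_over F" "f = (\<Sum>l\<leftarrow>A_index. P (a l) \<star> A_gen l)"
      using ex_A_gen by blast
    then show ?thesis
      using Span[of A_index a b] that by (simp add: A_basis_def del: A.Span.simps)
  qed
  then have "carrier A \<subseteq> A.Span k A_basis"
    unfolding carrier_A by blast
  moreover have "A.Span k A_basis \<subseteq> carrier A"
    by (rule A.Span_in_carrier[OF k_carrier]) (auto simp: A_basis_def)
  ultimately show ?thesis by (intro subset_antisym)
qed

end

section \<open>A splitting\<close>

lemma mat_eq_smult_iff: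
  fixes A B :: "'e::field mat"
  assumes "A \<in> carrier_mat n n" "B \<in> carrier_mat n n" "c \<noteq> 0" "d \<noteq> 0"
    and "d \<cdot>\<^sub>m A = c \<cdot>\<^sub>m B"
  shows "(1 / c) \<cdot>\<^sub>m A = (1 / d) \<cdot>\<^sub>m B"
proof (rule eq_matI)
  fix i j assume "i < dim_row ((1 / d) \<cdot>\<^sub>m B)" "j < dim_col ((1 / d) \<cdot>\<^sub>m B)"
  then have ij: "i < n" "j < n" using assms by auto
  have "(d \<cdot>\<^sub>m A) $$ (i, j) = (c \<cdot>\<^sub>m B) $$ (i, j)"
    using assms(5) by simp
  then show "((1 / c) \<cdot>\<^sub>m A) $$ (i, j) = ((1 / d) \<cdot>\<^sub>m B) $$ (i, j)"
    using assms(1-4) ij by (simp add: field_simps)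
qed (use assms in auto)

definition to_frac :: "'a::idom \<Rightarrow> 'a fract" where
  "to_frac a = Fract a 1"

interpretation to_frac: comm_ring_hom to_frac
  by unfold_locales (simp_all add: to_frac_def Zero_fract_def One_fract_def)

lemma to_frac_eq_0_iff [simp]: "to_frac a = 0 \<longleftrightarrow> a = 0"
  by (simp add: to_frac_def Zero_fract_def eq_fract)

context differential_extension
begin

abbreviation \<tau> :: "'k poly \<Rightarrow> 'k poly fract" where "\<tau> \<equiv> to_frac"

abbreviation B where "B \<equiv> ring_mat TYPE('k poly fract) n ()"

text \<open>For a denominator q = P a with a in F[x] the matrix M q is a times the identity, so its
  entry at (0, 0) recovers a. The choice of representative is immaterial by
  \<open>splitting_map_cfrac\<close>.\<close>

definition splitting_map :: "('k poly \<times> 'k poly) set \<Rightarrow> 'k poly fract mat" where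
  "splitting_map X = (let (f, q) = (SOME z. z \<in> X) in (1 / \<tau> (M q $$ (0, 0))) \<cdot>\<^sub>m map_mat \<tau> (M f))"

lemma map_M_carrier [simp]: "map_mat h (M f) \<in> carrier_mat n n"
  by simp

lemma M_P_mult: "c \<in> polys_over F \<Longrightarrow> M (P c \<star> f) = c \<cdot>\<^sub>m M f"
  using smult_one_mult[of "M f" n c] by (simp add: M_mult M_P)

lemma splitting_map_cfrac:
  assumes a: "a \<in> denoms"
  shows "splitting_map (cfrac f a) = (1 / \<tau> a) \<cdot>\<^sub>m map_mat \<tau> (M f)"
proof -
  obtain f' q where z: "(SOME z. z \<in> cfrac f a) = (f', q)" by (cases "SOME z. z \<in> cfrac f a")
  have "(f, P a) \<in> cfrac f a"
    using a by (auto simp: mem_cfrac_iff)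
  then have "(f', q) \<in> cfrac f a"
    unfolding z[symmetric] by (rule someI)
  then obtain b where b: "b \<in> denoms" "q = P b" "P b \<star> f = P a \<star> f'"
    using a by (auto simp: mem_cfrac_iff)
  have "b \<cdot>\<^sub>m M f = a \<cdot>\<^sub>m M f'"
    using a b by (simp flip: M_P_mult add: denoms_over)
  then have "map_mat \<tau> (b \<cdot>\<^sub>m M f) = map_mat \<tau> (a \<cdot>\<^sub>m M f')"
    by simp
  moreover have "map_mat \<tau> (c \<cdot>\<^sub>m X) = \<tau> c \<cdot>\<^sub>m map_mat \<tau> X" for c X
    by (intro eq_matI) (simp_all add: to_frac.hom_mult)
  ultimately have "\<tau> b \<cdot>\<^sub>m map_mat \<tau> (M f) = \<tau> a \<cdot>\<^sub>m map_mat \<tau> (M f')"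
    by (simp only:)
  then have "(1 / \<tau> a) \<cdot>\<^sub>m map_mat \<tau> (M f) = (1 / \<tau> b) \<cdot>\<^sub>m map_mat \<tau> (M f')"
    using a b by (intro mat_eq_smult_iff[of _ n]) (auto simp: denoms_def)
  moreover have "M (P b) $$ (0, 0) = b"
    using b n_pos by (simp add: M_P denoms_over)
  ultimately show ?thesis
    by (simp add: splitting_map_def z b)
qed

lemma splitting_map_emb: "splitting_map (emb f) = map_mat \<tau> (M f)"
  using splitting_map_cfrac[of 1 f] by (auto simp: emb_eq_cfrac intro!: eq_matI)

text \<open>On F(x) the splitting map yields scalar matrices, and the embedding is read off from one
  diagonal entry.\<close>

definition splitting_embedding :: "('k poly \<times> 'k poly) set \<Rightarrow> 'k poly fract" where
  "splitting_embedding X = splitting_map X $$ (0, 0)"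

lemma splitting_embedding_cfrac:
  assumes "a \<in> polys_over F" "b \<in> denoms"
  shows "splitting_embedding (cfrac (P a) b) = \<tau> a / \<tau> b"
  using assms n_pos by (simp add: splitting_embedding_def splitting_map_cfrac M_P)

lemma splitting_map_hom: "splitting_map \<in> Ring.ring_hom A B"
proof (rule ring_hom_memI)
  fix X assume "X \<in> carrier A"
  then obtain f a where X: "a \<in> denoms" "X = cfrac f a" by (rule carrier_A_cases)
  show "splitting_map X \<in> carrier B"
    using X by (simp add: splitting_map_cfrac ring_mat_simps)
  fix Y assume "Y \<in> carrier A"
  then obtain g b where Y: "b \<in> denoms" "Y = cfrac g b" by (rule carrier_A_cases)
  have ab: "\<tau> a \<noteq> 0" "\<tau> b \<noteq> 0"
    using X Y by (auto simp: denoms_def)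
  have mult: "map_mat \<tau> (M f * M g) = map_mat \<tau> (M f) * map_mat \<tau> (M g)"
    by (rule to_frac.mat_hom_mult[of _ n n _ n]) simp_all
  show "splitting_map (X \<otimes>\<^bsub>A\<^esub> Y) = splitting_map X \<otimes>\<^bsub>B\<^esub> splitting_map Y"
    using X Y
    by (simp add: A_mult splitting_map_cfrac ring_mat_simps M_mult mult to_frac.hom_mult
        mult_smult_distrib[of _ n n _ n] mult_smult_assoc_mat[of _ n n _ n])
      (auto intro!: eq_matI simp: mult.commute)
  show "splitting_map (X \<oplus>\<^bsub>A\<^esub> Y) = splitting_map X \<oplus>\<^bsub>B\<^esub> splitting_map Y"
    using X Y ab
    by (intro eq_matI) (simp_all add: A_add splitting_map_cfrac ring_mat_simps M_add M_P_mult denoms_over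
        to_frac.hom_mult to_frac.hom_add field_simps)
next
  show "splitting_map \<one>\<^bsub>A\<^esub> = \<one>\<^bsub>B\<^esub>"
  proof -
    have "M 1 = 1\<^sub>m n"
      using M_P[of 1] by (auto intro!: eq_matI)
    then show ?thesis
      using splitting_map_emb[of 1] by (simp add: emb_1 ring_mat_simps to_frac.mat_hom_one)
  qed
qed

lemma splitting_map_k:
  assumes "X \<in> k"
  shows "splitting_map X = splitting_embedding X \<cdot>\<^sub>m 1\<^sub>m n"
proof -
  obtain a b where X: "X = cfrac (P a) b" "a \<in> polys_over F" "b \<in> denoms"
    using assms unfolding k_eq by blast
  then show ?thesis
    by (intro eq_matI) (auto simp: splitting_map_cfrac M_P splitting_embedding_cfrac)
qed

lemma splitting_embedding_hom:
  "splitting_embedding \<in> Ring.ring_hom (A\<lparr>carrier := k\<rparr>) (class_ring :: 'k poly fract ring)"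
proof (rule ring_hom_memI)
  fix X Y assume "X \<in> carrier (A\<lparr>carrier := k\<rparr>)" "Y \<in> carrier (A\<lparr>carrier := k\<rparr>)"
  then have X: "X \<in> k" and Y: "Y \<in> k" by simp_all
  then have XY: "X \<in> carrier A" "Y \<in> carrier A" using k_carrier by auto
  show "splitting_embedding (X \<otimes>\<^bsub>A\<lparr>carrier := k\<rparr>\<^esub> Y) = splitting_embedding X \<otimes>\<^bsub>class_ring\<^esub> splitting_embedding Y"
    using ring_hom_mult[OF splitting_map_hom XY] X Y n_pos
    by (simp add: splitting_embedding_def[of "_ \<otimes>\<^bsub>A\<^esub> _"] splitting_map_k ring_mat_simps smult_one_mult)
  show "splitting_embedding (X \<oplus>\<^bsub>A\<lparr>carrier := k\<rparr>\<^esub> Y) = splitting_embedding X \<oplus>\<^bsub>class_ring\<^esub> splitting_embedding Y"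
    using ring_hom_add[OF splitting_map_hom XY] X Y n_pos
    by (simp add: splitting_embedding_def[of "_ \<oplus>\<^bsub>A\<^esub> _"] splitting_map_k ring_mat_simps)
qed (use ring_hom_one[OF splitting_map_hom] n_pos in \<open>simp_all add: splitting_embedding_def ring_mat_simps\<close>)

section \<open>Surjectivity of the scalar extension onto the matrices\<close>

lemma A_basis_carrier: "set A_basis \<subseteq> carrier A"
  by (auto simp: A_basis_def)

definition E_span where "E_span = ring.Span B (scalar_mats n) (map splitting_map A_basis)"

lemma splitting_images_carrier: "set (map splitting_map A_basis) \<subseteq> carrier_mat n n"
  by (auto simp: A_basis_def splitting_map_emb)

lemmas E_span_closed = Span_mat_closed[OF n_pos splitting_images_carrier, folded E_span_def]

lemma E_span_sum:
  fixes m :: nat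
  assumes "\<And>s. s < m \<Longrightarrow> Z s \<in> E_span"
  shows "mat n n (\<lambda>ij. \<Sum>s<m. Z s $$ ij) \<in> E_span"
  using assms
proof (induction m)
  case 0
  have "mat n n (\<lambda>ij. \<Sum>s<0. Z s $$ ij) = 0\<^sub>m n n"
    by (intro eq_matI) auto
  then show ?case using E_span_closed(2) by simp
next
  case (Suc m)
  have "Z m \<in> carrier_mat n n"
    using Suc.prems[of m] E_span_closed(1) by auto
  then have "mat n n (\<lambda>ij. \<Sum>s<Suc m. Z s $$ ij) = mat n n (\<lambda>ij. \<Sum>s<m. Z s $$ ij) + Z m"
    by (intro eq_matI) auto
  then show ?case
    using Suc.IH[OF Suc.prems] Suc.prems[of m] E_span_closed(3) by simp
qed

lemma M_in_E_span: "map_mat \<tau> (M f) \<in> E_span"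
proof -
  have M0: "map_mat \<tau> (M 0) = 0\<^sub>m n n"
    using M_P[of 0] by (intro eq_matI) simp_all
  have "map_mat \<tau> (M (\<Sum>l\<leftarrow>L. P (a l) \<star> A_gen l)) \<in> E_span"
    if "\<forall>l\<in>set L. a l \<in> polys_over F" "set L \<subseteq> set A_index" for L a
    using that
  proof (induction L)
    case Nil
    then show ?case using E_span_closed(2) by (simp add: M0)
  next
    case (Cons l L)
    have "map_mat \<tau> (M (\<Sum>l\<leftarrow>l # L. P (a l) \<star> A_gen l)) =
        \<tau> (a l) \<cdot>\<^sub>m splitting_map (emb (A_gen l)) + map_mat \<tau> (M (\<Sum>l\<leftarrow>L. P (a l) \<star> A_gen l))"
      using Cons.prems
      by (intro eq_matI) (simp_all add: M_add M_P_mult splitting_map_emb to_frac.hom_add to_frac.hom_mult)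
    moreover have "splitting_map (emb (A_gen l)) \<in> E_span"
      using E_span_closed(5) Cons.prems by (auto simp: A_basis_def)
    ultimately show ?case
      using E_span_closed(3,4) Cons by simp
  qed
  moreover obtain a where "\<forall>l\<in>set A_index. a l \<in> polys_over F" "f = (\<Sum>l\<leftarrow>A_index. P (a l) \<star> A_gen l)"
    using ex_A_gen[of f] by auto
  ultimately show ?thesis by simp
qed

text \<open>As long as i + a < n, the product t^i t^a is itself a basis element and no reduction by
  x takes place.\<close>

lemma M_monom_entry:
  assumes "i + a < n" and j: "j < n"
  shows "M (monom 1 a) $$ (i, j) = (if j = i + a then 1 else 0)"
proof -
  have "expand (\<lambda>j. M (monom 1 a) $$ (i, j)) = monom 1 (i + a)"
    using M_row[of i "monom 1 a"] assms by (simp add: expand_def dmult_monom_right mult_monom)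
  also have "\<dots> = expand (\<lambda>j. if j = i + a then 1 else 0)"
    using expand_single[OF assms(1), of 1] by simp
  finally show ?thesis
    by (rule expand_inj[OF _ j])
qed

text \<open>Multiplying the matrix unit of \<open>matrix_unit\<close> by powers of \<open>t\<close> on both sides gives matrices
  that are triangular with respect to the matrix units.\<close>

lemma mat_unit_in_E_span:
  assumes "i < n" "j < n"
  shows "mat_unit n (i, j) \<in> E_span"
  using assms(1)
proof (induction "n - i" arbitrary: i rule: less_induct)
  case less
  \<comment> \<open>Chosen so that column n - 1 of M(t^a) is 0 above row i and 1 in row i.\<close>
  define a where "a = n - 1 - i"
  obtain es :: "nat \<Rightarrow> 'k" where es: "\<And>k l. k < n \<Longrightarrow> l < n \<Longrightarrow>
    (\<Sum>s<n. [:es s:] * M [:bs ! s:] $$ (k, l)) = (if k = n - 1 \<and> l = 0 then 1 else 0)"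
    by (rule matrix_unit) blast
  let ?Ta = "M (monom 1 a)" and ?Tj = "M (monom 1 j)"
  define Z where "Z s = \<tau> [:es s:] \<cdot>\<^sub>m map_mat \<tau> (M (monom 1 a \<star> [:bs ! s:] \<star> monom 1 j))" for s
  \<comment> \<open>This is M(t^a) times the matrix unit at (n - 1, 0) times M(t^j). Row 0 of M(t^j)
    is the j-th unit vector, so the product places column n - 1 of M(t^a) into column j and is 0
    elsewhere.\<close>
  define Y where "Y = mat n n (\<lambda>rc. \<Sum>s<n. Z s $$ rc)"
  have Y_in: "Y \<in> E_span"
    unfolding Y_def Z_def by (intro E_span_sum E_span_closed(4) M_in_E_span)
  have Y: "Y $$ (r, c) = (if c = j then \<tau> (?Ta $$ (r, n - 1)) else 0)" if rc: "r < n" "c < n" for r c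
  proof -
    have "M (monom 1 a \<star> [:b:] \<star> monom 1 j) $$ (r, c)
        = (\<Sum>k<n. \<Sum>l<n. ?Ta $$ (r, k) * M [:b:] $$ (k, l) * ?Tj $$ (l, c))" for b
    proof -
      have "M (monom 1 a \<star> [:b:] \<star> monom 1 j) $$ (r, c) = (\<Sum>l<n. (?Ta * M [:b:]) $$ (r, l) * ?Tj $$ (l, c))"
        unfolding M_mult by (rule mult_mat_index[OF _ _ rc]) (auto intro: mult_carrier_mat[of _ n n])
      also have "\<dots> = (\<Sum>l<n. (\<Sum>k<n. ?Ta $$ (r, k) * M [:b:] $$ (k, l)) * ?Tj $$ (l, c))"
        by (intro sum.cong refl arg_cong2[of _ _ _ _ "(*)"] mult_mat_index rc) simp_all
      finally show ?thesis
        by (simp add: sum_distrib_right) (rule sum.swap)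
    qed
    then have "(\<Sum>s<n. [:es s:] * M (monom 1 a \<star> [:bs ! s:] \<star> monom 1 j) $$ (r, c))
        = (\<Sum>s<n. \<Sum>k<n. \<Sum>l<n. ?Ta $$ (r, k) * ([:es s:] * M [:bs ! s:] $$ (k, l)) * ?Tj $$ (l, c))"
      by (simp only: sum_distrib_left mult.left_commute mult.assoc)
    also have "\<dots> = (\<Sum>k<n. \<Sum>s<n. \<Sum>l<n. ?Ta $$ (r, k) * ([:es s:] * M [:bs ! s:] $$ (k, l)) * ?Tj $$ (l, c))"
      by (rule sum.swap)
    also have "\<dots> = (\<Sum>k<n. \<Sum>l<n. \<Sum>s<n. ?Ta $$ (r, k) * ([:es s:] * M [:bs ! s:] $$ (k, l)) * ?Tj $$ (l, c))"
      by (rule sum.cong[OF refl], rule sum.swap)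
    also have "\<dots> = (\<Sum>k<n. \<Sum>l<n. ?Ta $$ (r, k) * (if k = n - 1 \<and> l = 0 then 1 else 0) * ?Tj $$ (l, c))"
      by (intro sum.cong refl) (simp only: sum_distrib_left[symmetric] sum_distrib_right[symmetric] es lessThan_iff)
    also have "\<dots> = (\<Sum>k<n. \<Sum>l<n. if l = 0 then (if k = n - 1 then ?Ta $$ (r, k) * ?Tj $$ (l, c) else 0) else 0)"
      by (intro sum.cong refl) simp
    also have "\<dots> = ?Ta $$ (r, n - 1) * ?Tj $$ (0, c)"
      using n_pos by simp
    also have "?Tj $$ (0, c) = (if c = j then 1 else 0)"
      using M_monom_entry[of 0 j c] assms(2) rc by simp
    finally have "\<tau> (\<Sum>s<n. [:es s:] * M (monom 1 a \<star> [:bs ! s:] \<star> monom 1 j) $$ (r, c))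
        = (if c = j then \<tau> (?Ta $$ (r, n - 1)) else 0)"
      by simp
    then show ?thesis
      using rc by (simp only: to_frac.hom_sum to_frac.hom_mult) (simp add: Y_def Z_def)
  qed
  \<comment> \<open>Removes the entries of Y below row i; the units needed for that lie in later
    rows and are available by induction.\<close>
  define W where "W s = (if s > i then - \<tau> (?Ta $$ (s, n - 1)) \<cdot>\<^sub>m mat_unit n (s, j) else 0\<^sub>m n n)" for s
  have "W s \<in> E_span" if "s < n" for s
    using less(1)[of s] less(2) that E_span_closed(2,4) by (auto simp: W_def)
  then have "Y + mat n n (\<lambda>rc. \<Sum>s<n. W s $$ rc) \<in> E_span"
    by (intro E_span_closed(3) Y_in E_span_sum)
  also have "Y + mat n n (\<lambda>rc. \<Sum>s<n. W s $$ rc) = mat_unit n (i, j)"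
  proof (rule eq_matI)
    fix r c assume "r < dim_row (mat_unit n (i, j) :: 'k poly fract mat)"
      "c < dim_col (mat_unit n (i, j) :: 'k poly fract mat)"
    then have rc: "r < n" "c < n" by (simp_all add: mat_unit_def)
    have "(\<Sum>s<n. W s $$ (r, c)) = (\<Sum>s<n. if s = r then (if r > i \<and> c = j then - \<tau> (?Ta $$ (r, n - 1)) else 0) else 0)"
      using rc by (intro sum.cong) (auto simp: W_def mat_unit_def)
    then have sum: "(\<Sum>s<n. W s $$ (r, c)) = (if r > i \<and> c = j then - \<tau> (?Ta $$ (r, n - 1)) else 0)"
      using rc by simp
    have "?Ta $$ (r, n - 1) = (if r = i then 1 else 0)" if "r \<le> i"
      using M_monom_entry[of r a "n - 1"] that less(2) by (auto simp: a_def)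
    then show "(Y + mat n n (\<lambda>rc. \<Sum>s<n. W s $$ rc)) $$ (r, c) = mat_unit n (i, j) $$ (r, c)"
      using rc Y[OF rc] sum by (auto simp: mat_unit_def not_less)
  qed (simp_all add: mat_unit_def)
  finally show ?case .
qed

lemma E_span_eq: "E_span = carrier_mat n n"
proof
  show "E_span \<subseteq> carrier_mat n n" by (rule E_span_closed(1))
  show "carrier_mat n n \<subseteq> E_span"
  proof
    fix Y :: "'k poly fract mat" assume Y: "Y \<in> carrier_mat n n"
    interpret B: ring B by (rule ring_mat)
    let ?L = "List.product [0..<n] [0..<n]"
    have "Y \<in> B.Span (scalar_mats n) (map (mat_unit n) ?L)"
      by (rule mat_units_Span[OF Y]) simp
    moreover have "B.Span (scalar_mats n) (map (mat_unit n) ?L) \<subseteq> E_span"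
    proof (rule B.Span_subset)
      fix k u v :: "'k poly fract mat" assume "k \<in> scalar_mats n" "u \<in> set (map (mat_unit n) ?L)" "v \<in> E_span"
      then obtain c i j where "k = c \<cdot>\<^sub>m 1\<^sub>m n" "u = mat_unit n (i, j)" "i < n" "j < n" by auto
      then show "k \<otimes>\<^bsub>B\<^esub> u \<oplus>\<^bsub>B\<^esub> v \<in> E_span"
        using \<open>v \<in> E_span\<close> E_span_closed(3,4) mat_unit_in_E_span
        by (simp add: ring_mat_simps smult_one_mult del: mult_smult_assoc_mat)
    qed (use E_span_closed(2) in \<open>simp add: ring_mat_simps\<close>)
    ultimately show "Y \<in> E_span" by blast
  qed
qed

text \<open>The n^2 images span a space of dimension n^2 and are therefore independent. Their
  independence lifts back to the list in the algebra, which makes it a basis.\<close>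

lemma is_splitting: "is_splitting A k n splitting_embedding splitting_map"
proof -
  interpret A: ring A by (rule ring_A)
  interpret B: ring B by (rule ring_mat)
  have len: "length (map splitting_map A_basis) = n * n"
    by (simp add: A_basis_def A_index_def length_product)
  have span: "B.Span (scalar_mats n) (map splitting_map A_basis) = carrier_mat n n"
    using E_span_eq unfolding E_span_def .
  have "B.independent (scalar_mats n) (map splitting_map A_basis)"
  proof (rule B.length_eq_dimension_imp_independent[OF subfield_scalar_mats[OF n_pos]])
    show "set (map splitting_map A_basis) \<subseteq> carrier B"
      using splitting_images_carrier by (simp only: ring_mat_simps)
    show "B.dimension (length (map splitting_map A_basis)) (scalar_mats n)
        (B.Span (scalar_mats n) (map splitting_map A_basis))"
      unfolding len span by (rule dimension_mat[OF n_pos])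
  qed
  moreover from this have "A.independent k A_basis"
  proof (rule independent_map_imp_independent[OF ring_A ring_mat A_basis_carrier k_carrier splitting_map_hom, rotated])
    show "splitting_map ` k \<subseteq> scalar_mats n"
      using splitting_map_k by blast
  qed
  ultimately have "is_basis A k A_basis" "is_basis B (scalar_mats n) (map splitting_map A_basis)"
    unfolding is_basis_def ring_mat_simps
    using A_basis_carrier Span_A_basis splitting_images_carrier span by blast+
  then show ?thesis
    unfolding is_splitting_def
    using splitting_embedding_hom splitting_map_hom splitting_map_k by blast
qed

end

section \<open>Independence of the splitting\<close>

lemma CHAR_fract: "CHAR('a::idom fract) = CHAR('a)"
proof (rule CHAR_eqI)
  show "of_nat CHAR('a) = (0 :: 'a fract)"
    using to_frac.hom_of_nat[of "CHAR('a)", where 'a = 'a] by simp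
  fix m assume "of_nat m = (0 :: 'a fract)"
  then have "to_frac (of_nat m :: 'a) = 0"
    by (simp add: to_frac.hom_of_nat)
  then show "CHAR('a) dvd m"
    by (simp add: of_nat_eq_0_iff_char_dvd)
qed

text \<open>Let S be right multiplication by B minus \<beta>. In characteristic p its p-th power is
  right multiplication by B^p minus \<beta>^p, which is 0. The last nonzero iterate of S on V
  satisfies the new eigenvalue equation, and S preserves the equations for every C that commutes
  with B. Left eigenvectors are carried as rows of a nonzero matrix.\<close>

lemma commuting_nilpotent:
  fixes V B :: "'e::field mat"
  assumes p: "prime p" "CHAR('e) = p"
    and V: "V \<in> carrier_mat n n" "V \<noteq> 0\<^sub>m n n" and B: "B \<in> carrier_mat n n"
    and pow: "B ^\<^sub>m p = \<beta> ^ p \<cdot>\<^sub>m 1\<^sub>m n"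
  shows "\<exists>W \<in> carrier_mat n n. W \<noteq> 0\<^sub>m n n \<and> W * B = \<beta> \<cdot>\<^sub>m W \<and>
    (\<forall>C \<in> carrier_mat n n. \<forall>\<gamma>. B * C = C * B \<longrightarrow> V * C = \<gamma> \<cdot>\<^sub>m V \<longrightarrow> W * C = \<gamma> \<cdot>\<^sub>m W)"
proof -
  define S where "S X = X * B - \<beta> \<cdot>\<^sub>m X" for X
  define U where "U i = V * B ^\<^sub>m i" for i
  have S: "S X \<in> carrier_mat n n" if "X \<in> carrier_mat n n" for X
    unfolding S_def using that B by (intro minus_carrier_mat smult_carrier_mat)
  have S_iter: "(S ^^ m) V \<in> carrier_mat n n" for m
    by (induction m) (simp_all add: V S)
  have U: "U i \<in> carrier_mat n n" for i
    using V B by (simp add: U_def)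
  have U_Suc: "U i * B = U (Suc i)" for i
    using V B by (simp add: U_def assoc_mult_mat[of _ n n _ n _ n])
  \<comment> \<open>The coefficients of (X - \<beta>)^m express the m-th iterate of S through the
    matrices V B^i.\<close>
  let ?q = "\<lambda>m. [:- \<beta>, 1:] ^ m"
  have coeff_q: "coeff (?q (Suc m)) i = (case i of 0 \<Rightarrow> 0 | Suc i \<Rightarrow> coeff (?q m) i) - \<beta> * coeff (?q m) i" for m i
    by (simp add: coeff_pCons split: nat.splits)
  have deg_q: "degree (?q m) \<le> m" for m
    using degree_power_le[of "[:- \<beta>, 1:]" m] by simp
  have expansion: "(S ^^ m) V $$ (r, c) = (\<Sum>i\<le>m. coeff (?q m) i * U i $$ (r, c))"
    if "r < n" "c < n" for m r c
    using that
  proof (induction m arbitrary: r c)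
    case 0
    then show ?case using V B by (simp add: U_def)
  next
    case (Suc m)
    have "((S ^^ m) V * B) $$ (r, c) = (\<Sum>k<n. (\<Sum>i\<le>m. coeff (?q m) i * U i $$ (r, k)) * B $$ (k, c))"
      using Suc by (simp add: mult_mat_index[OF S_iter B] del: index_mult_mat)
    also have "\<dots> = (\<Sum>i\<le>m. coeff (?q m) i * (\<Sum>k<n. U i $$ (r, k) * B $$ (k, c)))"
      by (simp add: sum_distrib_left sum_distrib_right mult.assoc) (rule sum.swap)
    also have "\<dots> = (\<Sum>i\<le>m. coeff (?q m) i * U (Suc i) $$ (r, c))"
      using Suc.prems by (simp add: mult_mat_index[OF U B, symmetric] U_Suc)
    also have "\<dots> = (\<Sum>i\<le>Suc m. (case i of 0 \<Rightarrow> 0 | Suc i \<Rightarrow> coeff (?q m) i) * U i $$ (r, c))"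
      unfolding sum.atMost_Suc_shift by simp
    finally have "(S ^^ Suc m) V $$ (r, c)
        = (\<Sum>i\<le>Suc m. (case i of 0 \<Rightarrow> 0 | Suc i \<Rightarrow> coeff (?q m) i) * U i $$ (r, c)) - \<beta> * (S ^^ m) V $$ (r, c)"
      using Suc.prems S_iter[of m] B by (simp add: S_def del: index_mult_mat(1))
    also have "(S ^^ m) V $$ (r, c) = (\<Sum>i\<le>Suc m. coeff (?q m) i * U i $$ (r, c))"
      using Suc deg_q[of m] by (simp add: coeff_eq_0)
    finally show ?case
      unfolding coeff_q by (simp only: sum_distrib_left sum_subtractf left_diff_distrib mult.assoc)
  qed
  have q_p: "?q p = monom 1 p - [:\<beta> ^ p:]"
  proof -
    have "[:- \<beta>, 1:] + [:\<beta>:] = monom 1 1"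
      by (simp add: monom_Suc monom_0)
    moreover have "([:- \<beta>, 1:] + [:\<beta>:]) ^ p = [:- \<beta>, 1:] ^ p + [:\<beta>:] ^ p"
      by (rule freshmans_dream) (simp_all add: p)
    moreover have "monom 1 1 ^ p = (monom 1 p :: 'e poly)"
      by (simp only: monom_power power_one mult_1)
    ultimately show ?thesis
      by (simp only: poly_const_pow eq_diff_eq)
  qed
  have "p > 0" using p(1) by (rule prime_gt_0_nat)
  have S_p: "(S ^^ p) V = 0\<^sub>m n n"
  proof (rule eq_matI)
    fix r c assume "r < dim_row (0\<^sub>m n n :: 'e mat)" "c < dim_col (0\<^sub>m n n :: 'e mat)"
    then have rc: "r < n" "c < n" by simp_all
    have "U p = \<beta> ^ p \<cdot>\<^sub>m V"
      using V by (simp add: U_def pow mult_smult_distrib[of _ n n _ n])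
    then have "U p $$ (r, c) = \<beta> ^ p * U 0 $$ (r, c)"
      using rc V B by (simp add: U_def)
    moreover have "(\<Sum>i\<le>p. coeff (?q p) i * U i $$ (r, c)) = (\<Sum>i\<in>{0, p}. coeff (?q p) i * U i $$ (r, c))"
      by (rule sum.mono_neutral_right) (auto simp: q_p coeff_pCons split: nat.splits)
    ultimately have "(\<Sum>i\<le>p. coeff (?q p) i * U i $$ (r, c)) = 0"
      using \<open>p > 0\<close> by (simp add: q_p coeff_pCons split: nat.splits)
    then show "(S ^^ p) V $$ (r, c) = 0\<^sub>m n n $$ (r, c)"
      using rc by (simp add: expansion)
  qed (use S_iter[of p] in auto)
  \<comment> \<open>The iterate just before the first vanishing one is the W sought; m is positive
    because V is nonzero.\<close>
  define m where "m = (LEAST m. (S ^^ m) V = 0\<^sub>m n n)"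
  have m: "(S ^^ m) V = 0\<^sub>m n n"
    unfolding m_def by (rule LeastI[of _ p]) (rule S_p)
  then obtain l where l: "m = Suc l"
    using V(2) by (cases m) auto
  have comm: "(S ^^ i) V * C = \<gamma> \<cdot>\<^sub>m (S ^^ i) V"
    if "C \<in> carrier_mat n n" "B * C = C * B" "V * C = \<gamma> \<cdot>\<^sub>m V" for C \<gamma> i
  proof (induction i)
    case (Suc i)
    let ?X = "(S ^^ i) V"
    note X = S_iter[of i]
    have "S ?X * C = ?X * B * C - \<beta> \<cdot>\<^sub>m ?X * C"
      unfolding S_def[of ?X] by (rule minus_mult_distrib_mat[of _ n n]) (use X B that in auto)
    also have "?X * B * C = ?X * C * B"
      using X B that by (simp add: assoc_mult_mat[of _ n n _ n _ n])
    also have "\<dots> = \<gamma> \<cdot>\<^sub>m (?X * B)"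
      using X B by (simp add: Suc mult_smult_assoc_mat[of _ n n])
    also have "\<beta> \<cdot>\<^sub>m ?X * C = \<gamma> \<cdot>\<^sub>m (\<beta> \<cdot>\<^sub>m ?X)"
      using X that by (subst mult_smult_assoc_mat[of _ n n _ n]) (auto simp: Suc intro!: eq_matI)
    also have "\<gamma> \<cdot>\<^sub>m (?X * B) - \<gamma> \<cdot>\<^sub>m (\<beta> \<cdot>\<^sub>m ?X) = \<gamma> \<cdot>\<^sub>m S ?X"
      using X B unfolding S_def[of ?X]
      by (intro eq_matI) (auto simp: right_diff_distrib simp del: index_mult_mat(1))
    finally show ?case by simp
  qed (use that in simp)
  have "(S ^^ l) V \<noteq> 0\<^sub>m n n"
    using not_less_Least[of l "\<lambda>m. (S ^^ m) V = 0\<^sub>m n n"] by (simp add: l flip: m_def)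
  moreover have "(S ^^ l) V * B = \<beta> \<cdot>\<^sub>m (S ^^ l) V"
  proof (rule eq_matI)
    let ?X = "(S ^^ l) V"
    fix r c assume "r < dim_row (\<beta> \<cdot>\<^sub>m ?X)" "c < dim_col (\<beta> \<cdot>\<^sub>m ?X)"
    then have rc: "r < n" "c < n" using S_iter[of l] by auto
    have "S ?X $$ (r, c) = 0"
      using m l rc by simp
    then show "(?X * B) $$ (r, c) = (\<beta> \<cdot>\<^sub>m ?X) $$ (r, c)"
      using rc S_iter[of l] B unfolding S_def[of ?X] by (simp del: index_mult_mat(1))
  qed (use S_iter[of l] B in auto)
  moreover have "\<forall>C \<in> carrier_mat n n. \<forall>\<gamma>. B * C = C * B \<longrightarrow> V * C = \<gamma> \<cdot>\<^sub>m V \<longrightarrow>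
      (S ^^ l) V * C = \<gamma> \<cdot>\<^sub>m (S ^^ l) V"
    by (intro ballI allI impI) (rule comm)
  ultimately show ?thesis
    by (intro bexI[of _ "(S ^^ l) V"] conjI S_iter)
qed

lemma nonzero_mat_entry:
  fixes V :: "'e::zero mat"
  assumes "V \<in> carrier_mat n n" "V \<noteq> 0\<^sub>m n n"
  obtains r s where "r < n" "s < n" "V $$ (r, s) \<noteq> 0"
proof -
  have "\<exists>r<n. \<exists>s<n. V $$ (r, s) \<noteq> 0"
  proof (rule ccontr)
    assume "\<not> ?thesis"
    then have "V = 0\<^sub>m n n" using assms(1) by (intro eq_matI) auto
    then show False using assms(2) by simp
  qed
  then show thesis using that by blast
qed

section \<open>Comparison of an arbitrary splitting with right multiplication\<close>

context differential_extension
begin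

context
  fixes \<iota> :: "('k poly \<times> 'k poly) set \<Rightarrow> 'k poly fract" and \<phi>
  assumes split: "is_splitting A k n \<iota> \<phi>"
begin

lemma iota_hom: "\<iota> \<in> Ring.ring_hom (A\<lparr>carrier := k\<rparr>) (class_ring :: 'k poly fract ring)"
  and phi_hom: "\<phi> \<in> Ring.ring_hom A B"
  and phi_k: "X \<in> k \<Longrightarrow> \<phi> X = \<iota> X \<cdot>\<^sub>m 1\<^sub>m n"
  using split by (auto simp: is_splitting_def)

text \<open>The restriction of \<iota> to F[x]. It is meaningful only on
  \<open>polys_over F\<close>, since \<iota> is constrained only on F(x).\<close>

definition iota_P :: "'k poly \<Rightarrow> 'k poly fract" where "iota_P a = \<iota> (emb (P a))"

lemma iota_mult: "X \<in> k \<Longrightarrow> Y \<in> k \<Longrightarrow> \<iota> (X \<otimes>\<^bsub>A\<^esub> Y) = \<iota> X * \<iota> Y"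
  and iota_add: "X \<in> k \<Longrightarrow> Y \<in> k \<Longrightarrow> \<iota> (X \<oplus>\<^bsub>A\<^esub> Y) = \<iota> X + \<iota> Y"
  and iota_one: "\<iota> \<one>\<^bsub>A\<^esub> = 1"
  using ring_hom_mult[OF iota_hom, of X Y] ring_hom_add[OF iota_hom, of X Y] ring_hom_one[OF iota_hom]
  by simp_all

lemma phi_carrier: "\<phi> (emb f) \<in> carrier_mat n n"
  using ring_hom_closed[OF phi_hom, of "emb f"] by (simp add: ring_mat_simps)

lemma phi_mult: "\<phi> (emb (f \<star> q)) = \<phi> (emb f) * \<phi> (emb q)"
  and phi_add: "\<phi> (emb (f + q)) = \<phi> (emb f) + \<phi> (emb q)"
  using ring_hom_mult[OF phi_hom, of "emb f" "emb q"] ring_hom_add[OF phi_hom, of "emb f" "emb q"]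
  by (simp_all add: emb_mult emb_add ring_mat_simps)

lemma iota_P_mult: "a \<in> polys_over F \<Longrightarrow> b \<in> polys_over F \<Longrightarrow> iota_P (a * b) = iota_P a * iota_P b"
  and iota_P_add: "a \<in> polys_over F \<Longrightarrow> b \<in> polys_over F \<Longrightarrow> iota_P (a + b) = iota_P a + iota_P b"
  and iota_P_one: "iota_P 1 = 1"
  using iota_mult[OF emb_P_in_k emb_P_in_k, of a b] iota_add[OF emb_P_in_k emb_P_in_k, of a b] iota_one
  by (simp_all add: iota_P_def P_mult P_add emb_mult emb_add emb_1)

lemma iota_P_zero: "iota_P 0 = 0"
  using iota_P_add[of 0 0] by (metis add_0 add_cancel_left_right polys_over_0)

lemma iota_P_power: "a \<in> polys_over F \<Longrightarrow> a ^ i \<in> polys_over F \<and> iota_P (a ^ i) = iota_P a ^ i"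
  by (induction i) (simp_all add: iota_P_one iota_P_mult polys_over_mult)

lemma cfrac_P_in_k: "a \<in> polys_over F \<Longrightarrow> b \<in> denoms \<Longrightarrow> cfrac (P a) b \<in> k"
  unfolding k_eq by blast

lemma iota_P_nonzero:
  assumes "a \<in> denoms"
  shows "iota_P a \<noteq> 0"
proof -
  have "emb (P a) \<otimes>\<^bsub>A\<^esub> cfrac (P 1) a = \<one>\<^bsub>A\<^esub>"
    using assms by (simp add: emb_eq_cfrac A_mult A_one cfrac_eq_iff)
  then have "iota_P a * \<iota> (cfrac (P 1) a) = 1"
    using iota_mult[OF emb_P_in_k[OF denoms_over[OF assms]] cfrac_P_in_k[OF polys_over_1 assms]] iota_one
    by (simp add: iota_P_def)
  then show ?thesis by auto
qed

lemma iota_P_inj: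
  assumes a: "a \<in> polys_over F" and b: "b \<in> polys_over F" and eq: "iota_P a = iota_P b"
  shows "a = b"
proof -
  have "map_poly \<delta> (a - b) + map_poly \<delta> b = map_poly \<delta> a"
    using map_poly_deriv_add[of "a - b" b] by simp
  then have c: "a - b \<in> polys_over F"
    using a b by (simp add: polys_over_iff_deriv)
  have "iota_P (a - b) + iota_P b = iota_P a"
    using iota_P_add[OF c b] by simp
  then have "a - b \<notin> denoms"
    using iota_P_nonzero[of "a - b"] eq by auto
  then show ?thesis
    using c by (simp add: denoms_def)
qed

text \<open>Embeddings of fields are injective; this makes the element of F(x) described by the
  reduced norm unique.\<close>

lemma iota_inj:
  assumes "X \<in> k" "Y \<in> k" "\<iota> X = \<iota> Y"
  shows "X = Y"
proof -
  obtain a b where X: "X = cfrac (P a) b" and ab: "a \<in> polys_over F" "b \<in> denoms"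
    using assms(1) unfolding k_eq by blast
  obtain c d where Y: "Y = cfrac (P c) d" and cd: "c \<in> polys_over F" "d \<in> denoms"
    using assms(2) unfolding k_eq by blast
  have eq: "\<iota> (cfrac (P u) v) * iota_P v = iota_P u" if "u \<in> polys_over F" "v \<in> denoms" for u v
  proof -
    have "P u \<star> P v = P v \<star> P u"
      by (simp only: P_mult[symmetric] mult.commute)
    then have "cfrac (P u) v \<otimes>\<^bsub>A\<^esub> emb (P v) = emb (P u)"
      using that by (simp add: emb_eq_cfrac A_mult cfrac_eq_iff)
    then show ?thesis
      using iota_mult[OF cfrac_P_in_k[OF that] emb_P_in_k[OF denoms_over[OF that(2)]]] by (simp add: iota_P_def)
  qed
  have X': "iota_P a = \<iota> X * iota_P b" and Y': "iota_P c = \<iota> X * iota_P d"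
    using eq[OF ab] eq[OF cd] assms(3) by (simp_all add: X Y)
  have "iota_P (a * d) = iota_P (c * b)"
    using ab cd by (simp add: iota_P_mult denoms_over X' Y')
  then have "a * d = c * b"
    by (rule iota_P_inj[rotated 2]) (use ab cd in \<open>simp_all add: polys_over_mult denoms_over\<close>)
  then have "d * a = b * c" by (simp only: mult.commute)
  then have "P d \<star> P a = P b \<star> P c" by (simp only: P_mult[symmetric])
  then show ?thesis
    using ab cd by (simp add: X Y cfrac_eq_iff)
qed

text \<open>An arbitrary \<open>\<iota>\<close> need not extend from \<open>F(x)\<close> to \<open>K(x)\<close> inside the given field, but its composition
  with the Frobenius map does, since \<open>p\<close>-th powers of \<open>K[x]\<close> lie in \<open>F[x]\<close>.\<close>

definition frob_iota :: "'k poly \<Rightarrow> 'k poly fract" where "frob_iota h = iota_P (h ^ p)"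

lemma char_E: "CHAR('k poly fract) = p"
  by (simp add: CHAR_fract char_p)

interpretation frob: comm_ring_hom "\<lambda>z :: 'k poly fract. z ^ p"
  using prime_p
  by unfold_locales (simp_all add: freshmans_dream[of p] char_E power_mult_distrib prime_gt_0_nat)

interpretation frob_iota: comm_ring_hom frob_iota
proof
  fix h h' :: "'k poly"
  have "(h + h') ^ p = h ^ p + h' ^ p"
    by (rule freshmans_dream) (simp_all add: char_p prime_p)
  then show "frob_iota (h + h') = frob_iota h + frob_iota h'"
    by (simp add: frob_iota_def iota_P_add polys_over_power)
  show "frob_iota (h * h') = frob_iota h * frob_iota h'"
    by (simp add: frob_iota_def power_mult_distrib iota_P_mult polys_over_power)
qed (simp_all add: frob_iota_def iota_P_one iota_P_zero zero_power[OF prime_gt_0_nat[OF prime_p]])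

lemma frob_iota_over: "a \<in> polys_over F \<Longrightarrow> frob_iota a = iota_P a ^ p"
  by (simp add: frob_iota_def iota_P_power)

text \<open>Frobenius on the entries changes the scalars by which F[x] acts from \<iota> to
  \<open>frob_iota\<close>, which makes sense on all of K[x].\<close>

definition frob_phi :: "'k poly \<Rightarrow> 'k poly fract mat" where
  "frob_phi f = map_mat (\<lambda>z. z ^ p) (\<phi> (emb f))"

lemma frob_phi_carrier [simp]: "frob_phi f \<in> carrier_mat n n"
  using phi_carrier[of f] by (simp add: frob_phi_def)

lemma frob_phi_mult: "frob_phi (f \<star> q) = frob_phi f * frob_phi q"
  unfolding frob_phi_def phi_mult by (rule frob.mat_hom_mult[OF phi_carrier phi_carrier])

lemma frob_phi_add: "frob_phi (f + q) = frob_phi f + frob_phi q"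
  unfolding frob_phi_def phi_add using phi_carrier[of f] phi_carrier[of q]
  by (intro eq_matI) (auto simp: frob.hom_add)

lemma frob_phi_over: "a \<in> polys_over F \<Longrightarrow> frob_phi (P a) = frob_iota a \<cdot>\<^sub>m 1\<^sub>m n"
  unfolding frob_phi_def phi_k[OF emb_P_in_k] iota_P_def[symmetric]
  using prime_p by (intro eq_matI) (auto simp: frob_iota_over prime_gt_0_nat)

lemma frob_phi_one: "frob_phi 1 = 1\<^sub>m n"
  using frob_phi_over[of 1] by (auto intro!: eq_matI)

lemma frob_phi_zero: "frob_phi 0 = 0\<^sub>m n n"
  using frob_phi_over[of 0] by (auto intro!: eq_matI)

lemma frob_phi_pow: "frob_phi (f \<up> i) = frob_phi f ^\<^sub>m i"
  using carrier_matD[OF frob_phi_carrier[of f]] by (induction i) (simp_all add: frob_phi_one frob_phi_mult dpow_Suc)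

text \<open>h^p has coefficients in F and acts as a scalar. This is the hypothesis of
  \<open>commuting_nilpotent\<close>, with an eigenvalue that lies in the given field.\<close>

lemma frob_phi_P_pow: "frob_phi (P h) ^\<^sub>m p = frob_iota h ^ p \<cdot>\<^sub>m 1\<^sub>m n"
proof -
  have "frob_phi (P h) ^\<^sub>m p = frob_phi (P (h ^ p))"
    by (simp only: frob_phi_pow P_power)
  also have "\<dots> = frob_iota (h ^ p) \<cdot>\<^sub>m 1\<^sub>m n"
    by (rule frob_phi_over[OF polys_over_power])
  finally show ?thesis by (simp add: frob_iota.hom_power)
qed

lemma frob_phi_P_comm: "frob_phi (P h) * frob_phi (P h') = frob_phi (P h') * frob_phi (P h)"
  unfolding frob_phi_mult[symmetric] P_mult[symmetric] by (simp only: mult.commute)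

definition eigen :: "'k poly fract mat \<Rightarrow> 'k poly \<Rightarrow> bool" where
  "eigen V h \<longleftrightarrow> V * frob_phi (P h) = frob_iota h \<cdot>\<^sub>m V"

lemma eigen_add: "V \<in> carrier_mat n n \<Longrightarrow> eigen V h \<Longrightarrow> eigen V h' \<Longrightarrow> eigen V (h + h')"
  unfolding eigen_def P_add frob_phi_add
  by (subst mult_add_distrib_mat[of _ n n _ n]) (auto simp: frob_iota.hom_add add_smult_distrib_right_mat[of _ n n])

lemma eigen_mult:
  assumes V: "V \<in> carrier_mat n n" and h: "eigen V h" "eigen V h'"
  shows "eigen V (h * h')"
proof -
  have "V * frob_phi (P (h * h')) = V * frob_phi (P h) * frob_phi (P h')"
    unfolding P_mult frob_phi_mult using V by (simp add: assoc_mult_mat[of _ n n _ n _ n])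
  also have "\<dots> = frob_iota h \<cdot>\<^sub>m (V * frob_phi (P h'))"
    using h(1) V by (simp add: eigen_def mult_smult_assoc_mat[of _ n n _ n])
  also have "\<dots> = frob_iota (h * h') \<cdot>\<^sub>m V"
    using h(2) V by (intro eq_matI) (simp_all add: eigen_def frob_iota.hom_mult)
  finally show ?thesis by (simp add: eigen_def)
qed

lemma eigen_over: "V \<in> carrier_mat n n \<Longrightarrow> a \<in> polys_over F \<Longrightarrow> eigen V a"
  unfolding eigen_def by (simp add: frob_phi_over mult_smult_distrib[of _ n n _ n])

text \<open>The elements of \<open>bs\<close> are treated one at a time, starting from the identity
  matrix. Their images commute, so the eigenvalue equations already reached survive each
  step.\<close>

lemma ex_eigen_basis:
  "m \<le> n \<Longrightarrow> \<exists>V \<in> carrier_mat n n. V \<noteq> 0\<^sub>m n n \<and> (\<forall>s<m. eigen V [:bs ! s:])"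
proof (induction m)
  case 0
  have "1\<^sub>m n \<noteq> (0\<^sub>m n n :: 'k poly fract mat)"
  proof
    assume "1\<^sub>m n = (0\<^sub>m n n :: 'k poly fract mat)"
    then have "(1\<^sub>m n :: 'k poly fract mat) $$ (0, 0) = 0\<^sub>m n n $$ (0, 0)" by simp
    then show False using n_pos by simp
  qed
  then show ?case by (intro bexI[of _ "1\<^sub>m n"]) auto
next
  case (Suc m)
  then obtain V where V: "V \<in> carrier_mat n n" "V \<noteq> 0\<^sub>m n n" "\<forall>s<m. eigen V [:bs ! s:]"
    by auto
  let ?b = "[:bs ! m:]"
  obtain W where W: "W \<in> carrier_mat n n" "W \<noteq> 0\<^sub>m n n" "W * frob_phi (P ?b) = frob_iota ?b \<cdot>\<^sub>m W"
    and keep: "\<forall>C \<in> carrier_mat n n. \<forall>\<gamma>. frob_phi (P ?b) * C = C * frob_phi (P ?b) \<longrightarrow> V * C = \<gamma> \<cdot>\<^sub>m V \<longrightarrow> W * C = \<gamma> \<cdot>\<^sub>m W"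
    using commuting_nilpotent[OF prime_p char_E V(1,2) frob_phi_carrier frob_phi_P_pow[of ?b]]
    by (elim bexE conjE) (rule that)
  have "eigen W [:bs ! s:]" if "s < Suc m" for s
  proof (cases "s = m")
    case True
    then show ?thesis using W(3) unfolding eigen_def by simp
  next
    case False
    then have "V * frob_phi (P [:bs ! s:]) = frob_iota [:bs ! s:] \<cdot>\<^sub>m V"
      using V(3) that unfolding eigen_def by simp
    then show ?thesis
      unfolding eigen_def by (rule keep[rule_format, OF frob_phi_carrier frob_phi_P_comm])
  qed
  then show ?case using W(1,2) by (intro bexI[of _ W]) simp_all
qed

text \<open>The polynomials satisfying the eigenvalue equation contain F[x] and are closed under
  sums and products. With \<open>bs\<close> among them they are all of K[x].\<close>

lemma ex_eigen: "\<exists>V \<in> carrier_mat n n. V \<noteq> 0\<^sub>m n n \<and> (\<forall>h. eigen V h)"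
proof -
  obtain V where V: "V \<in> carrier_mat n n" "V \<noteq> 0\<^sub>m n n" "\<forall>s<n. eigen V [:bs ! s:]"
    using ex_eigen_basis[of n] by auto
  have "eigen V h" for h
  proof -
    obtain a where a: "\<forall>s<n. a s \<in> polys_over F" "h = (\<Sum>s<n. Polynomial.smult (bs ! s) (a s))"
      using ex_span_polys[of h] by auto
    have "eigen V (\<Sum>s<m. Polynomial.smult (bs ! s) (a s))" if "m \<le> n" for m
      using that
    proof (induction m)
      case 0
      then show ?case using eigen_over[OF V(1)] by simp
    next
      case (Suc m)
      have "eigen V [:bs ! m:]" "eigen V (a m)"
        using Suc.prems V(3) a(1) eigen_over[OF V(1)] by auto
      then have "eigen V ([:bs ! m:] * a m)"
        by (rule eigen_mult[OF V(1)])
      then show ?case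
        using Suc V(1) by (simp add: eigen_add)
    qed
    then show ?thesis using a(2) by simp
  qed
  then show ?thesis using V(1,2) by (intro bexI[of _ V] conjI allI)
qed

text \<open>Multiplication by the common eigenvectors turns coordinates in K[x] into scalars, which
  is what allows the comparison with M. The number of summands is free for the induction.\<close>

lemma eigen_expand:
  assumes V: "V \<in> carrier_mat n n" "\<forall>h. eigen V h" and rc: "r < n" "c < n"
  shows "(V * frob_phi (\<Sum>j<m. P (h j) * monom 1 j)) $$ (r, c) = (\<Sum>j<m. frob_iota (h j) * (V * frob_phi (monom 1 j)) $$ (r, c))"
proof (induction m)
  case 0
  have "V * frob_phi 0 = 0\<^sub>m n n"
    using V(1) by (simp add: frob_phi_zero)
  then show ?case using rc by simp
next
  case (Suc m)
  have "V * frob_phi (P (h m) * monom 1 m) = V * frob_phi (P (h m)) * frob_phi (monom 1 m)"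
    using V(1) by (simp add: frob_phi_mult assoc_mult_mat[of _ n n _ n _ n] flip: dmult_monom_right)
  also have "\<dots> = frob_iota (h m) \<cdot>\<^sub>m (V * frob_phi (monom 1 m))"
    using V by (simp add: eigen_def mult_smult_assoc_mat[of _ n n _ n])
  finally have step: "V * frob_phi (P (h m) * monom 1 m) = frob_iota (h m) \<cdot>\<^sub>m (V * frob_phi (monom 1 m))" .
  have "V * frob_phi (\<Sum>j<Suc m. P (h j) * monom 1 j)
      = V * frob_phi (\<Sum>j<m. P (h j) * monom 1 j) + frob_iota (h m) \<cdot>\<^sub>m (V * frob_phi (monom 1 m))"
    using V(1) step by (simp add: frob_phi_add mult_add_distrib_mat[of _ n n _ n])
  then show ?case
    using rc V(1) carrier_matD[OF frob_phi_carrier] Suc by (simp del: index_mult_mat(1))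
qed

text \<open>The splitting provides a spanning image for \<phi>, before Frobenius is applied. A
  functional on p-th powers of entries is therefore treated as a semilinear functional on the
  entries themselves, whence the factor c^p. A central denominator changes its value only by a
  nonzero factor.\<close>

lemma phi_span:
  assumes lin: "\<And>f. L (\<phi> (emb f)) = 0"
    and L_add: "\<And>X Y. X \<in> carrier_mat n n \<Longrightarrow> Y \<in> carrier_mat n n \<Longrightarrow> L (X + Y) = L X + (L Y :: 'k poly fract)"
    and L_smult: "\<And>c X. X \<in> carrier_mat n n \<Longrightarrow> L (c \<cdot>\<^sub>m X) = c ^ p * L X"
    and Y: "Y \<in> carrier_mat n n"
  shows "L Y = 0"
proof -
  interpret B: ring B by (rule ring_mat)
  obtain Us where Us: "is_basis A k Us" "is_basis B (scalar_mats n) (map \<phi> Us)"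
    using split unfolding is_splitting_def by (elim conjE exE) (rule that)
  have in_A: "L (\<phi> X) = 0 \<and> \<phi> X \<in> carrier_mat n n" if X_in: "X \<in> carrier A" for X
  proof -
    obtain f a where X: "a \<in> denoms" "X = cfrac f a" using X_in by (rule carrier_A_cases)
    have carr: "\<phi> X \<in> carrier_mat n n"
      using ring_hom_closed[OF phi_hom X_in] by (simp add: ring_mat_simps)
    have "emb (P a) \<otimes>\<^bsub>A\<^esub> X = emb f"
      using X by (simp add: emb_eq_cfrac A_mult cfrac_eq_iff)
    then have "\<phi> (emb f) = \<phi> (emb (P a)) * \<phi> X"
      using ring_hom_mult[OF phi_hom emb_carrier X_in, of "P a"] by (simp add: ring_mat_simps)
    also have "\<dots> = iota_P a \<cdot>\<^sub>m \<phi> X"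
      using phi_k[OF emb_P_in_k[OF denoms_over[OF X(1)]]] carr by (simp add: iota_P_def smult_one_mult)
    finally have "iota_P a ^ p * L (\<phi> X) = 0"
      using lin[of f] L_smult[OF carr] by simp
    then show ?thesis using iota_P_nonzero[OF X(1)] carr by simp
  qed
  let ?W = "{Z \<in> carrier_mat n n. L Z = 0}"
  have "B.Span (scalar_mats n) (map \<phi> Us) \<subseteq> ?W"
  proof (rule B.Span_subset)
    have "L (0 \<cdot>\<^sub>m 1\<^sub>m n) = 0"
      using prime_p by (simp add: L_smult prime_gt_0_nat)
    moreover have "0 \<cdot>\<^sub>m 1\<^sub>m n = (0\<^sub>m n n :: 'k poly fract mat)"
      by (intro eq_matI) auto
    ultimately show "\<zero>\<^bsub>B\<^esub> \<in> ?W" by (simp add: ring_mat_simps)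
    fix c u v :: "'k poly fract mat"
    assume "c \<in> scalar_mats n" "u \<in> set (map \<phi> Us)" "v \<in> ?W"
    moreover have "set Us \<subseteq> carrier A"
      using Us(1) by (simp add: is_basis_def)
    ultimately obtain d X where d: "c = d \<cdot>\<^sub>m 1\<^sub>m n" "u = \<phi> X" "X \<in> carrier A" and v: "v \<in> ?W"
      by auto
    then show "c \<otimes>\<^bsub>B\<^esub> u \<oplus>\<^bsub>B\<^esub> v \<in> ?W"
      using in_A[OF d(3)] by (simp add: ring_mat_simps smult_one_mult L_add L_smult del: mult_smult_assoc_mat)
  qed
  moreover have "B.Span (scalar_mats n) (map \<phi> Us) = carrier_mat n n"
    using Us(2) unfolding is_basis_def ring_mat_simps by (elim conjE)
  ultimately have "Y \<in> ?W"
    using Y by (simp only: subset_iff)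
  then show ?thesis by simp
qed

text \<open>A common left eigenvector \<open>v\<close> of the image of \<open>K[x]\<close> gives the rows \<open>v \<phi>(t\<^sup>i)\<close> of a matrix that
  intertwines \<open>frob_phi\<close> with \<open>M\<close>. Here \<open>v\<close> is a row of a matrix \<open>V\<close>.\<close>

lemma det_phi: "det (\<phi> (emb f)) = iota_P (det (M f))"
proof -
  obtain V where V: "V \<in> carrier_mat n n" "V \<noteq> 0\<^sub>m n n" "\<forall>h. eigen V h"
    using ex_eigen by auto
  obtain r s where rs: "r < n" "s < n" "V $$ (r, s) \<noteq> 0"
    by (rule nonzero_mat_entry[OF V(1,2)])
  define W where "W = mat n n (\<lambda>(i, c). (V * frob_phi (monom 1 i)) $$ (r, c))"
  have W: "W \<in> carrier_mat n n" by (simp add: W_def)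
  have mult_row: "(V * frob_phi q * frob_phi f) $$ (r, c) = (\<Sum>l<n. (V * frob_phi q) $$ (r, l) * frob_phi f $$ (l, c))"
    if "c < n" for c q f
    by (rule mult_mat_index) (use V(1) rs that in auto)
  have intertwine: "W * frob_phi f = map_mat frob_iota (M f) * W"
  proof (rule eq_matI)
    fix i c assume "i < dim_row (map_mat frob_iota (M f) * W)" "c < dim_col (map_mat frob_iota (M f) * W)"
    then have ic: "i < n" "c < n" by (simp_all add: W_def)
    have "(W * frob_phi f) $$ (i, c) = (\<Sum>l<n. W $$ (i, l) * frob_phi f $$ (l, c))"
      by (rule mult_mat_index[OF W frob_phi_carrier ic])
    also have "\<dots> = (V * frob_phi (monom 1 i) * frob_phi f) $$ (r, c)"
      unfolding mult_row[OF ic(2)] by (rule sum.cong) (use ic in \<open>auto simp: W_def\<close>)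
    also have "V * frob_phi (monom 1 i) * frob_phi f = V * frob_phi (monom 1 i \<star> f)"
      using V(1) by (simp add: frob_phi_mult assoc_mult_mat[of _ n n _ n _ n])
    also have "\<dots> = V * frob_phi (\<Sum>j<n. P (M f $$ (i, j)) * monom 1 j)"
      by (simp only: M_row[OF ic(1)])
    also have "\<dots> $$ (r, c) = (\<Sum>j<n. frob_iota (M f $$ (i, j)) * (V * frob_phi (monom 1 j)) $$ (r, c))"
      by (rule eigen_expand[OF V(1,3) rs(1) ic(2)])
    also have "\<dots> = (\<Sum>j<n. map_mat frob_iota (M f) $$ (i, j) * W $$ (j, c))"
      by (rule sum.cong) (use ic in \<open>auto simp: W_def\<close>)
    also have "\<dots> = (map_mat frob_iota (M f) * W) $$ (i, c)"
      by (rule mult_mat_index[symmetric]) (use W ic in auto)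
    finally show "(W * frob_phi f) $$ (i, c) = (map_mat frob_iota (M f) * W) $$ (i, c)" .
  qed (use W in \<open>auto simp: carrier_matD[OF frob_phi_carrier]\<close>)
  have "det W \<noteq> 0"
  proof
    assume "det W = 0"
    then obtain u where u: "u \<in> carrier_vec n" "u \<noteq> 0\<^sub>v n" "W *\<^sub>v u = 0\<^sub>v n"
      using det_0_iff_vec_prod_zero_field[OF W] by auto
    have W_u: "(\<Sum>c<n. (V * frob_phi (monom 1 j)) $$ (r, c) * u $ c) = 0" if "j < n" for j
    proof -
      have "(W *\<^sub>v u) $ j = (\<Sum>c<n. (V * frob_phi (monom 1 j)) $$ (r, c) * u $ c)"
        using that u(1) by (auto simp: W_def scalar_prod_def atLeast0LessThan intro!: sum.cong)
      then show ?thesis using that by (simp add: u(3))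
    qed
    \<comment> \<open>Applies Frobenius to the entries of Y and pairs the result with row r of V and
      the kernel vector u. It vanishes on the image of \<phi> and hence on all matrices, yet at a
      matrix unit its value is a product of nonzero entries of V and u.\<close>
    define L where "L Y = (\<Sum>c<n. \<Sum>l<n. V $$ (r, l) * (Y $$ (l, c)) ^ p * u $ c)" for Y :: "'k poly fract mat"
    have L_zero: "L Y = 0" if "Y \<in> carrier_mat n n" for Y
    proof (rule phi_span[OF _ _ _ that])
      fix f
      have "L (\<phi> (emb f)) = (\<Sum>c<n. (V * frob_phi f) $$ (r, c) * u $ c)"
        unfolding L_def
      proof (rule sum.cong[OF refl])
        fix c assume "c \<in> {..<n}"
        then have c: "c < n" by simp
        have "(V * frob_phi f) $$ (r, c) = (\<Sum>l<n. V $$ (r, l) * frob_phi f $$ (l, c))"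
          by (rule mult_mat_index[OF V(1) frob_phi_carrier rs(1) c])
        also have "\<dots> = (\<Sum>l<n. V $$ (r, l) * (\<phi> (emb f) $$ (l, c)) ^ p)"
          by (rule sum.cong) (use c carrier_matD[OF phi_carrier[of f]] in \<open>auto simp: frob_phi_def\<close>)
        finally show "(\<Sum>l<n. V $$ (r, l) * (\<phi> (emb f) $$ (l, c)) ^ p * u $ c) = (V * frob_phi f) $$ (r, c) * u $ c"
          by (simp add: sum_distrib_right)
      qed
      also have "\<dots> = (\<Sum>c<n. \<Sum>j<n. frob_iota (coord f j) * ((V * frob_phi (monom 1 j)) $$ (r, c) * u $ c))"
      proof (rule sum.cong[OF refl])
        fix c assume "c \<in> {..<n}"
        then have "(V * frob_phi f) $$ (r, c) = (\<Sum>j<n. frob_iota (coord f j) * (V * frob_phi (monom 1 j)) $$ (r, c))"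
          using eigen_expand[OF V(1,3) rs(1), of c "coord f" n] expand_coord[of f]
          by (simp add: expand_def del: index_mult_mat)
        then show "(V * frob_phi f) $$ (r, c) * u $ c
            = (\<Sum>j<n. frob_iota (coord f j) * ((V * frob_phi (monom 1 j)) $$ (r, c) * u $ c))"
          by (simp only: sum_distrib_right mult.assoc)
      qed
      also have "\<dots> = (\<Sum>j<n. frob_iota (coord f j) * (\<Sum>c<n. (V * frob_phi (monom 1 j)) $$ (r, c) * u $ c))"
        by (subst sum.swap) (simp add: sum_distrib_left)
      also have "\<dots> = 0"
        by (rule sum.neutral) (simp add: W_u del: index_mult_mat)
      finally show "L (\<phi> (emb f)) = 0" .
    next
      fix X Y :: "'k poly fract mat" assume "X \<in> carrier_mat n n" "Y \<in> carrier_mat n n"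
      then show "L (X + Y) = L X + L Y"
        by (simp add: L_def frob.hom_add distrib_left distrib_right sum.distrib)
    next
      fix d and X :: "'k poly fract mat" assume "X \<in> carrier_mat n n"
      then show "L (d \<cdot>\<^sub>m X) = d ^ p * L X"
        by (simp add: L_def power_mult_distrib sum_distrib_left mult.assoc mult.left_commute)
    qed
    obtain l where l: "l < n" "u $ l \<noteq> 0"
    proof -
      have "\<exists>l<n. u $ l \<noteq> 0"
      proof (rule ccontr)
        assume "\<not> ?thesis"
        then have "u = 0\<^sub>v n" using u(1) by (intro eq_vecI) auto
        then show False using u(2) by simp
      qed
      then show thesis using that by auto
    qed
    have "L (mat_unit n (s, l)) = V $$ (r, s) * u $ l"
    proof -
      have "L (mat_unit n (s, l)) = (\<Sum>c<n. \<Sum>i<n. if i = s then (if c = l then V $$ (r, s) * u $ l else 0) else 0)"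
        unfolding L_def using prime_p
        by (intro sum.cong refl) (auto simp: mat_unit_def prime_gt_0_nat)
      also have "\<dots> = V $$ (r, s) * u $ l"
        using rs l by simp
      finally show ?thesis .
    qed
    then show False
      using rs(3) l(2) L_zero[OF mat_unit_carrier, of "(s, l)"] by simp
  qed
  moreover have "det W * det (frob_phi f) = frob_iota (det (M f)) * det W"
  proof -
    have "det W * det (frob_phi f) = det (W * frob_phi f)"
      by (rule det_mult[OF W frob_phi_carrier, symmetric])
    also have "\<dots> = det (map_mat frob_iota (M f)) * det W"
      unfolding intertwine by (rule det_mult[OF map_M_carrier W])
    finally show ?thesis by (simp only: frob_iota.hom_det)
  qed
  ultimately have "det (frob_phi f) = frob_iota (det (M f))" by simp
  then have eq: "det (\<phi> (emb f)) ^ p = iota_P (det (M f)) ^ p"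
    unfolding frob_phi_def frob.hom_det frob_iota_over[OF det_M_over] .
  \<comment> \<open>Frobenius is additive, so equal p-th powers have a difference whose p-th power
    is 0.\<close>
  have "(det (\<phi> (emb f)) - iota_P (det (M f))) ^ p = det (\<phi> (emb f)) ^ p - iota_P (det (M f)) ^ p"
    by (rule frob.hom_minus)
  also have "\<dots> = 0"
    unfolding eq by (rule diff_self)
  finally have "det (\<phi> (emb f)) - iota_P (det (M f)) = 0"
    by (metis power_not_zero)
  then show ?thesis by (simp only: right_minus_eq)
qed

lemma iota_eq_det_imp:
  assumes "X \<in> k" "\<iota> X = det (\<phi> (emb f))"
  shows "X = emb (P (det (M f)))"
  using iota_inj[OF assms(1) emb_P_in_k[OF det_M_over]] assms(2) det_phi[of f] by (simp add: iota_P_def)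

end

text \<open>The constructed splitting shows that the value is attained; \<open>det_phi\<close> and
  injectivity of \<iota> show that no splitting yields another one.\<close>

lemma reduced_norm_eq:
  "reduced_norm TYPE('k poly fract) A k n (emb f) = emb (P (det (M f)))"
  unfolding reduced_norm_def
proof (rule the_equality)
  have "splitting_embedding (emb (P (det (M f)))) = det (splitting_map (emb f))"
    unfolding splitting_map_emb to_frac.hom_det
    using splitting_embedding_cfrac[OF det_M_over denoms_1] by (simp add: emb_eq_cfrac)
  then show "emb (P (det (M f))) \<in> k \<and> (\<exists>(\<iota> :: _ \<Rightarrow> 'k poly fract) \<phi>. is_splitting A k n \<iota> \<phi> \<and>
      \<iota> (emb (P (det (M f)))) = det (\<phi> (emb f)))"
    using is_splitting emb_P_in_k[OF det_M_over] by (intro conjI exI)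
next
  fix X assume "X \<in> k \<and> (\<exists>(\<iota> :: _ \<Rightarrow> 'k poly fract) \<phi>. is_splitting A k n \<iota> \<phi> \<and> \<iota> X = det (\<phi> (emb f)))"
  then show "X = emb (P (det (M f)))"
    by (elim conjE exE) (rule iota_eq_det_imp)
qed

end

section \<open>The minimum polynomial\<close>

context derivation
begin

lemma dmult_monom_left: "monom c i \<star> q = Polynomial.smult c ((T ^^ i) q)"
  by (subst dmult_eq_sum[OF degree_monom_le])
    (simp add: coeff_monom if_distrib[of "\<lambda>c. Polynomial.smult c _"] cong: if_cong)

lemma poly_at_map_eq_sum:
  assumes "degree h \<le> m"
  shows "poly_at_map h \<delta> a = (\<Sum>i\<le>m. coeff h i * (\<delta> ^^ i) a)"
  unfolding poly_at_map_def
  using assms by (intro sum.mono_neutral_left) (auto simp: coeff_eq_0)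

lemma poly_at_map_add: "poly_at_map (h + h') \<delta> a = poly_at_map h \<delta> a + poly_at_map h' \<delta> a"
  using degree_add_le_max[of h h']
  by (simp add: poly_at_map_eq_sum[of _ "max (degree h) (degree h')"] distrib_right sum.distrib)

lemma poly_at_map_sum: "poly_at_map (\<Sum>i\<in>I. h i) \<delta> a = (\<Sum>i\<in>I. poly_at_map (h i) \<delta> a)"
  by (induction I rule: infinite_finite_induct) (simp_all add: poly_at_map_add, simp_all add: poly_at_map_def)

lemma poly_at_map_monom: "poly_at_map (monom c i) \<delta> a = c * (\<delta> ^^ i) a"
  by (subst poly_at_map_eq_sum[OF degree_monom_le])
    (simp add: coeff_monom if_distrib[of "\<lambda>c. c * _"] cong: if_cong)

lemma poly_at_map_smult: "poly_at_map (Polynomial.smult c h) \<delta> a = c * poly_at_map h \<delta> a"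
  using degree_smult_le[of c h]
  by (simp add: poly_at_map_eq_sum[of _ "degree h"] sum_distrib_left mult.assoc)

lemma deriv_poly_at_map:
  "\<delta> (poly_at_map h \<delta> a) = poly_at_map (map_poly \<delta> h) \<delta> a + poly_at_map h \<delta> (\<delta> a)"
  using map_poly_degree_leq[of \<delta> h]
  by (simp add: poly_at_map_eq_sum[of _ "degree h"] deriv_sum deriv_mult coeff_map_poly sum.distrib funpow_swap1)

text \<open>Stated for an abstract pair of maps so that it also applies to the p^i-th iterates of
  \<open>T\<close> and \<delta>.\<close>

lemma leibniz:
  fixes S :: "'k poly \<Rightarrow> 'k poly" and \<Delta> :: "'k \<Rightarrow> 'k"
  assumes S_add: "\<And>f q. S (f + q) = S f + S q" and \<Delta>_add: "\<And>a b. \<Delta> (a + b) = \<Delta> a + \<Delta> b"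
    and S_smult: "\<And>b q. S (Polynomial.smult b q) = Polynomial.smult b (S q) + Polynomial.smult (\<Delta> b) q"
  shows "(S ^^ m) (Polynomial.smult b q)
    = (\<Sum>j\<le>m. Polynomial.smult (of_nat (m choose j) * (\<Delta> ^^ j) b) ((S ^^ (m - j)) q))"
proof (induction m)
  case (Suc m)
  have S0: "S 0 = 0" using S_add[of 0 0] by (metis add_cancel_left_right add_0)
  have \<Delta>0: "\<Delta> 0 = 0" using \<Delta>_add[of 0 0] by (metis add_cancel_left_right add_0)
  have S_sum: "S (\<Sum>j\<in>J. f j) = (\<Sum>j\<in>J. S (f j))" for J :: "nat set" and f
    by (induction J rule: infinite_finite_induct) (simp_all add: S_add S0)
  have \<Delta>_nat: "\<Delta> (of_nat c * a) = of_nat c * \<Delta> a" for c a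
    by (induction c) (simp_all add: \<Delta>_add \<Delta>0 distrib_right)
  have "(S ^^ Suc m) (Polynomial.smult b q)
      = (\<Sum>j\<le>m. Polynomial.smult (of_nat (m choose j) * (\<Delta> ^^ j) b) ((S ^^ (Suc m - j)) q))
      + (\<Sum>j\<le>m. Polynomial.smult (of_nat (m choose j) * (\<Delta> ^^ Suc j) b) ((S ^^ (m - j)) q))"
    by (simp add: Suc S_sum S_smult sum.distrib \<Delta>_nat Suc_diff_le)
  also have "(\<Sum>j\<le>m. Polynomial.smult (of_nat (m choose j) * (\<Delta> ^^ j) b) ((S ^^ (Suc m - j)) q))
      = (\<Sum>j\<le>Suc m. Polynomial.smult (of_nat (m choose j) * (\<Delta> ^^ j) b) ((S ^^ (Suc m - j)) q))"
    by (simp add: binomial_eq_0)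
  also have "\<dots> = Polynomial.smult b ((S ^^ Suc m) q)
      + (\<Sum>j\<le>m. Polynomial.smult (of_nat (m choose Suc j) * (\<Delta> ^^ Suc j) b) ((S ^^ (m - j)) q))"
    unfolding sum.atMost_Suc_shift by simp
  finally show ?case
    unfolding sum.atMost_Suc_shift
    by (simp add: distrib_right smult_add_left sum.distrib binomial_eq_0)
qed simp

text \<open>The inner binomial coefficients of p vanish in K, so the p-th iterate of a map with this
  product rule satisfies it again; induction reaches p^i.\<close>

lemma leibniz_prime_power:
  assumes p: "prime p" "CHAR('k) = p"
  shows "(T ^^ (p ^ i)) (Polynomial.smult b q)
    = Polynomial.smult b ((T ^^ (p ^ i)) q) + Polynomial.smult ((\<delta> ^^ (p ^ i)) b) q"
proof (induction i arbitrary: b q)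
  case 0
  then show ?case by (simp add: T_smult)
next
  case (Suc i)
  let ?S = "T ^^ (p ^ i)" and ?\<Delta> = "\<delta> ^^ (p ^ i)"
  have "p > 0" using p(1) by (rule prime_gt_0_nat)
  let ?term = "\<lambda>j. Polynomial.smult (of_nat (p choose j) * (?\<Delta> ^^ j) b) ((?S ^^ (p - j)) q)"
  have "(?S ^^ p) (Polynomial.smult b q) = (\<Sum>j\<le>p. ?term j)"
    by (rule leibniz) (simp_all add: T_iter_add deriv_iter_add Suc)
  also have "\<dots> = (\<Sum>j\<in>{0, p}. ?term j)"
  proof (rule sum.mono_neutral_right)
    show "\<forall>j\<in>{..p} - {0, p}. ?term j = 0"
    proof
      fix j assume "j \<in> {..p} - {0, p}"
      then have "p dvd (p choose j)"
        using p(1) by (intro dvd_choose_prime) auto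
      then have "of_nat (p choose j) = (0 :: 'k)"
        using of_nat_eq_0_iff_char_dvd[of "p choose j", where 'a = 'k] p(2) by simp
      then show "?term j = 0" by simp
    qed
  qed auto
  also have "\<dots> = Polynomial.smult b ((?S ^^ p) q) + Polynomial.smult ((?\<Delta> ^^ p) b) q"
    using \<open>p > 0\<close> by simp
  finally show ?case
    by (simp add: funpow_mult mult.commute)
qed

text \<open>K and t generate the ring. Past b in K, each t^(p^j) leaves only the error term
  delta^(p^j)(b), and these add up to g(delta)(b) = 0. Past t, only derivatives of the coefficients
  of g appear, and they are 0.\<close>

lemma min_poly_central:
  assumes p: "prime p" "CHAR('k) = p"
    and g: "g = monom 1 (p ^ e) + (\<Sum>i = 1..e. monom (c i) (p ^ (e - i)))"
    and c: "\<forall>i\<in>{1..e}. \<delta> (c i) = 0" and zero: "\<forall>a. poly_at_map g \<delta> a = 0"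
  shows "g \<star> q = q \<star> g"
proof -
  have left: "g \<star> r = (T ^^ (p ^ e)) r + (\<Sum>i = 1..e. Polynomial.smult (c i) ((T ^^ (p ^ (e - i))) r))" for r
    by (simp add: g dmult_add_left dmult_sum_left dmult_monom_left)
  have at_map: "poly_at_map g \<delta> b = (\<delta> ^^ (p ^ e)) b + (\<Sum>i = 1..e. c i * (\<delta> ^^ (p ^ (e - i))) b)" for b
    by (simp add: g poly_at_map_add poly_at_map_sum poly_at_map_monom)
  have smult: "g \<star> Polynomial.smult b r = Polynomial.smult b (g \<star> r)" for b r
  proof -
    have "g \<star> Polynomial.smult b r = Polynomial.smult b (g \<star> r) + Polynomial.smult (poly_at_map g \<delta> b) r"
      unfolding left at_map
      by (rule poly_eqI)
        (simp add: leibniz_prime_power[OF p] coeff_sum sum.distrib sum_distrib_left sum_distrib_right algebra_simps)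
    then show ?thesis using zero by simp
  qed
  have "map_poly \<delta> (monom a i) = monom (\<delta> a) i" for a i
    by (rule poly_eqI) (simp add: coeff_map_poly coeff_monom)
  then have "map_poly \<delta> g = 0"
    using c by (simp add: g map_poly_deriv_add map_poly_deriv_sum)
  then have "T g = g \<star> monom 1 1"
    unfolding t_times_def dmult_monom_right by (simp add: monom_Suc monom_0)
  then have T: "g \<star> T r = T (g \<star> r)" for r
    using dmult_assoc[of g "monom 1 1" r] T_dmult[of g r] dmult_t_left[of r] by simp
  \<comment> \<open>The extra factor r is needed because the recursion on q passes from r to t
    r.\<close>
  have "g \<star> (q \<star> r) = q \<star> (g \<star> r)" for r
    by (induction q arbitrary: r) (simp_all add: dmult_pCons dmult_add_right smult T)
  from this[of 1] show ?thesis by simp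
qed

text \<open>Scale h to be monic. Differentiating the relation h(delta) = 0 shows that the polynomial
  with differentiated coefficients also annihilates K, and the monic top term disappears from it.
  Either it is nonzero of smaller degree, or the coefficients lie in F and minimality of g
  applies.\<close>

lemma min_poly_degree_le:
  assumes Const: "Const \<delta> = F" and g: "is_minimum_polynomial F \<delta> g"
    and h: "h \<noteq> 0" "\<forall>a. poly_at_map h \<delta> a = 0"
  shows "degree g \<le> degree h"
  using h
proof (induction "degree h" arbitrary: h rule: less_induct)
  case less
  define h' where "h' = Polynomial.smult (1 / lead_coeff h) h"
  have h': "degree h' = degree h" "lead_coeff h' = 1" "h' \<noteq> 0" "\<forall>a. poly_at_map h' \<delta> a = 0"
    using less(2,3) by (simp_all add: h'_def poly_at_map_smult)
  let ?D = "map_poly \<delta> h'"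
  have D: "\<forall>a. poly_at_map ?D \<delta> a = 0"
    using deriv_poly_at_map[of h'] h'(4) by simp
  show ?case
  proof (cases "?D = 0")
    case True
    then have "\<delta> (coeff h' i) = 0" for i
      by (simp add: poly_eq_iff coeff_map_poly)
    then have "range (coeff h') \<subseteq> F"
      using Const by (auto simp: Const_def)
    then have "h' \<in> polys_over F"
      by (simp add: polys_over_def range_coeff)
    then show ?thesis
      using g h' by (auto simp: is_minimum_polynomial_def)
  next
    case False
    have "coeff ?D (degree h') = 0"
      using h'(2) by (simp add: coeff_map_poly)
    moreover have "degree ?D \<le> degree h'" by (rule map_poly_degree_leq)
    ultimately have "degree ?D < degree h'"
      using False by (metis le_neq_implies_less leading_coeff_0_iff)
    then show ?thesis
      using less(1)[of ?D] False D h'(1) by simp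
  qed
qed

end

section \<open>The reduced norm of a differential polynomial\<close>

lemma dimension_imp_spanning_list:
  fixes F :: "'k::field set"
  assumes F: "subfield F (class_ring :: 'k ring)"
    and dim: "ring.dimension (class_ring :: 'k ring) n F UNIV"
  obtains bs :: "'k list" where "length bs = n"
    "\<And>a. \<exists>c. (\<forall>s<n. c s \<in> F) \<and> a = (\<Sum>s<n. c s * bs ! s)"
proof -
  have ring: "ring (class_ring :: 'k ring)"
    by (rule field.is_ring[OF class_field])
  obtain bs where bs: "length bs = n" "ring.Span (class_ring :: 'k ring) F bs = UNIV"
    using ring.exists_base[OF ring F dim] by auto
  have combine: "ring.combine (class_ring :: 'k ring) Ks Us = (\<Sum>s<length Us. Ks ! s * Us ! s)"
    if "length Ks = length Us" for Ks Us :: "'k list"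
    using that
    by (induction Ks Us rule: list_induct2)
      (simp_all add: ring.combine.simps[OF ring] sum.lessThan_Suc_shift del: sum.lessThan_Suc)
  have "\<exists>c. (\<forall>s<n. c s \<in> F) \<and> a = (\<Sum>s<n. c s * bs ! s)" for a
  proof -
    have "a \<in> ring.Span (class_ring :: 'k ring) F bs"
      by (simp only: bs(2) UNIV_I)
    then obtain Ks where "set Ks \<subseteq> F" "length Ks = length bs" "a = ring.combine (class_ring :: 'k ring) Ks bs"
      using ring.Span_mem_iff_length_version[OF ring F, of bs a] by auto
    then show ?thesis
      using bs(1) by (intro exI[of _ "\<lambda>s. Ks ! s"]) (auto simp: combine)
  qed
  with bs(1) show thesis by (rule that)
qed

theorem theorem18:
  fixes F :: "'k::field set"
    and \<delta> :: "'k \<Rightarrow> 'k"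
    and p e :: nat
    and c :: "nat \<Rightarrow> 'k"
    and g x :: "'k poly"
    and N :: "'k poly \<Rightarrow> ('k poly \<times> 'k poly) set"
  assumes "prime p" and "CHAR('k) = p"
    and "subfield F (class_ring :: 'k ring)"
    and "purely_inseparable_exponent_one F"
    and "ring.dimension (class_ring :: 'k ring) (p ^ e) F UNIV"
    and "algebraic_derivation F \<delta>"
    and "Const \<delta> = F"
    and "is_minimum_polynomial F \<delta> g"
    and "\<forall>i \<in> {1..e}. c i \<in> F"
    and "g = monom 1 (p ^ e) + (\<Sum>i = 1..e. monom (c i) (p ^ (e - i)))"
    and "x = g"
    and "\<And>f. N f = reduced_norm TYPE('k poly fract)
           (central_quotients \<delta> F x) (central_fractions \<delta> F x) (p ^ e) (embed \<delta> F x f)"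
  shows "(\<forall>f. \<exists>h \<in> polys_in \<delta> F x. N f = embed \<delta> F x h \<and>
            (\<exists>q. h = q \<otimes>\<^bsub>diff_poly_ring \<delta>\<^esub> f \<and> h = f \<otimes>\<^bsub>diff_poly_ring \<delta>\<^esub> q)) \<and>
         (\<forall>f m. f \<noteq> 0 \<and> degree f = m \<longrightarrow>
            (\<exists>h \<in> polys_over F. (\<forall>i \<ge> m. coeff h i = 0) \<and>
               N f = embed \<delta> F x
                 ([:(-1) ^ (m * (p ^ e - 1)) * coeff f m ^ (p ^ e):]
                    \<otimes>\<^bsub>diff_poly_ring \<delta>\<^esub> (x [^]\<^bsub>diff_poly_ring \<delta>\<^esub> m)
                  \<oplus>\<^bsub>diff_poly_ring \<delta>\<^esub> poly_at \<delta> x h)))"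
proof -
  interpret derivation \<delta>
    using assms(6) by unfold_locales (simp add: algebraic_derivation_def)
  obtain bs where bs: "length bs = p ^ e"
    "\<And>a. \<exists>d. (\<forall>s<p ^ e. d s \<in> F) \<and> a = (\<Sum>s<p ^ e. d s * bs ! s)"
    using dimension_imp_spanning_list[OF assms(3,5)] by blast
  have lead: "lead_coeff g = 1" and zero: "\<forall>a. poly_at_map g \<delta> a = 0"
    using assms(8) by (auto simp: is_minimum_polynomial_def)
  have degree_g: "degree g = p ^ e"
  proof -
    have "degree (monom (c i) (p ^ (e - i))) \<le> p ^ e - 1" if "i \<in> {1..e}" for i
    proof -
      have "p ^ (e - i) < p ^ e"
        using that prime_gt_1_nat[OF assms(1)] by (intro power_strict_increasing) auto
      then show ?thesis
        using degree_monom_le[of "c i" "p ^ (e - i)"] by linarith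
    qed
    then have "degree (\<Sum>i = 1..e. monom (c i) (p ^ (e - i))) \<le> p ^ e - 1"
      by (intro degree_sum_le) auto
    also have "\<dots> < p ^ e"
      using prime_gt_0_nat[OF assms(1)] by simp
    finally show ?thesis
      unfolding assms(10) by (subst degree_add_eq_left) (simp_all add: degree_monom_eq)
  qed
  have "g \<star> q = q \<star> g" for q
    by (rule min_poly_central[OF assms(1,2,10) _ zero]) (use assms(7,9) in \<open>auto simp: Const_def\<close>)
  moreover have "\<exists>a. poly_at_map h \<delta> a \<noteq> 0" if "h \<noteq> 0" "degree h < p ^ e" for h
    using min_poly_degree_le[OF assms(7,8), of h] that degree_g by auto
  moreover have "a ^ p \<in> F" for a
    using assms(2,4) by (simp add: purely_inseparable_exponent_one_def)
  ultimately interpret differential_extension \<delta> F x "p ^ e" p e bs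
    using assms(1,2,7) lead degree_g bs by unfold_locales (simp_all add: assms(11))
  have N: "N f = emb (P (det (M f)))" for f
    unfolding assms(12) by (rule reduced_norm_eq)
  show ?thesis
  proof (intro conjI allI impI)
    fix f
    have "P (det (M f)) \<in> polys_in \<delta> F x"
      unfolding polys_in_def using det_M_over by blast
    then show "\<exists>h \<in> polys_in \<delta> F x. N f = embed \<delta> F x h \<and>
        (\<exists>q. h = q \<otimes>\<^bsub>diff_poly_ring \<delta>\<^esub> f \<and> h = f \<otimes>\<^bsub>diff_poly_ring \<delta>\<^esub> q)"
      using divides_norm[of f] N[of f] unfolding R_simps by (intro bexI conjI)
  next
    fix f :: "'k poly" and m assume "f \<noteq> 0 \<and> degree f = m"
    then have f: "degree f = m" "f \<noteq> 0" by simp_all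
    let ?a = "coeff f m ^ p ^ e"
    define h where "h = det (M f) - monom ?a m"
    have coeff_h: "coeff h i = coeff (det (M f)) i - (if i = m then ?a else 0)" for i
      by (simp add: h_def)
    have h_zero: "\<forall>i\<ge>m. coeff h i = 0"
      using det_M_top[OF f] by (auto simp: coeff_h coeff_eq_0)
    moreover have "h \<in> polys_over F"
    proof -
      have "coeff h i \<in> F" for i
      proof (cases "i = m")
        case True
        then show ?thesis using h_zero by (simp add: in_F_iff)
      next
        case False
        then show ?thesis
          using det_M_over[of f] by (simp add: coeff_h polys_over_iff)
      qed
      then show ?thesis by (simp add: polys_over_iff)
    qed
    moreover have "[:(-1) ^ (m * (p ^ e - 1)) * ?a:] \<star> (x \<up> m) + P h = P (det (M f))"
      unfolding sign_eq_1 using P_add[of "monom ?a m" h] by (simp add: P_monom h_def)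
    ultimately show "\<exists>h \<in> polys_over F. (\<forall>i \<ge> m. coeff h i = 0) \<and>
        N f = embed \<delta> F x
          ([:(-1) ^ (m * (p ^ e - 1)) * coeff f m ^ (p ^ e):]
             \<otimes>\<^bsub>diff_poly_ring \<delta>\<^esub> (x [^]\<^bsub>diff_poly_ring \<delta>\<^esub> m)
           \<oplus>\<^bsub>diff_poly_ring \<delta>\<^esub> poly_at \<delta> x h)"
      using N[of f] unfolding R_simps by (intro bexI[of _ h] conjI) simp_all
  qed
qed

end
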